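(* Assume (NR), (FR) and (NS). Let $F\subset V^{( * )}$ be the set of monodromy matrices and $\mathcal F$ its image in the geometric quotient $V^{( * )}/H$. Then: (i) the map $F\to\mathcal F$ is a geometric quotient of $F$ by $H$; (ii) the monodromy data space $\mathcal F$ is a separated variety.
   Context: Conventions. Varieties are algebraic varieties over $\mathbf C$: reduced, not necessarily affine, irreducible or separated. Fix $q\in\mathbf C^*$, $|q|<1$; for $c,d\in\mathbf C^*$ write $c\equiv d$ iff $c/d\in q^{\mathbf Z}$. Parameters: $\rho_1,\rho_2,\sigma_1,\sigma_2,x_1,x_2,x_3,x_4\in\mathbf C^*$, with conditions: (NR) $\rho_1\not\equiv\rho_2$, $\sigma_1\not\equiv\sigma_2$, and $x_k\not\equiv x_l$ for $k\ne l$; (FR) $x_1x_2x_3x_4=\rho_1\rho_2/(\sigma_1\sigma_2)$; (NS) $\rho_i/\sigma_j\not\equiv x_kx_l$ for all $i,j\in\{1,2\}$ and all $k\neq l$. Let $\mathcal O(\mathbf C^* )$ be the ring of holomorphic functions on $\mathbf C^*$ and $V_{i,j}:=\{m\in\mathcal O(\mathbf C^* )\mid m(qx)=(\rho_i/\sigma_j)x^{-2}m(x)\}$, a complex vector space of dimension 2. Put $V:=\prod_{1\le i,j\le2}V_{i,j}$ (elements written as $2\times2$ matrices $M=(m_{i,j})$) and $V^{( * )}:=\prod_{i,j}(V_{i,j}\setminus\{0\})$. Let $D_2(\mathbf C)$ be the group of invertible diagonal $2\times 2$ matrices; the torus $H:=(D_2(\mathbf C)\times D_2(\mathbf C))/\mathbf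 C^*(I_2,I_2)$ acts on $V$ by $(\Gamma,\Delta).M=\Gamma M\Delta^{-1}$. There is a geometric quotient $V^{( * )}\to V^{( * )}/H$. $F:=\{M\in V\mid \det M\not\equiv0 \text{ (as a function) and } \det M(x_k)=0,\ k=1,2,3,4\}$; this is an $H$-stable locally closed subset of $V$, contained in $V^{( * )}$ when (NR), (FR) and (NS) hold. $\mathcal F$ is the image of $F$ in $V^{( * )}/H$, with the structure of subvariety of $V^{( * )}/H$. Geometric quotient: for an algebraic group $G$ acting on a variety $X$, a good quotient is an affine, surjective, $G$-invariant morphism $\phi:X\to Y$ such that for every open $U\subset Y$ the map $\mathbf C[U]\to\mathbf C[\phi^{-1}(U)]^G$ is an isomorphism, images of closed $G$-invariant subsets are closed, and disjoint closed $G$-invariant subsets have disjoint images. It is a geometric quotient if moreover its fibers are exactly the $G$-orbits. *)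

theory Defs
  imports
    "HOL-Analysis.Analysis"
    "HOL-Algebra.Group_Action"
    "HOL-Library.Function_Algebras"
begin

section \<open>Spaces with functions\<close>

text \<open>
  A reduced variety over the complex numbers is encoded in the sense of Serre: a topological space
  with a sheaf of complex-valued functions that has a finite open cover by affine algebraic sets.
  Elements of \<open>reg X U\<close> are extensional functions on the open set \<open>U\<close>, so
  that \<open>reg X U\<close> really is the set \<open>C[U]\<close> (values at nonopen \<open>U\<close> are irrelevant).
\<close>

record 'a fspace =
  topo :: "'a topology"
  reg :: "'a set \<Rightarrow> ('a \<Rightarrow> complex) set"

definition pts :: "'a fspace \<Rightarrow> 'a set" where
  "pts X = topspace (topo X)"

definition sheaf_of_functions :: "'a fspace \<Rightarrow> bool" where
  "sheaf_of_functions X \<longleftrightarrow>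
     (\<forall>U f. openin (topo X) U \<longrightarrow>
        (f \<in> reg X U \<longleftrightarrow>
           f \<in> extensional U \<and>
           (\<forall>x\<in>U. \<exists>W. openin (topo X) W \<and> x \<in> W \<and> W \<subseteq> U \<and> restrict f W \<in> reg X W))) \<and>
     (\<forall>U W f. openin (topo X) U \<longrightarrow> openin (topo X) W \<longrightarrow> W \<subseteq> U \<longrightarrow> f \<in> reg X U \<longrightarrow>
        restrict f W \<in> reg X W)"

definition pullback :: "'a fspace \<Rightarrow> ('a \<Rightarrow> 'b) \<Rightarrow> 'b set \<Rightarrow> ('b \<Rightarrow> complex) \<Rightarrow> 'a \<Rightarrow> complex" where
  "pullback X \<phi> U f = restrict (f \<circ> \<phi>) {x \<in> pts X. \<phi> x \<in> U}"

definition morphism :: "'a fspace \<Rightarrow> 'b fspace \<Rightarrow> ('a \<Rightarrow> 'b) \<Rightarrow> bool" where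
  "morphism X Y \<phi> \<longleftrightarrow>
     continuous_map (topo X) (topo Y) \<phi> \<and>
     (\<forall>U f. openin (topo Y) U \<longrightarrow> f \<in> reg Y U \<longrightarrow>
        pullback X \<phi> U f \<in> reg X {x \<in> pts X. \<phi> x \<in> U})"

definition isomorphism :: "'a fspace \<Rightarrow> 'b fspace \<Rightarrow> ('a \<Rightarrow> 'b) \<Rightarrow> bool" where
  "isomorphism X Y \<phi> \<longleftrightarrow>
     morphism X Y \<phi> \<and>
     (\<exists>\<psi>. morphism Y X \<psi> \<and> (\<forall>x\<in>pts X. \<psi> (\<phi> x) = x) \<and> (\<forall>y\<in>pts Y. \<phi> (\<psi> y) = y))"

text \<open>The structure induced on a subset; this is the subvariety structure if \<open>Z\<close> is locally closed.\<close>

definition subspace_of :: "'a fspace \<Rightarrow> 'a set \<Rightarrow> 'a fspace" where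
  "subspace_of X Z =
     \<lparr> topo = subtopology (topo X) Z,
       reg = (\<lambda>U. {f \<in> extensional U. \<forall>x\<in>U. \<exists>W g. openin (topo X) W \<and> x \<in> W \<and> g \<in> reg X W \<and>
                     (\<forall>y\<in>W \<inter> U. f y = g y)}) \<rparr>"

definition quotient_space :: "'a fspace \<Rightarrow> ('a \<Rightarrow> 'b) \<Rightarrow> 'b fspace" where
  "quotient_space X \<pi> =
     \<lparr> topo = topology (\<lambda>U. U \<subseteq> \<pi> ` pts X \<and> openin (topo X) {x \<in> pts X. \<pi> x \<in> U}),
       reg = (\<lambda>U. {f \<in> extensional U. pullback X \<pi> U f \<in> reg X {x \<in> pts X. \<pi> x \<in> U}}) \<rparr>"

lemma openin_quotient_space:
  "openin (topo (quotient_space X \<pi>)) U \<longleftrightarrow>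
     U \<subseteq> \<pi> ` pts X \<and> openin (topo X) {x \<in> pts X. \<pi> x \<in> U}"
proof -
  have "istopology (\<lambda>U. U \<subseteq> \<pi> ` pts X \<and> openin (topo X) {x \<in> pts X. \<pi> x \<in> U})"
    unfolding istopology_def
  proof (intro conjI allI impI, goal_cases)
    case (2 S T)
    then have "openin (topo X) ({x \<in> pts X. \<pi> x \<in> S} \<inter> {x \<in> pts X. \<pi> x \<in> T})" by blast
    also have "{x \<in> pts X. \<pi> x \<in> S} \<inter> {x \<in> pts X. \<pi> x \<in> T} = {x \<in> pts X. \<pi> x \<in> S \<inter> T}" by blast
    finally show ?case .
  next
    case (4 K)
    then have "openin (topo X) (\<Union>S\<in>K. {x \<in> pts X. \<pi> x \<in> S})" by blast
    also have "(\<Union>S\<in>K. {x \<in> pts X. \<pi> x \<in> S}) = {x \<in> pts X. \<pi> x \<in> \<Union>K}" by blast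
    finally show ?case .
  qed blast+
  then show ?thesis
    by (simp add: quotient_space_def)
qed

lemma pts_quotient_space: "pts (quotient_space X \<pi>) = \<pi> ` pts X"
proof -
  have "{x \<in> pts X. \<pi> x \<in> \<pi> ` pts X} = pts X" by blast
  then have "openin (topo (quotient_space X \<pi>)) (\<pi> ` pts X)"
    unfolding openin_quotient_space by (simp add: pts_def)
  then have "\<pi> ` pts X \<subseteq> pts (quotient_space X \<pi>)"
    unfolding pts_def by (rule openin_subset)
  moreover have "openin (topo (quotient_space X \<pi>)) (pts (quotient_space X \<pi>))"
    by (simp add: pts_def)
  then have "pts (quotient_space X \<pi>) \<subseteq> \<pi> ` pts X"
    unfolding openin_quotient_space by (rule conjunct1)
  ultimately show ?thesis by blast
qed


section \<open>Zariski structures and affine spaces\<close>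

inductive_set algebra_generated_by :: "('a \<Rightarrow> complex) set \<Rightarrow> ('a \<Rightarrow> complex) set"
  for G :: "('a \<Rightarrow> complex) set" where
  gen: "g \<in> G \<Longrightarrow> g \<in> algebra_generated_by G"
| const: "(\<lambda>_. c) \<in> algebra_generated_by G"
| add: "a \<in> algebra_generated_by G \<Longrightarrow> b \<in> algebra_generated_by G \<Longrightarrow>
    (\<lambda>x. a x + b x) \<in> algebra_generated_by G"
| mult: "a \<in> algebra_generated_by G \<Longrightarrow> b \<in> algebra_generated_by G \<Longrightarrow>
    (\<lambda>x. a x * b x) \<in> algebra_generated_by G"

text \<open>
  The set \<open>S\<close> with the Zariski topology of an algebra \<open>A\<close> of functions; regular functions are
  locally quotients of elements of \<open>A\<close>.
\<close>

definition zariski_space :: "'a set \<Rightarrow> ('a \<Rightarrow> complex) set \<Rightarrow> 'a fspace" where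
  "zariski_space S A =
     (let T = topology_generated_by {{x \<in> S. a x \<noteq> 0} | a. a \<in> A} in
      \<lparr> topo = T,
        reg = (\<lambda>U. {f \<in> extensional U. \<forall>x\<in>U. \<exists>W. openin T W \<and> x \<in> W \<and> W \<subseteq> U \<and>
                      (\<exists>a\<in>A. \<exists>b\<in>A. \<forall>y\<in>W. b y \<noteq> 0 \<and> f y = a y / b y)}) \<rparr>)"

text \<open>Points of affine n-space are the sequences supported in \<open>{..<n}\<close>.\<close>

definition affine_space :: "nat \<Rightarrow> (nat \<Rightarrow> complex) fspace" where
  "affine_space n =
     zariski_space {z. \<forall>i\<ge>n. z i = 0} (algebra_generated_by {\<lambda>z. z i | i. i < n})"

text \<open>
  A finite-dimensional complex vector space \<open>V\<close> as an affine space: its polynomial functions are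
  generated by the linear forms.
\<close>

definition linear_forms :: "(complex \<Rightarrow> 'a \<Rightarrow> 'a::ab_group_add) \<Rightarrow> 'a set \<Rightarrow> ('a \<Rightarrow> complex) set" where
  "linear_forms smul V =
     {l. (\<forall>v\<in>V. \<forall>w\<in>V. l (v + w) = l v + l w) \<and> (\<forall>c. \<forall>v\<in>V. l (smul c v) = c * l v)}"

definition vector_space_variety :: "(complex \<Rightarrow> 'a \<Rightarrow> 'a::ab_group_add) \<Rightarrow> 'a set \<Rightarrow> 'a fspace" where
  "vector_space_variety smul V = zariski_space V (algebra_generated_by (linear_forms smul V))"


section \<open>Varieties\<close>

definition affine_variety :: "'a fspace \<Rightarrow> bool" where
  "affine_variety X \<longleftrightarrow>
     (\<exists>n Z \<phi>. closedin (topo (affine_space n)) Z \<and>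
        isomorphism X (subspace_of (affine_space n) Z) \<phi>)"

definition variety :: "'a fspace \<Rightarrow> bool" where
  "variety X \<longleftrightarrow>
     sheaf_of_functions X \<and>
     (\<exists>\<U>. finite \<U> \<and> \<Union>\<U> = pts X \<and>
        (\<forall>U\<in>\<U>. openin (topo X) U \<and> affine_variety (subspace_of X U)))"

text \<open>
  The product of varieties: on a product \<open>U \<times> V\<close> of open sets one has the functions
  \<open>\<Sum>i. f i x * g i y\<close> with \<open>f i\<close>, \<open>g i\<close> regular; their nonvanishing loci form a basis of
  the topology and regular functions are locally quotients of them.
\<close>

definition tensor_functions ::
    "'a fspace \<Rightarrow> 'b fspace \<Rightarrow> 'a set \<Rightarrow> 'b set \<Rightarrow> ('a \<times> 'b \<Rightarrow> complex) set" where
  "tensor_functions X Y U V =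
     {h. \<exists>n::nat. \<exists>f g. (\<forall>i<n. f i \<in> reg X U \<and> g i \<in> reg Y V) \<and>
           h = (\<lambda>(x, y). \<Sum>i<n. f i x * g i y)}"

definition product_space :: "'a fspace \<Rightarrow> 'b fspace \<Rightarrow> ('a \<times> 'b) fspace" where
  "product_space X Y =
     (let T = topology_generated_by {{p \<in> U \<times> V. h p \<noteq> 0} | U V h.
                openin (topo X) U \<and> openin (topo Y) V \<and> h \<in> tensor_functions X Y U V} in
      \<lparr> topo = T,
        reg = (\<lambda>W. {f \<in> extensional W. \<forall>p\<in>W. \<exists>U V a b.
                 openin (topo X) U \<and> openin (topo Y) V \<and>
                 a \<in> tensor_functions X Y U V \<and> b \<in> tensor_functions X Y U V \<and>
                 p \<in> {r \<in> U \<times> V. b r \<noteq> 0} \<and> {r \<in> U \<times> V. b r \<noteq> 0} \<subseteq> W \<and>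
                 (\<forall>r\<in>U \<times> V. b r \<noteq> 0 \<longrightarrow> f r = a r / b r)}) \<rparr>)"

definition separated :: "'a fspace \<Rightarrow> bool" where
  "separated X \<longleftrightarrow> closedin (topo (product_space X X)) {(x, x) | x. x \<in> pts X}"

definition affine_morphism :: "'a fspace \<Rightarrow> 'b fspace \<Rightarrow> ('a \<Rightarrow> 'b) \<Rightarrow> bool" where
  "affine_morphism X Y \<phi> \<longleftrightarrow>
     morphism X Y \<phi> \<and>
     (\<exists>\<U>. \<Union>\<U> = pts Y \<and>
        (\<forall>U\<in>\<U>. openin (topo Y) U \<and> affine_variety (subspace_of Y U) \<and>
           affine_variety (subspace_of X {x \<in> pts X. \<phi> x \<in> U})))"


section \<open>Algebraic groups, actions and quotients\<close>

definition algebraic_group :: "('g, 'm) monoid_scheme \<Rightarrow> 'g fspace \<Rightarrow> bool" where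
  "algebraic_group G XG \<longleftrightarrow>
     group G \<and> variety XG \<and> pts XG = carrier G \<and>
     morphism (product_space XG XG) XG (\<lambda>(g, h). g \<otimes>\<^bsub>G\<^esub> h) \<and>
     morphism XG XG (\<lambda>g. inv\<^bsub>G\<^esub> g)"

text \<open>The restriction is needed because \<open>group_action\<close> requires extensional maps.\<close>

definition algebraic_action ::
    "('g, 'm) monoid_scheme \<Rightarrow> 'g fspace \<Rightarrow> ('g \<Rightarrow> 'a \<Rightarrow> 'a) \<Rightarrow> 'a fspace \<Rightarrow> bool" where
  "algebraic_action G XG \<alpha> X \<longleftrightarrow>
     algebraic_group G XG \<and> variety X \<and>
     group_action G (pts X) (\<lambda>g. restrict (\<alpha> g) (pts X)) \<and>
     morphism (product_space XG X) X (\<lambda>(g, x). \<alpha> g x)"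

definition invariant_subset :: "('g, 'm) monoid_scheme \<Rightarrow> ('g \<Rightarrow> 'a \<Rightarrow> 'a) \<Rightarrow> 'a set \<Rightarrow> bool" where
  "invariant_subset G \<alpha> Z \<longleftrightarrow> (\<forall>g\<in>carrier G. \<forall>z\<in>Z. \<alpha> g z \<in> Z)"

text \<open>
  Pullback of functions is always a homomorphism of algebras, so the fourth condition
  says that it is an isomorphism onto the algebra of invariants.
\<close>

definition good_quotient ::
    "('g, 'm) monoid_scheme \<Rightarrow> 'g fspace \<Rightarrow> ('g \<Rightarrow> 'a \<Rightarrow> 'a) \<Rightarrow> 'a fspace \<Rightarrow> 'b fspace \<Rightarrow>
      ('a \<Rightarrow> 'b) \<Rightarrow> bool" where
  "good_quotient G XG \<alpha> X Y \<phi> \<longleftrightarrow>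
     algebraic_action G XG \<alpha> X \<and> variety Y \<and>
     affine_morphism X Y \<phi> \<and>
     \<phi> ` pts X = pts Y \<and>
     (\<forall>g\<in>carrier G. \<forall>x\<in>pts X. \<phi> (\<alpha> g x) = \<phi> x) \<and>
     (\<forall>U. openin (topo Y) U \<longrightarrow>
        bij_betw (pullback X \<phi> U) (reg Y U)
          {f \<in> reg X {x \<in> pts X. \<phi> x \<in> U}.
             \<forall>g\<in>carrier G. \<forall>x\<in>{x \<in> pts X. \<phi> x \<in> U}. f (\<alpha> g x) = f x}) \<and>
     (\<forall>Z. closedin (topo X) Z \<longrightarrow> invariant_subset G \<alpha> Z \<longrightarrow> closedin (topo Y) (\<phi> ` Z)) \<and>
     (\<forall>Z Z'. closedin (topo X) Z \<longrightarrow> invariant_subset G \<alpha> Z \<longrightarrow>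
             closedin (topo X) Z' \<longrightarrow> invariant_subset G \<alpha> Z' \<longrightarrow>
             Z \<inter> Z' = {} \<longrightarrow> \<phi> ` Z \<inter> \<phi> ` Z' = {})"

definition geometric_quotient ::
    "('g, 'm) monoid_scheme \<Rightarrow> 'g fspace \<Rightarrow> ('g \<Rightarrow> 'a \<Rightarrow> 'a) \<Rightarrow> 'a fspace \<Rightarrow> 'b fspace \<Rightarrow>
      ('a \<Rightarrow> 'b) \<Rightarrow> bool" where
  "geometric_quotient G XG \<alpha> X Y \<phi> \<longleftrightarrow>
     good_quotient G XG \<alpha> X Y \<phi> \<and>
     (\<forall>x\<in>pts X. {x' \<in> pts X. \<phi> x' = \<phi> x} = orbit G \<alpha> x)"

text \<open>
  The orbit space, with the quotient topology and the invariant functions. Every geometric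
  quotient is canonically isomorphic to it, as shown next; hence, where a geometric quotient
  exists, the orbit space is its canonical model.
\<close>

definition orbit_space ::
    "('g, 'm) monoid_scheme \<Rightarrow> ('g \<Rightarrow> 'a \<Rightarrow> 'a) \<Rightarrow> 'a fspace \<Rightarrow> 'a set fspace" where
  "orbit_space G \<alpha> X = quotient_space X (orbit G \<alpha>)"

lemma geometric_quotient_iso_orbit_space:
  assumes gq: "geometric_quotient G XG \<alpha> X Y \<phi>"
  shows "\<exists>\<psi>. isomorphism Y (orbit_space G \<alpha> X) \<psi> \<and> (\<forall>x\<in>pts X. \<psi> (\<phi> x) = orbit G \<alpha> x)"
proof -
  define \<pi> where "\<pi> = orbit G \<alpha>"
  define Q where "Q = orbit_space G \<alpha> X"
  have Q: "Q = quotient_space X \<pi>" by (simp add: Q_def orbit_space_def \<pi>_def)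
  define \<psi> where "\<psi> = (\<lambda>y. {x \<in> pts X. \<phi> x = y})"
  define \<theta> where "\<theta> = (\<lambda>O'. \<phi> (SOME x. x \<in> O'))"
  have good: "good_quotient G XG \<alpha> X Y \<phi>"
    and fib: "\<And>x. x \<in> pts X \<Longrightarrow> {x' \<in> pts X. \<phi> x' = \<phi> x} = \<pi> x"
    using gq unfolding geometric_quotient_def \<pi>_def by blast+
  have act: "algebraic_action G XG \<alpha> X" and mor: "morphism X Y \<phi>" and vY: "variety Y"
    and surj: "\<phi> ` pts X = pts Y"
    and inv: "\<And>g x. g \<in> carrier G \<Longrightarrow> x \<in> pts X \<Longrightarrow> \<phi> (\<alpha> g x) = \<phi> x"
    and bij: "\<And>U. openin (topo Y) U \<Longrightarrow> bij_betw (pullback X \<phi> U) (reg Y U)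
          {f \<in> reg X {x \<in> pts X. \<phi> x \<in> U}.
             \<forall>g\<in>carrier G. \<forall>x\<in>{x \<in> pts X. \<phi> x \<in> U}. f (\<alpha> g x) = f x}"
    and clo: "\<And>Z. closedin (topo X) Z \<Longrightarrow> invariant_subset G \<alpha> Z \<Longrightarrow> closedin (topo Y) (\<phi> ` Z)"
  proof -
    note c = good[unfolded good_quotient_def]
    note c1 = c[THEN conjunct2]
    note c2 = c1[THEN conjunct2]
    note c3 = c2[THEN conjunct2]
    note c4 = c3[THEN conjunct2]
    note c5 = c4[THEN conjunct2]
    note c6 = c5[THEN conjunct2]
    show "algebraic_action G XG \<alpha> X" by (rule c[THEN conjunct1])
    show "variety Y" by (rule c1[THEN conjunct1])
    show "morphism X Y \<phi>" using c2[THEN conjunct1] unfolding affine_morphism_def by (rule conjunct1)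
    show "\<phi> ` pts X = pts Y" by (rule c3[THEN conjunct1])
    show "\<phi> (\<alpha> g x) = \<phi> x" if "g \<in> carrier G" "x \<in> pts X" for g x
      using c4[THEN conjunct1] that by blast
    show "bij_betw (pullback X \<phi> U) (reg Y U)
          {f \<in> reg X {x \<in> pts X. \<phi> x \<in> U}.
             \<forall>g\<in>carrier G. \<forall>x\<in>{x \<in> pts X. \<phi> x \<in> U}. f (\<alpha> g x) = f x}"
      if "openin (topo Y) U" for U
      by (rule c5[THEN conjunct1, THEN spec, THEN mp, OF that])
    show "closedin (topo Y) (\<phi> ` Z)" if "closedin (topo X) Z" "invariant_subset G \<alpha> Z" for Z
      by (rule c6[THEN conjunct1, THEN spec, THEN mp, THEN mp, OF that])
  qed
  have extY: "\<And>U f. openin (topo Y) U \<Longrightarrow> f \<in> reg Y U \<Longrightarrow> f \<in> extensional U"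
    using vY unfolding variety_def sheaf_of_functions_def by blast
  have cX: "\<alpha> g x \<in> pts X" if "g \<in> carrier G" "x \<in> pts X" for g x
  proof -
    interpret group_action G "pts X" "\<lambda>g. restrict (\<alpha> g) (pts X)"
      using act unfolding algebraic_action_def by blast
    show ?thesis using element_image[OF that refl] that by simp
  qed
  have mem: "x \<in> \<pi> x" if "x \<in> pts X" for x using fib[OF that] that by blast
  have eq_iff: "\<pi> x = \<pi> x' \<longleftrightarrow> \<phi> x = \<phi> x'" if "x \<in> pts X" "x' \<in> pts X" for x x'
  proof
    assume "\<pi> x = \<pi> x'"
    then have "x \<in> {x'' \<in> pts X. \<phi> x'' = \<phi> x'}"
      using mem[OF that(1)] unfolding fib[OF that(2)] by simp
    then show "\<phi> x = \<phi> x'" by simp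
  next
    assume "\<phi> x = \<phi> x'"
    then show "\<pi> x = \<pi> x'"
      using fib[OF that(1)] fib[OF that(2)] by simp
  qed
  have psi: "\<psi> (\<phi> x) = \<pi> x" if "x \<in> pts X" for x
    using fib[OF that] unfolding \<psi>_def .
  have chi: "\<theta> (\<pi> x) = \<phi> x" if "x \<in> pts X" for x
  proof -
    have "(SOME x'. x' \<in> \<pi> x) \<in> \<pi> x" using mem[OF that] by (rule someI)
    then show ?thesis using fib[OF that, symmetric] unfolding \<theta>_def by simp
  qed
  have ptsQ: "pts Q = \<pi> ` pts X" by (simp add: Q pts_quotient_space)
  have pi_inv: "\<pi> (\<alpha> g x) = \<pi> x" if "g \<in> carrier G" "x \<in> pts X" for g x
    using eq_iff[OF cX[OF that] that(2)] inv[OF that] by simp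
  have ex: "\<exists>x\<in>pts X. y = \<phi> x" if "y \<in> pts Y" for y
    using that unfolding surj[symmetric] by blast
  have exQ: "\<exists>x\<in>pts X. z = \<pi> x" if "z \<in> pts Q" for z
    using that unfolding ptsQ by blast
  have piQ: "\<pi> x \<in> pts Q" if "x \<in> pts X" for x unfolding ptsQ using that by blast
  have phiX: "\<phi> x \<in> pts Y" if "x \<in> pts X" for x using surj that by blast

  have openpsi: "openin (topo Y) {y \<in> pts Y. \<psi> y \<in> U}" if U: "openin (topo Q) U" for U
  proof -
    let ?Z = "pts X - {x \<in> pts X. \<pi> x \<in> U}"
    have "openin (topo X) {x \<in> pts X. \<pi> x \<in> U}" using U by (simp add: Q openin_quotient_space)
    then have "closedin (topo X) ?Z" unfolding pts_def by blast
    moreover have "invariant_subset G \<alpha> ?Z"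
      unfolding invariant_subset_def using pi_inv cX by auto
    ultimately have "closedin (topo Y) (\<phi> ` ?Z)" by (rule clo)
    then have "openin (topo Y) (pts Y - \<phi> ` ?Z)" unfolding pts_def by blast
    also have "pts Y - \<phi> ` ?Z = {y \<in> pts Y. \<psi> y \<in> U}"
    proof (rule Set.set_eqI)
      fix y show "y \<in> pts Y - \<phi> ` ?Z \<longleftrightarrow> y \<in> {y \<in> pts Y. \<psi> y \<in> U}"
      proof (cases "y \<in> pts Y")
        case True
        then obtain x where x: "x \<in> pts X" "y = \<phi> x" using surj by blast
        have "\<phi> x \<in> \<phi> ` ?Z \<longleftrightarrow> \<pi> x \<notin> U"
          using x(1) eq_iff by (auto simp: image_iff) metis
        then show ?thesis using x psi True by auto
      qed auto
    qed
    finally show ?thesis .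
  qed
  have "morphism Y Q \<psi>"
    unfolding morphism_def
  proof (intro conjI allI impI)
    show "continuous_map (topo Y) (topo Q) \<psi>"
      unfolding continuous_map_def
    proof (intro conjI allI impI)
      have "\<psi> y \<in> pts Q" if "y \<in> pts Y" for y
        using ex[OF that] piQ psi by auto
      then show "\<psi> \<in> topspace (topo Y) \<rightarrow> topspace (topo Q)" unfolding pts_def by blast
      show "openin (topo Y) {y \<in> topspace (topo Y). \<psi> y \<in> U}" if "openin (topo Q) U" for U
        using openpsi[OF that] unfolding pts_def .
    qed
    fix U f assume U: "openin (topo Q) U" and f: "f \<in> reg Q U"
    let ?W = "{y \<in> pts Y. \<psi> y \<in> U}"
    have W: "openin (topo Y) ?W" by (rule openpsi[OF U])
    have eqW: "{x \<in> pts X. \<phi> x \<in> ?W} = {x \<in> pts X. \<pi> x \<in> U}"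
      using psi phiX by auto
    have "pullback X \<pi> U f \<in> {f \<in> reg X {x \<in> pts X. \<phi> x \<in> ?W}.
             \<forall>g\<in>carrier G. \<forall>x\<in>{x \<in> pts X. \<phi> x \<in> ?W}. f (\<alpha> g x) = f x}"
      unfolding eqW using f pi_inv cX by (auto simp: Q quotient_space_def pullback_def)
    then obtain g where g: "g \<in> reg Y ?W" "pullback X \<phi> ?W g = pullback X \<pi> U f"
      using bij[OF W] unfolding bij_betw_def by (metis (no_types, lifting) imageE)
    have "g = pullback Y \<psi> U f"
    proof (rule extensionalityI[of _ ?W])
      show "g \<in> extensional ?W" using extY[OF W g(1)] .
      show "pullback Y \<psi> U f \<in> extensional ?W" by (simp add: pullback_def)
      fix y assume y: "y \<in> ?W"
      then obtain x where x: "x \<in> pts X" "y = \<phi> x" using surj by blast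
      have "pullback X \<phi> ?W g x = g y" "pullback X \<pi> U f x = f (\<pi> x)"
        using x y psi by (auto simp: pullback_def)
      then have "g y = f (\<pi> x)" using g(2) by simp
      then show "g y = pullback Y \<psi> U f y" using x y psi by (simp add: pullback_def)
    qed
    then show "pullback Y \<psi> U f \<in> reg Y ?W" using g(1) by simp
  qed
  moreover have "morphism Q Y \<theta>"
    unfolding morphism_def
  proof (intro conjI allI impI)
    have pre: "{x \<in> pts X. \<pi> x \<in> {z \<in> pts Q. \<theta> z \<in> U}} = {x \<in> pts X. \<phi> x \<in> U}" for U
      using chi piQ by auto
    show "continuous_map (topo Q) (topo Y) \<theta>"
      unfolding continuous_map_def
    proof (intro conjI allI impI)
      have "\<theta> z \<in> pts Y" if "z \<in> pts Q" for z using exQ[OF that] chi phiX by auto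
      then show "\<theta> \<in> topspace (topo Q) \<rightarrow> topspace (topo Y)" unfolding pts_def by blast
      fix U assume U: "openin (topo Y) U"
      have "openin (topo X) {x \<in> pts X. \<phi> x \<in> U}"
        using mor U unfolding morphism_def continuous_map_def pts_def by blast
      then have "openin (topo Q) {z \<in> pts Q. \<theta> z \<in> U}"
        using pre[of U] exQ unfolding Q openin_quotient_space by auto
      then show "openin (topo Q) {z \<in> topspace (topo Q). \<theta> z \<in> U}" unfolding pts_def .
    qed
    fix U f assume U: "openin (topo Y) U" and f: "f \<in> reg Y U"
    let ?W = "{z \<in> pts Q. \<theta> z \<in> U}"
    have "pullback X \<pi> ?W (pullback Q \<theta> U f) = pullback X \<phi> U f"
      unfolding pullback_def pre using chi piQ by (auto simp: restrict_def fun_eq_iff)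
    moreover have "pullback X \<phi> U f \<in> reg X {x \<in> pts X. \<phi> x \<in> U}"
      using mor U f unfolding morphism_def by blast
    ultimately have "pullback X \<pi> ?W (pullback Q \<theta> U f) \<in> reg X {x \<in> pts X. \<pi> x \<in> ?W}"
      by (simp only: pre)
    moreover have "pullback Q \<theta> U f \<in> extensional ?W" by (simp add: pullback_def)
    moreover have "reg Q ?W = {f \<in> extensional ?W. pullback X \<pi> ?W f \<in> reg X {x \<in> pts X. \<pi> x \<in> ?W}}"
      by (simp add: Q quotient_space_def)
    ultimately show "pullback Q \<theta> U f \<in> reg Q ?W" by blast
  qed
  moreover have "\<theta> (\<psi> y) = y" if "y \<in> pts Y" for y using ex[OF that] psi chi by auto
  moreover have "\<psi> (\<theta> z) = z" if "z \<in> pts Q" for z using exQ[OF that] psi chi by auto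
  ultimately have "isomorphism Y Q \<psi>" unfolding isomorphism_def by blast
  then show ?thesis using psi unfolding Q_def \<pi>_def by blast
qed


section \<open>Monodromy matrices\<close>

definition q_equiv :: "complex \<Rightarrow> complex \<Rightarrow> complex \<Rightarrow> bool" where
  "q_equiv q c d \<longleftrightarrow> (\<exists>n::int. c / d = q powi n)"

text \<open>
  Functions on the punctured plane are normalised by the value \<open>0\<close> at \<open>0\<close>. A matrix of functions
  is encoded as a matrix-valued function; the index type \<open>2\<close> has the elements \<open>1\<close> and \<open>2\<close>, and
  the index type \<open>4\<close> of the points \<open>x k\<close> has the elements \<open>1\<close>, \<open>2\<close>, \<open>3\<close>, \<open>4\<close>.
\<close>

definition Vij :: "complex \<Rightarrow> (2 \<Rightarrow> complex) \<Rightarrow> (2 \<Rightarrow> complex) \<Rightarrow> 2 \<Rightarrow> 2 \<Rightarrow> (complex \<Rightarrow> complex) set" where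
  "Vij q \<rho> \<sigma> i j =
     {m. m holomorphic_on (- {0}) \<and> m 0 = 0 \<and>
         (\<forall>x. x \<noteq> 0 \<longrightarrow> m (q * x) = (\<rho> i / \<sigma> j) * x powi (-2) * m x)}"

definition Vmat :: "complex \<Rightarrow> (2 \<Rightarrow> complex) \<Rightarrow> (2 \<Rightarrow> complex) \<Rightarrow> (complex \<Rightarrow> complex^2^2) set" where
  "Vmat q \<rho> \<sigma> = {M. \<forall>i j. (\<lambda>x. M x $ i $ j) \<in> Vij q \<rho> \<sigma> i j}"

definition Vstar :: "complex \<Rightarrow> (2 \<Rightarrow> complex) \<Rightarrow> (2 \<Rightarrow> complex) \<Rightarrow> (complex \<Rightarrow> complex^2^2) set" where
  "Vstar q \<rho> \<sigma> = {M. \<forall>i j. (\<lambda>x. M x $ i $ j) \<in> Vij q \<rho> \<sigma> i j - {\<lambda>x. 0}}"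

definition matrix_scale :: "complex \<Rightarrow> complex^2^2 \<Rightarrow> complex^2^2" where
  "matrix_scale c A = (\<chi> i j. c * A $ i $ j)"

definition Vmat_variety ::
    "complex \<Rightarrow> (2 \<Rightarrow> complex) \<Rightarrow> (2 \<Rightarrow> complex) \<Rightarrow> (complex \<Rightarrow> complex^2^2) fspace" where
  "Vmat_variety q \<rho> \<sigma> = vector_space_variety (\<lambda>c M x. matrix_scale c (M x)) (Vmat q \<rho> \<sigma>)"

definition Vstar_variety ::
    "complex \<Rightarrow> (2 \<Rightarrow> complex) \<Rightarrow> (2 \<Rightarrow> complex) \<Rightarrow> (complex \<Rightarrow> complex^2^2) fspace" where
  "Vstar_variety q \<rho> \<sigma> = subspace_of (Vmat_variety q \<rho> \<sigma>) (Vstar q \<rho> \<sigma>)"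

definition D2 :: "(complex^2^2) monoid" where
  "D2 = \<lparr> carrier = {A. (\<forall>i j. i \<noteq> j \<longrightarrow> A $ i $ j = 0) \<and> invertible A},
          mult = (**), one = mat 1 \<rparr>"

definition D2_variety :: "(complex^2^2) fspace" where
  "D2_variety = subspace_of (vector_space_variety matrix_scale UNIV) (carrier D2)"

definition scalar_pairs :: "((complex^2^2) \<times> (complex^2^2)) set" where
  "scalar_pairs = {(mat c, mat c) | c. c \<noteq> 0}"

definition H :: "((complex^2^2) \<times> (complex^2^2)) set monoid" where
  "H = (D2 \<times>\<times> D2) Mod scalar_pairs"

definition H_variety :: "((complex^2^2) \<times> (complex^2^2)) set fspace" where
  "H_variety = quotient_space (product_space D2_variety D2_variety)
     (\<lambda>g. scalar_pairs #>\<^bsub>D2 \<times>\<times> D2\<^esub> g)"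

text \<open>
  The action of a class \<open>h\<close> is that of any representative; they all give the same matrix, so
  that the image below is a singleton for \<open>h \<in> carrier H\<close>.
\<close>

definition H_act ::
    "((complex^2^2) \<times> (complex^2^2)) set \<Rightarrow> (complex \<Rightarrow> complex^2^2) \<Rightarrow> (complex \<Rightarrow> complex^2^2)" where
  "H_act h M = the_elem ((\<lambda>(\<Gamma>, \<Delta>). (\<lambda>x. \<Gamma> ** M x ** matrix_inv \<Delta>)) ` h)"

definition monodromy_matrices ::
    "complex \<Rightarrow> (2 \<Rightarrow> complex) \<Rightarrow> (2 \<Rightarrow> complex) \<Rightarrow> (4 \<Rightarrow> complex) \<Rightarrow> (complex \<Rightarrow> complex^2^2) set" where
  "monodromy_matrices q \<rho> \<sigma> x =
     {M \<in> Vmat q \<rho> \<sigma>. \<not> (\<forall>z. z \<noteq> 0 \<longrightarrow> det (M z) = 0) \<and> (\<forall>k. det (M (x k)) = 0)}"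

definition F_variety ::
    "complex \<Rightarrow> (2 \<Rightarrow> complex) \<Rightarrow> (2 \<Rightarrow> complex) \<Rightarrow> (4 \<Rightarrow> complex) \<Rightarrow> (complex \<Rightarrow> complex^2^2) fspace" where
  "F_variety q \<rho> \<sigma> x = subspace_of (Vmat_variety q \<rho> \<sigma>) (monodromy_matrices q \<rho> \<sigma> x)"

definition monodromy_data_space ::
    "complex \<Rightarrow> (2 \<Rightarrow> complex) \<Rightarrow> (2 \<Rightarrow> complex) \<Rightarrow> (4 \<Rightarrow> complex) \<Rightarrow> (complex \<Rightarrow> complex^2^2) set fspace" where
  "monodromy_data_space q \<rho> \<sigma> x =
     subspace_of (orbit_space H H_act (Vstar_variety q \<rho> \<sigma>))
       (orbit H H_act ` monodromy_matrices q \<rho> \<sigma> x)"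

definition NR :: "complex \<Rightarrow> (2 \<Rightarrow> complex) \<Rightarrow> (2 \<Rightarrow> complex) \<Rightarrow> (4 \<Rightarrow> complex) \<Rightarrow> bool" where
  "NR q \<rho> \<sigma> x \<longleftrightarrow> \<not> q_equiv q (\<rho> 1) (\<rho> 2) \<and> \<not> q_equiv q (\<sigma> 1) (\<sigma> 2) \<and>
     (\<forall>k l. k \<noteq> l \<longrightarrow> \<not> q_equiv q (x k) (x l))"

definition FR :: "(2 \<Rightarrow> complex) \<Rightarrow> (2 \<Rightarrow> complex) \<Rightarrow> (4 \<Rightarrow> complex) \<Rightarrow> bool" where
  "FR \<rho> \<sigma> x \<longleftrightarrow> x 1 * x 2 * x 3 * x 4 = \<rho> 1 * \<rho> 2 / (\<sigma> 1 * \<sigma> 2)"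

definition NS :: "complex \<Rightarrow> (2 \<Rightarrow> complex) \<Rightarrow> (2 \<Rightarrow> complex) \<Rightarrow> (4 \<Rightarrow> complex) \<Rightarrow> bool" where
  "NS q \<rho> \<sigma> x \<longleftrightarrow> (\<forall>i j k l. k \<noteq> l \<longrightarrow> \<not> q_equiv q (\<rho> i / \<sigma> j) (x k * x l))"

end

theory Submission
  imports Defs "HOL-Complex_Analysis.Complex_Singularities"
begin

text \<open>
  Evaluation at the points \<open>x 1\<close> and \<open>x 2\<close> identifies each \<open>V i j\<close> with the plane: by division by
  theta functions and Liouville's theorem, a nonzero element of \<open>V i j\<close> vanishes at no more than one
  of the \<open>x k\<close>. So \<open>V\<close> is an affine space with eight coordinates. By the same argument, a nonzero
  determinant that vanishes at \<open>x 1\<close>, ..., \<open>x 4\<close> has no zeros outside their classes; hence it suffices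
  to require that it be nonzero at one fixed point \<open>p\<close>, and \<open>F\<close> is affine.

  The torus scales the entries by \<open>c i j\<close> with \<open>c 1 1 * c 2 2 = c 1 2 * c 2 1\<close>. Where one chosen
  coordinate of each entry does not vanish, every orbit has exactly one element at which three of the
  four chosen coordinates are \<open>1\<close>. This gives regular sections of the orbit map over finitely many
  open sets, and with them affine charts of the orbit space.

  For \<open>a\<close>, \<open>b\<close> in \<open>{x 1, x 2}\<close> the functions \<open>m 1 1 a * m 2 2 b / det (M p)\<close> and
  \<open>m 1 2 a * m 2 1 b / det (M p)\<close> are invariant and regular on all of \<open>F\<close>. They separate the orbits,
  so the orbit space is separated.
\<close>

section \<open>Zariski structures\<close>

text \<open>The analytic input is one count. If \<open>f (q * x) * x ^ n = c * f x\<close> and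
  \<open>f\<close> vanishes at n inequivalent points, then division by n theta functions leaves a
  monomial; unless \<open>f\<close> is zero, \<open>c\<close> is equivalent to the product of the
  negatives of the points. For an entry, n = 2, and (NS) forbids exactly this; for the determinant,
  n = 4, and the count leaves room for no further zeros.

  On the algebraic side two quotient structures compete. The data space inherits its structure from
  the orbit space of \<open>Vstar\<close>, while (i) speaks of invariant functions on
  \<open>F\<close>, and such a function need not extend invariantly to a neighbourhood. The sections
  remove the obstacle: a local fraction composed with a section is invariant on a saturated open
  set.

  For separatedness the charts alone do not suffice, since gluing affine charts can produce a
  nonseparated space. The determinant at \<open>p\<close> supplies global functions: it is nowhere
  zero on \<open>F\<close> and has the same weight as both products of opposite entries, even when
  the two factors are evaluated at different points.\<close>

text \<open>Equality up to the irrelevant values of \<open>reg\<close> at sets that are not open.\<close>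

definition same_structure :: "'a fspace \<Rightarrow> 'a fspace \<Rightarrow> bool" (infix \<open>\<doteq>\<close> 50) where
  "X \<doteq> Y \<longleftrightarrow> topo X = topo Y \<and> (\<forall>U. openin (topo X) U \<longrightarrow> reg X U = reg Y U)"

lemma same_structureI:
  assumes "\<And>U. openin (topo X) U \<longleftrightarrow> openin (topo Y) U"
    and "\<And>U f. openin (topo X) U \<Longrightarrow> openin (topo Y) U \<Longrightarrow> f \<in> reg X U \<longleftrightarrow> f \<in> reg Y U"
  shows "X \<doteq> Y"
  using assms unfolding same_structure_def topology_eq by blast

lemma same_structure_refl: "X \<doteq> X"
  unfolding same_structure_def by simp

lemma same_structure_sym: "X \<doteq> Y \<Longrightarrow> Y \<doteq> X"
  unfolding same_structure_def by auto

lemma same_structure_trans [trans]: "X \<doteq> Y \<Longrightarrow> Y \<doteq> Z \<Longrightarrow> X \<doteq> Z"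
  unfolding same_structure_def by auto

lemma same_structure_pts: "X \<doteq> Y \<Longrightarrow> pts X = pts Y"
  unfolding same_structure_def pts_def by simp

lemma same_structure_openin: "X \<doteq> Y \<Longrightarrow> openin (topo X) U \<longleftrightarrow> openin (topo Y) U"
  unfolding same_structure_def by simp

lemma same_structure_reg: "X \<doteq> Y \<Longrightarrow> openin (topo X) U \<Longrightarrow> reg X U = reg Y U"
  unfolding same_structure_def by simp

text \<open>A genuine equality, because \<open>subspace_of\<close> consults the ambient
  \<open>reg\<close> only at open sets. The same happens for \<open>product_space\<close>.\<close>

lemma subspace_of_cong: "X \<doteq> Y \<Longrightarrow> subspace_of X Z = subspace_of Y Z"
  unfolding subspace_of_def same_structure_def
  by (auto intro!: ext) (metis, metis)

lemma tensor_functions_cong: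
  "X \<doteq> X' \<Longrightarrow> Y \<doteq> Y' \<Longrightarrow> openin (topo X) U \<Longrightarrow> openin (topo Y) V \<Longrightarrow>
    tensor_functions X Y U V = tensor_functions X' Y' U V"
  unfolding tensor_functions_def same_structure_def by auto

lemma product_space_cong:
  assumes "X \<doteq> X'" "Y \<doteq> Y'"
  shows "product_space X Y = product_space X' Y'"
proof -
  have t: "topo X' = topo X" "topo Y' = topo Y"
    using assms unfolding same_structure_def by auto
  have "tensor_functions X' Y' U V = tensor_functions X Y U V"
    if "openin (topo X) U" "openin (topo Y) V" for U V
    using tensor_functions_cong[OF assms that] by simp
  then show ?thesis
    unfolding product_space_def Let_def t by (simp cong: conj_cong)
qed

lemma separated_cong: "A \<doteq> B \<Longrightarrow> separated A \<longleftrightarrow> separated B"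
  unfolding separated_def using product_space_cong[of A B A B] same_structure_pts[of A B] by simp

lemma morphism_cong:
  assumes "X \<doteq> X'" "Y \<doteq> Y'"
  shows "morphism X Y \<phi> \<longleftrightarrow> morphism X' Y' \<phi>"
proof -
  have t: "topo X' = topo X" "topo Y' = topo Y" "pts X' = pts X"
    and rX: "\<And>U. openin (topo X) U \<Longrightarrow> reg X' U = reg X U"
    and rY: "\<And>U. openin (topo Y) U \<Longrightarrow> reg Y' U = reg Y U"
    using assms unfolding same_structure_def by (auto simp: pts_def)
  \<comment> \<open>Continuity comes first: the two structures on the source agree only at open
    sets, so the preimage of \<open>U\<close> must be known to be open.\<close>
  have "(\<forall>U f. openin (topo Y) U \<longrightarrow> f \<in> reg Y U \<longrightarrow>
        pullback X \<phi> U f \<in> reg X {x \<in> pts X. \<phi> x \<in> U}) \<longleftrightarrow>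
      (\<forall>U f. openin (topo Y) U \<longrightarrow> f \<in> reg Y' U \<longrightarrow>
        pullback X' \<phi> U f \<in> reg X' {x \<in> pts X. \<phi> x \<in> U})"
    if c: "continuous_map (topo X) (topo Y) \<phi>"
  proof -
    have "openin (topo X) {x \<in> pts X. \<phi> x \<in> U}" if "openin (topo Y) U" for U
      using c that unfolding continuous_map_def pts_def by blast
    then show ?thesis using rX rY by (simp add: pullback_def t)
  qed
  then show ?thesis unfolding morphism_def t by blast
qed

lemma isomorphism_cong:
  assumes "X \<doteq> X'" "Y \<doteq> Y'"
  shows "isomorphism X Y \<phi> \<longleftrightarrow> isomorphism X' Y' \<phi>"
  unfolding isomorphism_def morphism_cong[OF assms] morphism_cong[OF assms(2,1)]
    same_structure_pts[OF assms(1)] same_structure_pts[OF assms(2)] ..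

lemma affine_variety_cong:
  assumes "X \<doteq> X'"
  shows "affine_variety X \<longleftrightarrow> affine_variety X'"
  unfolding affine_variety_def isomorphism_cong[OF assms same_structure_refl] ..

lemma sheaf_of_functions_cong:
  assumes "X \<doteq> X'"
  shows "sheaf_of_functions X \<longleftrightarrow> sheaf_of_functions X'"
proof -
  have t: "topo X' = topo X" and r: "\<And>U. openin (topo X) U \<Longrightarrow> reg X' U = reg X U"
    using assms unfolding same_structure_def by auto
  show ?thesis
    unfolding sheaf_of_functions_def t by (simp add: r cong: conj_cong imp_cong)
qed

lemma variety_cong:
  assumes "X \<doteq> X'" "variety X"
  shows "variety X'"
  using assms sheaf_of_functions_cong[of X X'] subspace_of_cong[OF assms(1)]
    same_structure_pts[OF assms(1)] same_structure_openin[OF assms(1)]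
  unfolding variety_def by auto

lemma pullback_cong: "X \<doteq> X' \<Longrightarrow> pullback X = pullback X'"
  by (intro ext) (simp add: pullback_def same_structure_pts)

text \<open>Here only \<open>\<doteq>\<close> can be expected: at a set that is not open,
  \<open>reg\<close> of the quotient refers to a preimage that is not open either.\<close>

lemma quotient_space_cong:
  assumes "X \<doteq> X'"
  shows "quotient_space X \<pi> \<doteq> quotient_space X' \<pi>"
proof (rule same_structureI)
  show *: "openin (topo (quotient_space X \<pi>)) U \<longleftrightarrow> openin (topo (quotient_space X' \<pi>)) U" for U
    unfolding openin_quotient_space using same_structure_pts[OF assms] same_structure_openin[OF assms]
    by simp
  fix U f assume "openin (topo (quotient_space X \<pi>)) U"
  then have "openin (topo X) {x \<in> pts X. \<pi> x \<in> U}" unfolding openin_quotient_space by simp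
  then show "f \<in> reg (quotient_space X \<pi>) U \<longleftrightarrow> f \<in> reg (quotient_space X' \<pi>) U"
    by (simp add: quotient_space_def pullback_cong[OF assms] same_structure_pts[OF assms]
        same_structure_reg[OF assms])
qed

section \<open>Calculus of local fractions\<close>

abbreviation zar :: "'a set \<Rightarrow> ('a \<Rightarrow> complex) set \<Rightarrow> 'a fspace" where
  "zar S G \<equiv> zariski_space S (algebra_generated_by G)"

text \<open>
  The denominators are required to be nonzero only inside \<open>U\<close>, so that \<open>U\<close> is automatically open;
  openness itself is the case of the function \<open>1\<close>.
\<close>

definition locally_quotient ::
    "'a set \<Rightarrow> ('a \<Rightarrow> complex) set \<Rightarrow> 'a set \<Rightarrow> ('a \<Rightarrow> complex) \<Rightarrow> bool" where
  "locally_quotient S G U f \<longleftrightarrow>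
     (\<forall>x\<in>U. \<exists>a\<in>algebra_generated_by G. \<exists>b\<in>algebra_generated_by G. b x \<noteq> 0 \<and>
        {y \<in> S. b y \<noteq> 0} \<subseteq> U \<and> (\<forall>y\<in>S. b y \<noteq> 0 \<longrightarrow> f y = a y / b y))"

lemma locally_quotientI:
  assumes "\<And>x. x \<in> U \<Longrightarrow> \<exists>a b. a \<in> algebra_generated_by G \<and> b \<in> algebra_generated_by G \<and> b x \<noteq> 0 \<and>
        (\<forall>y\<in>S. b y \<noteq> 0 \<longrightarrow> y \<in> U \<and> f y = a y / b y)"
  shows "locally_quotient S G U f"
proof (unfold locally_quotient_def, intro ballI)
  fix x assume "x \<in> U"
  from assms[OF this] obtain a b where "a \<in> algebra_generated_by G" "b \<in> algebra_generated_by G" "b x \<noteq> 0"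
    "\<forall>y\<in>S. b y \<noteq> 0 \<longrightarrow> y \<in> U \<and> f y = a y / b y" by (elim exE conjE)
  then show "\<exists>a\<in>algebra_generated_by G. \<exists>b\<in>algebra_generated_by G. b x \<noteq> 0 \<and>
        {y \<in> S. b y \<noteq> 0} \<subseteq> U \<and> (\<forall>y\<in>S. b y \<noteq> 0 \<longrightarrow> f y = a y / b y)"
    by (intro bexI[of _ a] bexI[of _ b]) auto
qed

lemma locally_quotientE:
  assumes "locally_quotient S G U f" "x \<in> U"
  obtains a b where "a \<in> algebra_generated_by G" "b \<in> algebra_generated_by G" "b x \<noteq> 0"
    "\<forall>y\<in>S. b y \<noteq> 0 \<longrightarrow> y \<in> U" "\<forall>y\<in>S. b y \<noteq> 0 \<longrightarrow> f y = a y / b y"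
proof -
  obtain a b where *: "a \<in> algebra_generated_by G" "b \<in> algebra_generated_by G" "b x \<noteq> 0"
    "{y \<in> S. b y \<noteq> 0} \<subseteq> U" "\<forall>y\<in>S. b y \<noteq> 0 \<longrightarrow> f y = a y / b y"
    using assms(1)[unfolded locally_quotient_def, rule_format, OF assms(2)] by (elim bexE conjE)
  show ?thesis by (rule that[OF *(1-3) _ *(5)]) (use *(4) in auto)
qed

lemma locally_quotient_algebra: "a \<in> algebra_generated_by G \<Longrightarrow> locally_quotient S G S a"
  using algebra_generated_by.const[of 1 G]
  by (intro locally_quotientI exI[of _ a] exI[of _ "\<lambda>_. 1"] conjI) simp_all

lemma locally_quotient_gen: "g \<in> G \<Longrightarrow> locally_quotient S G S g"
  by (intro locally_quotient_algebra algebra_generated_by.gen)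

lemma locally_quotient_const: "locally_quotient S G S (\<lambda>_. c)"
  by (intro locally_quotient_algebra algebra_generated_by.const)

lemma locally_quotient_cong:
  assumes "locally_quotient S G U f" "\<And>x. x \<in> U \<Longrightarrow> f x = f' x"
  shows "locally_quotient S G U f'"
proof (rule locally_quotientI)
  fix x assume x: "x \<in> U"
  obtain a b where ab: "a \<in> algebra_generated_by G" "b \<in> algebra_generated_by G" "b x \<noteq> 0"
    "\<forall>y\<in>S. b y \<noteq> 0 \<longrightarrow> y \<in> U" "\<forall>y\<in>S. b y \<noteq> 0 \<longrightarrow> f y = a y / b y"
    using locally_quotientE[OF assms(1) x] .
  have "f' y = a y / b y" if "y \<in> S" "b y \<noteq> 0" for y
    using ab(4,5) assms(2)[of y] that by metis
  then show "\<exists>a b. a \<in> algebra_generated_by G \<and> b \<in> algebra_generated_by G \<and> b x \<noteq> 0 \<and>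
        (\<forall>y\<in>S. b y \<noteq> 0 \<longrightarrow> y \<in> U \<and> f' y = a y / b y)"
    using ab by blast
qed

lemma locally_quotient_add:
  assumes "locally_quotient S G U f" "locally_quotient S G W g"
  shows "locally_quotient S G (U \<inter> W) (\<lambda>x. f x + g x)"
proof (rule locally_quotientI)
  fix x assume x: "x \<in> U \<inter> W"
  then have xU: "x \<in> U" and xW: "x \<in> W" by auto
  obtain a b where ab: "a \<in> algebra_generated_by G" "b \<in> algebra_generated_by G" "b x \<noteq> 0"
    "\<forall>y\<in>S. b y \<noteq> 0 \<longrightarrow> y \<in> U" "\<forall>y\<in>S. b y \<noteq> 0 \<longrightarrow> f y = a y / b y"
    using locally_quotientE[OF assms(1) xU] .
  obtain c d where cd: "c \<in> algebra_generated_by G" "d \<in> algebra_generated_by G" "d x \<noteq> 0"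
    "\<forall>y\<in>S. d y \<noteq> 0 \<longrightarrow> y \<in> W" "\<forall>y\<in>S. d y \<noteq> 0 \<longrightarrow> g y = c y / d y"
    using locally_quotientE[OF assms(2) xW] .
  show "\<exists>a b. a \<in> algebra_generated_by G \<and> b \<in> algebra_generated_by G \<and> b x \<noteq> 0 \<and>
        (\<forall>y\<in>S. b y \<noteq> 0 \<longrightarrow> y \<in> U \<inter> W \<and> f y + g y = a y / b y)"
  proof (intro exI conjI)
    show "(\<lambda>y. a y * d y + c y * b y) \<in> algebra_generated_by G"
      "(\<lambda>y. b y * d y) \<in> algebra_generated_by G"
      using ab cd by (auto intro!: algebra_generated_by.add algebra_generated_by.mult)
  qed (use ab cd in \<open>auto simp: field_simps\<close>)
qed

lemma locally_quotient_mult: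
  assumes "locally_quotient S G U f" "locally_quotient S G W g"
  shows "locally_quotient S G (U \<inter> W) (\<lambda>x. f x * g x)"
proof (rule locally_quotientI)
  fix x assume x: "x \<in> U \<inter> W"
  then have xU: "x \<in> U" and xW: "x \<in> W" by auto
  obtain a b where ab: "a \<in> algebra_generated_by G" "b \<in> algebra_generated_by G" "b x \<noteq> 0"
    "\<forall>y\<in>S. b y \<noteq> 0 \<longrightarrow> y \<in> U" "\<forall>y\<in>S. b y \<noteq> 0 \<longrightarrow> f y = a y / b y"
    using locally_quotientE[OF assms(1) xU] .
  obtain c d where cd: "c \<in> algebra_generated_by G" "d \<in> algebra_generated_by G" "d x \<noteq> 0"
    "\<forall>y\<in>S. d y \<noteq> 0 \<longrightarrow> y \<in> W" "\<forall>y\<in>S. d y \<noteq> 0 \<longrightarrow> g y = c y / d y"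
    using locally_quotientE[OF assms(2) xW] .
  show "\<exists>a b. a \<in> algebra_generated_by G \<and> b \<in> algebra_generated_by G \<and> b x \<noteq> 0 \<and>
        (\<forall>y\<in>S. b y \<noteq> 0 \<longrightarrow> y \<in> U \<inter> W \<and> f y * g y = a y / b y)"
  proof (intro exI conjI)
    show "(\<lambda>y. a y * c y) \<in> algebra_generated_by G"
      "(\<lambda>y. b y * d y) \<in> algebra_generated_by G"
      using ab cd by (auto intro!: algebra_generated_by.mult)
  qed (use ab cd in auto)
qed


lemma locally_quotient_inverse:
  assumes "locally_quotient S G U f" "U \<subseteq> S"
  shows "locally_quotient S G {x \<in> U. f x \<noteq> 0} (\<lambda>x. inverse (f x))"
proof (rule locally_quotientI)
  fix x assume x: "x \<in> {x \<in> U. f x \<noteq> 0}"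
  then have xU: "x \<in> U" by auto
  obtain a b where ab: "a \<in> algebra_generated_by G" "b \<in> algebra_generated_by G" "b x \<noteq> 0"
    "\<forall>y\<in>S. b y \<noteq> 0 \<longrightarrow> y \<in> U" "\<forall>y\<in>S. b y \<noteq> 0 \<longrightarrow> f y = a y / b y"
    using locally_quotientE[OF assms(1) xU] .
  have "a x \<noteq> 0" using ab(3) ab(5) x assms(2) by auto
  show "\<exists>c d. c \<in> algebra_generated_by G \<and> d \<in> algebra_generated_by G \<and> d x \<noteq> 0 \<and>
      (\<forall>y\<in>S. d y \<noteq> 0 \<longrightarrow> y \<in> {x \<in> U. f x \<noteq> 0} \<and> inverse (f y) = c y / d y)"
  proof (intro exI conjI)
    \<comment> \<open>The fraction b / a is expanded by \<open>b\<close>, so that a nonzero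
      denominator still forces \<open>y\<close> into \<open>U\<close>.\<close>
    show "(\<lambda>y. b y * b y) \<in> algebra_generated_by G"
      "(\<lambda>y. a y * b y) \<in> algebra_generated_by G"
      using ab by (auto intro!: algebra_generated_by.mult)
  qed (use ab \<open>a x \<noteq> 0\<close> in auto)
qed

text \<open>Gluing, with no openness of \<open>W\<close> to supply: the denominators that witness
  \<open>locally_quotient\<close> on \<open>W\<close> already cut out sets inside
  \<open>W\<close>.\<close>

lemma locally_quotient_local:
  assumes "\<And>x. x \<in> U \<Longrightarrow> \<exists>W g. x \<in> W \<and> W \<subseteq> U \<and> locally_quotient S G W g \<and> (\<forall>y\<in>W. f y = g y)"
  shows "locally_quotient S G U f"
proof (rule locally_quotientI)
  fix x assume "x \<in> U"
  then obtain W g where W: "x \<in> W" "W \<subseteq> U" "locally_quotient S G W g" "\<forall>y\<in>W. f y = g y"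
    using assms by blast
  show "\<exists>a b. a \<in> algebra_generated_by G \<and> b \<in> algebra_generated_by G \<and> b x \<noteq> 0 \<and>
        (\<forall>y\<in>S. b y \<noteq> 0 \<longrightarrow> y \<in> U \<and> f y = a y / b y)"
  proof -
    obtain a b where ab: "a \<in> algebra_generated_by G" "b \<in> algebra_generated_by G" "b x \<noteq> 0"
    "\<forall>y\<in>S. b y \<noteq> 0 \<longrightarrow> y \<in> W" "\<forall>y\<in>S. b y \<noteq> 0 \<longrightarrow> g y = a y / b y"
    using locally_quotientE[OF W(3,1)] .
    then show ?thesis using W by (intro exI[of _ a] exI[of _ b]) auto
  qed
qed

section \<open>Open sets and regular functions of a Zariski space\<close>

text \<open>Principal open sets are closed under finite intersections, by multiplying denominators,
  so they form a basis. To be a union of them is to be a domain on which the constant 1 is locally a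
  fraction.\<close>

lemma openin_zar:
  "openin (topo (zar S G)) U \<longleftrightarrow> U \<subseteq> S \<and> locally_quotient S G U (\<lambda>_. 1)"
proof
  let ?B = "{{x \<in> S. a x \<noteq> 0} | a. a \<in> algebra_generated_by G}"
  have topo: "topo (zar S G) = topology_generated_by ?B"
    by (simp add: zariski_space_def Let_def)
  show "U \<subseteq> S \<and> locally_quotient S G U (\<lambda>_. 1)" if "openin (topo (zar S G)) U"
  proof -
    have "generate_topology_on ?B U"
      using that unfolding topo openin_topology_generated_by_iff .
    then show ?thesis
    proof (induction rule: generate_topology_on.induct)
      case Empty then show ?case by (simp add: locally_quotient_def)
    next
      case (Int a b)
      then show ?case using locally_quotient_mult[of S G a "\<lambda>_. 1" b "\<lambda>_. 1"] by auto
    next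
      case (UN K)
      have "locally_quotient S G (\<Union>K) (\<lambda>_. 1)"
      proof (rule locally_quotient_local)
        fix x assume "x \<in> \<Union>K"
        then obtain W where "W \<in> K" "x \<in> W" by auto
        with UN.IH show "\<exists>W g. x \<in> W \<and> W \<subseteq> \<Union>K \<and> locally_quotient S G W g \<and> (\<forall>y\<in>W. 1 = g y)"
          by (intro exI[of _ W] exI[of _ "\<lambda>_. 1"]) auto
      qed
      with UN.IH show ?case by blast
    next
      case (Basis s)
      then obtain a where a: "s = {x \<in> S. a x \<noteq> 0}" "a \<in> algebra_generated_by G" by auto
      then show ?case
        by (auto intro!: locally_quotientI exI[of _ a])
    qed
  qed
  show "openin (topo (zar S G)) U" if "U \<subseteq> S \<and> locally_quotient S G U (\<lambda>_. 1)"
  proof (subst openin_subopen, intro ballI)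
    fix x assume x: "x \<in> U"
    from that have l: "locally_quotient S G U (\<lambda>_. 1)" by simp
    obtain b where b: "b \<in> algebra_generated_by G" "b x \<noteq> 0"
      "\<forall>y\<in>S. b y \<noteq> 0 \<longrightarrow> y \<in> U" by (rule locally_quotientE[OF l x]) blast
    have "openin (topo (zar S G)) {x \<in> S. b x \<noteq> 0}"
      unfolding topo openin_topology_generated_by_iff using b by (intro generate_topology_on.Basis) auto
    then show "\<exists>T. openin (topo (zar S G)) T \<and> x \<in> T \<and> T \<subseteq> U"
      using b x that by (intro exI[of _ "{x \<in> S. b x \<noteq> 0}"]) auto
  qed
qed

lemma pts_zar: "pts (zar S G) = S"
proof -
  have "openin (topo (zar S G)) S" by (simp add: openin_zar locally_quotient_const)
  then have "S \<subseteq> pts (zar S G)" unfolding pts_def by (rule openin_subset)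
  moreover have "openin (topo (zar S G)) (pts (zar S G))" unfolding pts_def by simp
  then have "pts (zar S G) \<subseteq> S" unfolding openin_zar by simp
  ultimately show ?thesis by simp
qed

lemma locally_quotient_restrict:
  assumes "locally_quotient S G U f" "openin (topo (zar S G)) W" 
  shows "locally_quotient S G (U \<inter> W) f"
  using locally_quotient_mult[OF assms(1), of W "\<lambda>_. 1"] assms(2) unfolding openin_zar by simp

lemma locally_quotient_open:
  assumes "locally_quotient S G U f" "U \<subseteq> S" 
  shows "openin (topo (zar S G)) U" "openin (topo (zar S G)) {x \<in> U. f x \<noteq> 0}"
proof -
  show U: "openin (topo (zar S G)) U"
  proof (unfold openin_zar, intro conjI assms(2) locally_quotientI)
    fix x assume x: "x \<in> U"
    obtain b where "b \<in> algebra_generated_by G" "b x \<noteq> 0"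
      "\<forall>y\<in>S. b y \<noteq> 0 \<longrightarrow> y \<in> U" by (rule locally_quotientE[OF assms(1) x]) blast
    then show "\<exists>a b. a \<in> algebra_generated_by G \<and> b \<in> algebra_generated_by G \<and> b x \<noteq> 0 \<and>
        (\<forall>y\<in>S. b y \<noteq> 0 \<longrightarrow> y \<in> U \<and> 1 = a y / b y)" by (intro exI[of _ b] conjI) auto
  qed
  have "locally_quotient S G (U \<inter> {x \<in> U. f x \<noteq> 0}) (\<lambda>x. f x * inverse (f x))"
    by (intro locally_quotient_mult locally_quotient_inverse assms)
  moreover have "U \<inter> {x \<in> U. f x \<noteq> 0} = {x \<in> U. f x \<noteq> 0}" by auto
  ultimately have "locally_quotient S G {x \<in> U. f x \<noteq> 0} (\<lambda>x. f x * inverse (f x))" by simp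
  then have "locally_quotient S G {x \<in> U. f x \<noteq> 0} (\<lambda>x. 1)"
    by (rule locally_quotient_cong) auto
  then show "openin (topo (zar S G)) {x \<in> U. f x \<noteq> 0}" using assms(2) unfolding openin_zar by auto
qed

text \<open>In \<open>zariski_space\<close> the fraction is valid on some open \<open>W\<close>, and
  its denominator may be nonzero outside \<open>W\<close>. Intersecting with principal open subsets
  of \<open>W\<close> trades it for a denominator that is nonzero only inside
  \<open>U\<close>.\<close>

lemma reg_zar:
  assumes "openin (topo (zar S G)) U"
  shows "f \<in> reg (zar S G) U \<longleftrightarrow> f \<in> extensional U \<and> locally_quotient S G U f"
proof -
  let ?A = "algebra_generated_by G"
  have US: "U \<subseteq> S" using assms by (simp add: openin_zar)
  have r: "f \<in> reg (zar S G) U \<longleftrightarrow> f \<in> extensional U \<and> (\<forall>x\<in>U. \<exists>W. openin (topo (zar S G)) W \<and>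
     x \<in> W \<and> W \<subseteq> U \<and> (\<exists>a\<in>?A. \<exists>b\<in>?A. \<forall>y\<in>W. b y \<noteq> 0 \<and> f y = a y / b y))"
    by (simp add: zariski_space_def Let_def)
  show ?thesis
  proof (rule iffI, goal_cases)
    case 1
    have "locally_quotient S G U f"
    proof (rule locally_quotient_local)
      fix x assume "x \<in> U"
      then obtain W a b where W: "openin (topo (zar S G)) W" "x \<in> W" "W \<subseteq> U" "a \<in> ?A" "b \<in> ?A"
        "\<forall>y\<in>W. b y \<noteq> 0 \<and> f y = a y / b y" using 1 unfolding r by blast
      have "locally_quotient S G (S \<inter> {x \<in> S. b x \<noteq> 0}) (\<lambda>x. a x * inverse (b x))"
        by (intro locally_quotient_mult locally_quotient_inverse locally_quotient_algebra W order_refl)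
      then have "locally_quotient S G (S \<inter> {x \<in> S. b x \<noteq> 0} \<inter> W) (\<lambda>x. a x * inverse (b x))"
        using W(1) by (rule locally_quotient_restrict)
      moreover have "S \<inter> {x \<in> S. b x \<noteq> 0} \<inter> W = W" using W US by auto
      ultimately have "locally_quotient S G W (\<lambda>x. a x * inverse (b x))" by simp
      then show "\<exists>W g. x \<in> W \<and> W \<subseteq> U \<and> locally_quotient S G W g \<and> (\<forall>y\<in>W. f y = g y)"
        using W by (intro exI[of _ W] exI[of _ "\<lambda>x. a x * inverse (b x)"]) (auto simp: field_simps)
    qed
    then show ?case using 1 unfolding r by simp
  next
    case 2
    show ?case unfolding r
    proof (intro conjI ballI)
      fix x assume x: "x \<in> U"
      from 2 have l: "locally_quotient S G U f" by simp
      obtain a b where ab: "a \<in> ?A" "b \<in> ?A" "b x \<noteq> 0"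
        "\<forall>y\<in>S. b y \<noteq> 0 \<longrightarrow> y \<in> U" "\<forall>y\<in>S. b y \<noteq> 0 \<longrightarrow> f y = a y / b y"
        using locally_quotientE[OF l x] .
      have "openin (topo (zar S G)) {x \<in> S. b x \<noteq> 0}"
        by (intro locally_quotient_open(2) locally_quotient_algebra ab order_refl)
      then show "\<exists>W. openin (topo (zar S G)) W \<and> x \<in> W \<and> W \<subseteq> U \<and>
          (\<exists>a\<in>?A. \<exists>b\<in>?A. \<forall>y\<in>W. b y \<noteq> 0 \<and> f y = a y / b y)"
        using ab x US by (intro exI[of _ "{x \<in> S. b x \<noteq> 0}"] conjI bexI[of _ a] bexI[of _ b]) auto
    qed (use 2 in simp)
  qed
qed

lemma sheaf_of_functions_zar: "sheaf_of_functions (zar S G)"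
  unfolding sheaf_of_functions_def
proof (intro conjI allI impI)
  fix U W f assume *: "openin (topo (zar S G)) U" "openin (topo (zar S G)) W" "W \<subseteq> U" "f \<in> reg (zar S G) U"
  then have "locally_quotient S G (U \<inter> W) f"
    by (intro locally_quotient_restrict) (auto simp: reg_zar)
  then have "locally_quotient S G W f" using * by (simp add: Int_absorb1)
  then have "locally_quotient S G W (restrict f W)" by (rule locally_quotient_cong) auto
  then show "restrict f W \<in> reg (zar S G) W" using * by (auto simp: reg_zar)
next
  fix U f assume U: "openin (topo (zar S G)) U"
  show "f \<in> reg (zar S G) U \<longleftrightarrow> f \<in> extensional U \<and>
           (\<forall>x\<in>U. \<exists>W. openin (topo (zar S G)) W \<and> x \<in> W \<and> W \<subseteq> U \<and> restrict f W \<in> reg (zar S G) W)"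
    (is "?L \<longleftrightarrow> ?R")
  proof
    assume ?L then show ?R using U by (auto simp: reg_zar intro!: exI[of _ U] locally_quotient_cong[of S G U f "restrict f U"])
  next
    assume r: ?R
    have "locally_quotient S G U f"
    proof (rule locally_quotient_local)
      fix x assume "x \<in> U"
      then obtain W where W: "openin (topo (zar S G)) W" "x \<in> W" "W \<subseteq> U" "restrict f W \<in> reg (zar S G) W"
        using r by blast
      then have "locally_quotient S G W (restrict f W)" by (simp add: reg_zar)
      then show "\<exists>W g. x \<in> W \<and> W \<subseteq> U \<and> locally_quotient S G W g \<and> (\<forall>y\<in>W. f y = g y)"
        using W by (intro exI[of _ W] exI[of _ "restrict f W"]) auto
    qed
    then show ?L using r U by (simp add: reg_zar)
  qed
qed

section \<open>Morphisms, subspaces and change of generators\<close>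

text \<open>Pulling back functions needs a check on the generators of the target only: sums and
  products follow by induction over the algebra, fractions by inverting the pulled-back
  denominator.\<close>

lemma locally_quotient_comp:
  assumes \<phi>: "\<phi> \<in> U \<rightarrow> T" and U: "openin (topo (zar S G)) U"
    and gen: "\<And>k. k \<in> K \<Longrightarrow> locally_quotient S G U (\<lambda>x. k (\<phi> x))"
    and f: "locally_quotient T K W f"
  shows "locally_quotient S G {x \<in> U. \<phi> x \<in> W} (\<lambda>x. f (\<phi> x))"
proof -
  have US: "U \<subseteq> S" using U by (simp add: openin_zar)
  have alg: "locally_quotient S G U (\<lambda>x. a (\<phi> x))" if "a \<in> algebra_generated_by K" for a
    using that
  proof induction
    case (const c)
    then show ?case using locally_quotient_restrict[OF locally_quotient_const U] US by (simp add: Int_absorb1)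
  next
    case (add a b) then show ?case using locally_quotient_add[of S G U _ U] by simp
  next
    case (mult a b) then show ?case using locally_quotient_mult[of S G U _ U] by simp
  qed (rule gen)
  show ?thesis
  proof (rule locally_quotient_local)
    fix x assume x: "x \<in> {x \<in> U. \<phi> x \<in> W}"
    then have xW: "\<phi> x \<in> W" by simp
    obtain a b where ab: "a \<in> algebra_generated_by K" "b \<in> algebra_generated_by K" "b (\<phi> x) \<noteq> 0"
      "\<forall>y\<in>T. b y \<noteq> 0 \<longrightarrow> y \<in> W" "\<forall>y\<in>T. b y \<noteq> 0 \<longrightarrow> f y = a y / b y"
      using locally_quotientE[OF f xW] .
    let ?W = "{x \<in> U. b (\<phi> x) \<noteq> 0}"
    have "locally_quotient S G (U \<inter> ?W) (\<lambda>x. a (\<phi> x) * inverse (b (\<phi> x)))"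
      by (intro locally_quotient_mult locally_quotient_inverse alg ab US)
    moreover have "U \<inter> ?W = ?W" by auto
    ultimately have "locally_quotient S G ?W (\<lambda>x. a (\<phi> x) * inverse (b (\<phi> x)))" by simp
    then show "\<exists>V g. x \<in> V \<and> V \<subseteq> {x \<in> U. \<phi> x \<in> W} \<and> locally_quotient S G V g \<and> (\<forall>y\<in>V. f (\<phi> y) = g y)"
      using x ab \<phi> by (intro exI[of _ ?W] exI[of _ "\<lambda>x. a (\<phi> x) * inverse (b (\<phi> x))"])
         (auto simp: divide_inverse Pi_iff)
  qed
qed

lemma morphism_zar:
  assumes \<phi>: "\<phi> \<in> S \<rightarrow> T" and gen: "\<And>k. k \<in> K \<Longrightarrow> locally_quotient S G S (\<lambda>x. k (\<phi> x))"
  shows "morphism (zar S G) (zar T K) \<phi>"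
proof -
  have S: "openin (topo (zar S G)) S" by (simp add: openin_zar locally_quotient_const)
  note comp = locally_quotient_comp[where K = K, OF \<phi> S gen, simplified]
  have pre: "openin (topo (zar S G)) {x \<in> S. \<phi> x \<in> U}" if "openin (topo (zar T K)) U" for U
    using comp[of U "\<lambda>_. 1"] that unfolding openin_zar by auto
  show ?thesis
    unfolding morphism_def continuous_map_def pts_zar[unfolded pts_def] pts_zar
  proof (intro conjI allI impI \<phi> pre)
    fix U f assume U: "openin (topo (zar T K)) U" "f \<in> reg (zar T K) U"
    then have "locally_quotient T K U f" by (simp add: reg_zar)
    from comp[OF this] have "locally_quotient S G {x \<in> S. \<phi> x \<in> U} (pullback (zar S G) \<phi> U f)"
      by (rule locally_quotient_cong) (auto simp: pullback_def pts_zar)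
    then show "pullback (zar S G) \<phi> U f \<in> reg (zar S G) {x \<in> S. \<phi> x \<in> U}"
      using pre[OF U(1)] by (auto simp: reg_zar pullback_def pts_zar)
  qed
qed

lemma locally_quotient_subset:
  assumes "locally_quotient S G U f" "F \<subseteq> S"
  shows "locally_quotient F G (U \<inter> F) f"
proof (rule locally_quotientI)
  fix x assume x: "x \<in> U \<inter> F"
  then have xU: "x \<in> U" by simp
  obtain a b where ab: "a \<in> algebra_generated_by G" "b \<in> algebra_generated_by G" "b x \<noteq> 0"
    "\<forall>y\<in>S. b y \<noteq> 0 \<longrightarrow> y \<in> U" "\<forall>y\<in>S. b y \<noteq> 0 \<longrightarrow> f y = a y / b y"
    using locally_quotientE[OF assms(1) xU] .
  then show "\<exists>a b. a \<in> algebra_generated_by G \<and> b \<in> algebra_generated_by G \<and> b x \<noteq> 0 \<and>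
        (\<forall>y\<in>F. b y \<noteq> 0 \<longrightarrow> y \<in> U \<inter> F \<and> f y = a y / b y)"
    using assms(2) by (intro exI[of _ a] exI[of _ b]) auto
qed

text \<open>A regular function on \<open>F\<close> extends locally to \<open>S\<close>: near a point
  it is a fraction of polynomials, and this fraction makes sense wherever its denominator is nonzero
  in \<open>S\<close>.\<close>

lemma subspace_of_zar:
  assumes "F \<subseteq> S"
  shows "subspace_of (zar S G) F \<doteq> zar F G"
proof (rule same_structureI)
  fix U
  have topo: "topo (subspace_of (zar S G) F) = subtopology (topo (zar S G)) F"
    by (simp add: subspace_of_def)
  have basic: "openin (topo (zar S G)) {x \<in> S. b x \<noteq> 0}" if "b \<in> algebra_generated_by G" for b
    by (intro locally_quotient_open(2) locally_quotient_algebra that order_refl)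
  show "openin (topo (subspace_of (zar S G) F)) U \<longleftrightarrow> openin (topo (zar F G)) U"
  proof
    assume "openin (topo (subspace_of (zar S G) F)) U"
    then obtain W where "openin (topo (zar S G)) W" "U = W \<inter> F"
      unfolding topo openin_subtopology by blast
    then show "openin (topo (zar F G)) U"
      using locally_quotient_subset assms unfolding openin_zar by blast
  next
    assume U: "openin (topo (zar F G)) U"
    show "openin (topo (subspace_of (zar S G) F)) U" unfolding topo
    proof (subst openin_subopen, intro ballI)
      fix x assume x: "x \<in> U"
      have l: "locally_quotient F G U (\<lambda>_. 1)" and UF: "U \<subseteq> F" using U unfolding openin_zar by auto
      obtain b where b: "b \<in> algebra_generated_by G" "b x \<noteq> 0"
        "\<forall>y\<in>F. b y \<noteq> 0 \<longrightarrow> y \<in> U" by (rule locally_quotientE[OF l x]) blast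
      show "\<exists>T. openin (subtopology (topo (zar S G)) F) T \<and> x \<in> T \<and> T \<subseteq> U"
        using basic[OF b(1)] b UF x assms
        by (intro exI[of _ "{x \<in> S. b x \<noteq> 0} \<inter> F"]) (auto simp: openin_subtopology)
    qed
  qed
  fix f assume U: "openin (topo (subspace_of (zar S G) F)) U" and U': "openin (topo (zar F G)) U"
  have UF: "U \<subseteq> F" using U' unfolding openin_zar by auto
  have r: "f \<in> reg (subspace_of (zar S G) F) U \<longleftrightarrow> f \<in> extensional U \<and>
      (\<forall>x\<in>U. \<exists>W g. openin (topo (zar S G)) W \<and> x \<in> W \<and> g \<in> reg (zar S G) W \<and> (\<forall>y\<in>W \<inter> U. f y = g y))"
    by (simp add: subspace_of_def)
  show "f \<in> reg (subspace_of (zar S G) F) U \<longleftrightarrow> f \<in> reg (zar F G) U" (is "?L \<longleftrightarrow> ?R")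
  proof
    assume L: ?L
    have "locally_quotient F G U f"
    proof (rule locally_quotient_local)
      fix x assume x: "x \<in> U"
      then obtain W g where W: "openin (topo (zar S G)) W" "x \<in> W" "g \<in> reg (zar S G) W" "\<forall>y\<in>W \<inter> U. f y = g y"
        using L unfolding r by blast
      have "locally_quotient S G W g" using W by (simp add: reg_zar)
      then have "locally_quotient F G (W \<inter> F \<inter> U) g"
        by (intro locally_quotient_restrict[OF locally_quotient_subset[OF _ assms] U'])
      then show "\<exists>W g. x \<in> W \<and> W \<subseteq> U \<and> locally_quotient F G W g \<and> (\<forall>y\<in>W. f y = g y)"
        using x UF W by (intro exI[of _ "W \<inter> F \<inter> U"] exI[of _ g]) auto
    qed
    then show ?R using L U' unfolding r by (auto simp: reg_zar)
  next
    assume R: ?R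
    show ?L unfolding r
    proof (intro conjI ballI)
      show "f \<in> extensional U" using R U' by (simp add: reg_zar)
      have l: "locally_quotient F G U f" using R U' by (simp add: reg_zar)
      fix x assume x: "x \<in> U"
      obtain a b where ab: "a \<in> algebra_generated_by G" "b \<in> algebra_generated_by G" "b x \<noteq> 0"
        "\<forall>y\<in>F. b y \<noteq> 0 \<longrightarrow> y \<in> U" "\<forall>y\<in>F. b y \<noteq> 0 \<longrightarrow> f y = a y / b y"
        using locally_quotientE[OF l x] .
      let ?W = "{x \<in> S. b x \<noteq> 0}"
      have "locally_quotient S G (S \<inter> ?W) (\<lambda>x. a x * inverse (b x))"
        by (intro locally_quotient_mult locally_quotient_inverse locally_quotient_algebra ab order_refl)
      then have "locally_quotient S G ?W (\<lambda>x. a x * inverse (b x))" by (simp add: Int_def)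
      then have "locally_quotient S G ?W (restrict (\<lambda>x. a x * inverse (b x)) ?W)"
        by (rule locally_quotient_cong) auto
      then have "restrict (\<lambda>x. a x * inverse (b x)) ?W \<in> reg (zar S G) ?W"
        using basic[OF ab(2)] by (simp add: reg_zar)
      then show "\<exists>W g. openin (topo (zar S G)) W \<and> x \<in> W \<and> g \<in> reg (zar S G) W \<and> (\<forall>y\<in>W \<inter> U. f y = g y)"
        using basic[OF ab(2)] x ab UF assms
        by (intro exI[of _ ?W] exI[of _ "restrict (\<lambda>x. a x * inverse (b x)) ?W"]) (auto simp: divide_inverse subset_iff)
    qed
  qed
qed

text \<open>Only values on \<open>S\<close> are compared. This matters for the linear forms of a
  vector space, which are constrained on that space and arbitrary elsewhere; they can be replaced by
  coordinates.\<close>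

lemma zar_cong:
  assumes "\<And>g. g \<in> G \<Longrightarrow> \<exists>a\<in>algebra_generated_by K. \<forall>x\<in>S. g x = a x"
    and "\<And>g. g \<in> K \<Longrightarrow> \<exists>a\<in>algebra_generated_by G. \<forall>x\<in>S. g x = a x"
  shows "zar S G \<doteq> zar S K"
proof -
  have alg: "\<exists>a'\<in>algebra_generated_by K. \<forall>x\<in>S. a x = a' x" if "a \<in> algebra_generated_by G"
    "\<And>g. g \<in> G \<Longrightarrow> \<exists>a\<in>algebra_generated_by K. \<forall>x\<in>S. g x = a x" for a :: "'a \<Rightarrow> complex" and G K
    using that(1)
  proof induction
    case (const c) then show ?case by (intro bexI[of _ "\<lambda>_. c"] algebra_generated_by.const) auto
  next
    case (add a b)
    then obtain a' b' where "a' \<in> algebra_generated_by K" "b' \<in> algebra_generated_by K"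
      "\<forall>x\<in>S. a x = a' x" "\<forall>x\<in>S. b x = b' x" by blast
    then show ?case by (intro bexI[of _ "\<lambda>x. a' x + b' x"] algebra_generated_by.add) auto
  next
    case (mult a b)
    then obtain a' b' where "a' \<in> algebra_generated_by K" "b' \<in> algebra_generated_by K"
      "\<forall>x\<in>S. a x = a' x" "\<forall>x\<in>S. b x = b' x" by blast
    then show ?case by (intro bexI[of _ "\<lambda>x. a' x * b' x"] algebra_generated_by.mult) auto
  qed (use that in auto)
  have lq: "locally_quotient S K U f" if f: "locally_quotient S G U f" and "U \<subseteq> S"
    and sub: "\<And>g. g \<in> G \<Longrightarrow> \<exists>a\<in>algebra_generated_by K. \<forall>x\<in>S. g x = a x" for U f G K
  proof (rule locally_quotientI)
    fix x assume x: "x \<in> U"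
    obtain a b where ab: "a \<in> algebra_generated_by G" "b \<in> algebra_generated_by G" "b x \<noteq> 0"
      "\<forall>y\<in>S. b y \<noteq> 0 \<longrightarrow> y \<in> U" "\<forall>y\<in>S. b y \<noteq> 0 \<longrightarrow> f y = a y / b y"
      using locally_quotientE[OF f x] .
    obtain a' where a': "a' \<in> algebra_generated_by K" "\<forall>x\<in>S. a x = a' x" using alg[OF ab(1) sub] by blast
    obtain b' where b': "b' \<in> algebra_generated_by K" "\<forall>x\<in>S. b x = b' x" using alg[OF ab(2) sub] by blast
    show "\<exists>a b. a \<in> algebra_generated_by K \<and> b \<in> algebra_generated_by K \<and> b x \<noteq> 0 \<and>
        (\<forall>y\<in>S. b y \<noteq> 0 \<longrightarrow> y \<in> U \<and> f y = a y / b y)"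
      using a' b' ab x \<open>U \<subseteq> S\<close> by (intro exI[of _ a'] exI[of _ b']) auto
  qed
  show ?thesis
  proof (rule same_structureI)
    show "openin (topo (zar S G)) U \<longleftrightarrow> openin (topo (zar S K)) U" for U
      unfolding openin_zar using lq assms by blast
    show "f \<in> reg (zar S G) U \<longleftrightarrow> f \<in> reg (zar S K) U"
      if "openin (topo (zar S G)) U" "openin (topo (zar S K)) U" for f U
    proof -
      have "U \<subseteq> S" using that by (simp add: openin_zar)
      then show ?thesis unfolding reg_zar[OF that(1)] reg_zar[OF that(2)] using lq assms by blast
    qed
  qed
qed

section \<open>Quotients with local sections\<close>

text \<open>Restriction commutes with pullback (\<open>res\<close>) and preimages of open sets are
  open, so both sheaf conditions are inherited from \<open>X\<close>.\<close>

lemma sheaf_of_functions_quotient_space: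
  assumes "sheaf_of_functions X"
  shows "sheaf_of_functions (quotient_space X \<pi>)"
proof -
  let ?Q = "quotient_space X \<pi>" and ?P = "\<lambda>U. {x \<in> pts X. \<pi> x \<in> U}"
  have opn: "openin (topo X) (?P U)" if "openin (topo ?Q) U" for U
    using that by (simp add: openin_quotient_space)
  have reg: "f \<in> reg ?Q U \<longleftrightarrow> f \<in> extensional U \<and> pullback X \<pi> U f \<in> reg X (?P U)" for f U
    by (simp add: quotient_space_def)
  have res: "pullback X \<pi> W (restrict f W) = restrict (pullback X \<pi> U f) (?P W)" if "W \<subseteq> U" for f U W
    using that by (auto simp: pullback_def restrict_def fun_eq_iff)
  have loc: "f \<in> reg X U" if "openin (topo X) U" "f \<in> extensional U"
    "\<And>x. x \<in> U \<Longrightarrow> \<exists>W. openin (topo X) W \<and> x \<in> W \<and> W \<subseteq> U \<and> restrict f W \<in> reg X W" for f U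
    using assms[unfolded sheaf_of_functions_def, THEN conjunct1, THEN spec, THEN spec, THEN mp, OF that(1)]
      that(2,3) by simp
  have rst: "restrict f W \<in> reg X W"
    if "openin (topo X) U" "openin (topo X) W" "W \<subseteq> U" "f \<in> reg X U" for U W f
    by (rule assms[unfolded sheaf_of_functions_def, THEN conjunct2, THEN spec, THEN spec, THEN spec,
          THEN mp, THEN mp, THEN mp, THEN mp, OF that])
  have rstQ: "restrict f W \<in> reg ?Q W"
    if "openin (topo ?Q) U" "openin (topo ?Q) W" "W \<subseteq> U" "f \<in> reg ?Q U" for U W f
    unfolding reg res[OF that(3)] using that rst[OF opn[OF that(1)] opn[OF that(2)]] by (auto simp: reg)
  show ?thesis
    unfolding sheaf_of_functions_def
  proof (intro conjI allI impI)
    fix U f assume U: "openin (topo ?Q) U"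
    show "f \<in> reg ?Q U \<longleftrightarrow> f \<in> extensional U \<and>
           (\<forall>x\<in>U. \<exists>W. openin (topo ?Q) W \<and> x \<in> W \<and> W \<subseteq> U \<and> restrict f W \<in> reg ?Q W)"
      (is "?L \<longleftrightarrow> ?R")
    proof
      assume ?L then show ?R using rstQ[OF U U] U by (auto simp: reg intro!: exI[of _ U])
    next
      assume R: ?R
      have "pullback X \<pi> U f \<in> reg X (?P U)"
      proof (rule loc[OF opn[OF U]])
        show "pullback X \<pi> U f \<in> extensional (?P U)" by (simp add: pullback_def)
        fix x assume "x \<in> ?P U"
        then obtain W where W: "openin (topo ?Q) W" "\<pi> x \<in> W" "W \<subseteq> U" "restrict f W \<in> reg ?Q W"
          and x: "x \<in> pts X" using R by blast
        then have "restrict (pullback X \<pi> U f) (?P W) \<in> reg X (?P W)"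
          unfolding reg res[OF W(3)] by simp
        then show "\<exists>W. openin (topo X) W \<and> x \<in> W \<and> W \<subseteq> ?P U \<and> restrict (pullback X \<pi> U f) W \<in> reg X W"
          using W x opn[OF W(1)] by (intro exI[of _ "?P W"]) auto
      qed
      then show ?L using R by (simp add: reg)
    qed
  qed (rule rstQ)
qed

text \<open>The map \<open>r\<close> is the composition of \<open>\<pi>\<close> with a section of \<open>\<pi>\<close> over the image of \<open>U\<close>.\<close>

definition local_section ::
    "'a set \<Rightarrow> ('a \<Rightarrow> complex) set \<Rightarrow> ('a \<Rightarrow> 'b) \<Rightarrow> 'a set \<Rightarrow> ('a \<Rightarrow> 'a) \<Rightarrow> bool" where
  "local_section S G \<pi> U r \<longleftrightarrow>
     openin (topo (zar S G)) U \<and> (\<forall>x\<in>U. \<forall>y\<in>S. \<pi> x = \<pi> y \<longrightarrow> y \<in> U \<and> r x = r y) \<and>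
     (\<forall>x\<in>U. r x \<in> S \<and> \<pi> (r x) = \<pi> x) \<and> (\<forall>g\<in>G. locally_quotient S G U (\<lambda>x. g (r x)))"

text \<open>The fraction a / b need not be invariant, but its composition with \<open>r\<close> is,
  since \<open>r\<close> is constant on the fibres of \<open>\<pi>\<close>. It therefore descends,
  and so does the open set where its denominator is nonzero.\<close>

lemma local_section_basic_open:
  assumes sec: "local_section S G \<pi> U r" and a: "a \<in> algebra_generated_by G" and b: "b \<in> algebra_generated_by G"
  defines "B \<equiv> {z \<in> U. b (r z) \<noteq> 0}"
  shows "openin (topo (quotient_space (zar S G) \<pi>)) (\<pi> ` B)" "{x \<in> S. \<pi> x \<in> \<pi> ` B} = B"
    "\<exists>h \<in> reg (quotient_space (zar S G) \<pi>) (\<pi> ` B). \<forall>x\<in>B. h (\<pi> x) = a (r x) / b (r x)"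
proof -
  have U: "openin (topo (zar S G)) U" and US: "U \<subseteq> S"
    and sat: "\<And>x y. x \<in> U \<Longrightarrow> y \<in> S \<Longrightarrow> \<pi> x = \<pi> y \<Longrightarrow> y \<in> U \<and> r x = r y"
    and r: "\<And>x. x \<in> U \<Longrightarrow> r x \<in> S" and gr: "\<And>g. g \<in> G \<Longrightarrow> locally_quotient S G U (\<lambda>x. g (r x))"
    using sec unfolding local_section_def openin_zar by blast+
  have alg: "locally_quotient S G U (\<lambda>x. c (r x))" if "c \<in> algebra_generated_by G" for c
  proof -
    have "locally_quotient S G {x \<in> U. r x \<in> S} (\<lambda>x. c (r x))"
      using r by (intro locally_quotient_comp[OF _ U gr locally_quotient_algebra[OF that]]) auto
    moreover have "{x \<in> U. r x \<in> S} = U" using r by auto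
    ultimately show ?thesis by simp
  qed
  show B: "{x \<in> S. \<pi> x \<in> \<pi> ` B} = B"
  proof
    show "B \<subseteq> {x \<in> S. \<pi> x \<in> \<pi> ` B}" using US by (auto simp: B_def)
    show "{x \<in> S. \<pi> x \<in> \<pi> ` B} \<subseteq> B"
    proof
      fix x assume "x \<in> {x \<in> S. \<pi> x \<in> \<pi> ` B}"
      then obtain z where z: "x \<in> S" "z \<in> U" "b (r z) \<noteq> 0" "\<pi> z = \<pi> x" unfolding B_def by auto
      then show "x \<in> B" using sat[OF z(2,1,4)] unfolding B_def by auto
    qed
  qed
  have oB: "openin (topo (zar S G)) B"
    unfolding B_def by (intro locally_quotient_open(2) alg b US)
  have BS: "B \<subseteq> S" using US by (auto simp: B_def)
  then show oQ: "openin (topo (quotient_space (zar S G) \<pi>)) (\<pi> ` B)"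
    unfolding openin_quotient_space pts_zar B using oB by blast
  \<comment> \<open>An arbitrary choice of representatives is enough, because \<open>r\<close> takes
    the same value on all of them.\<close>
  define \<sigma> where "\<sigma> y = (SOME z. z \<in> B \<and> \<pi> z = y)" for y
  have \<sigma>: "r (\<sigma> (\<pi> x)) = r x" if "x \<in> B" for x
  proof -
    have "\<sigma> (\<pi> x) \<in> B \<and> \<pi> (\<sigma> (\<pi> x)) = \<pi> x" unfolding \<sigma>_def by (rule someI[of _ x]) (use that in simp)
    then show ?thesis using sat[of x "\<sigma> (\<pi> x)"] that BS by (auto simp: B_def)
  qed
  have "locally_quotient S G (U \<inter> B) (\<lambda>x. a (r x) * inverse (b (r x)))"
    unfolding B_def by (intro locally_quotient_mult locally_quotient_inverse alg a b US)
  moreover have "U \<inter> B = B" by (auto simp: B_def)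
  ultimately have lB: "locally_quotient S G B (\<lambda>x. a (r x) * inverse (b (r x)))" by simp
  define h where "h = restrict (\<lambda>y. a (r (\<sigma> y)) / b (r (\<sigma> y))) (\<pi> ` B)"
  have h: "h (\<pi> x) = a (r x) / b (r x)" if "x \<in> B" for x
    using that \<sigma>[OF that] by (simp add: h_def)
  have "locally_quotient S G B (pullback (zar S G) \<pi> (\<pi> ` B) h)"
    using lB by (rule locally_quotient_cong) (use BS h in \<open>auto simp: pullback_def pts_zar divide_inverse\<close>)
  then have "pullback (zar S G) \<pi> (\<pi> ` B) h \<in> reg (zar S G) B"
    unfolding reg_zar[OF oB] by (simp add: pullback_def pts_zar B)
  then have "h \<in> reg (quotient_space (zar S G) \<pi>) (\<pi> ` B)"
    by (simp add: quotient_space_def pts_zar B h_def)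
  then show "\<exists>h \<in> reg (quotient_space (zar S G) \<pi>) (\<pi> ` B). \<forall>x\<in>B. h (\<pi> x) = a (r x) / b (r x)"
    using h by blast
qed

text \<open>An open set or an invariant function on \<open>F\<close> has to be spread to a saturated
  open set of \<open>S\<close>. If a / b represents it near \<open>r x\<close>, then
  \<open>a (r z) / b (r z)\<close> represents it on such a set, because \<open>r\<close> moves
  points only within their fibres and so keeps points of \<open>F\<close> in
  \<open>F\<close>.\<close>

lemma subspace_of_quotient_space:
  assumes sec: "\<And>x. x \<in> F \<Longrightarrow> \<exists>U r. x \<in> U \<and> local_section S G \<pi> U r"
    and FS: "F \<subseteq> S" and sat: "\<And>x y. x \<in> F \<Longrightarrow> y \<in> S \<Longrightarrow> \<pi> x = \<pi> y \<Longrightarrow> y \<in> F"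
  shows "subspace_of (quotient_space (zar S G) \<pi>) (\<pi> ` F) \<doteq> quotient_space (zar F G) \<pi>"
proof -
  let ?Q = "quotient_space (zar S G) \<pi>" and ?R = "quotient_space (zar F G) \<pi>"
  have topo: "topo (subspace_of ?Q (\<pi> ` F)) = subtopology (topo ?Q) (\<pi> ` F)"
    by (simp add: subspace_of_def)
  have oQ: "openin (topo ?Q) U \<longleftrightarrow> U \<subseteq> \<pi> ` S \<and> openin (topo (zar S G)) {x \<in> S. \<pi> x \<in> U}" for U
    by (simp add: openin_quotient_space pts_zar)
  have oR: "openin (topo ?R) U \<longleftrightarrow> U \<subseteq> \<pi> ` F \<and> openin (topo (zar F G)) {x \<in> F. \<pi> x \<in> U}" for U
    by (simp add: openin_quotient_space pts_zar)
  have chart: "\<exists>O'. openin (topo ?Q) O' \<and> \<pi> x \<in> O' \<and> O' \<inter> \<pi> ` F \<subseteq> W \<and>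
      (\<exists>h\<in>reg ?Q O'. \<forall>y\<in>O' \<inter> W. h y = f y)"
    if W: "W \<subseteq> \<pi> ` F" and x: "x \<in> F" "\<pi> x \<in> W" and l: "locally_quotient F G {x \<in> F. \<pi> x \<in> W} (\<lambda>x. f (\<pi> x))"
    for W x f
  proof -
    obtain U r where xU: "x \<in> U" and sc: "local_section S G \<pi> U r" using sec[OF x(1)] by blast
    have US: "U \<subseteq> S" and r: "\<And>x. x \<in> U \<Longrightarrow> r x \<in> S \<and> \<pi> (r x) = \<pi> x"
      using sc unfolding local_section_def openin_zar by blast+
    have rF: "r z \<in> F" if "z \<in> U" "z \<in> F" for z using sat[OF that(2), of "r z"] r[OF that(1)] by simp
    \<comment> \<open>The fraction is taken at \<open>r x\<close> instead of \<open>x\<close>: the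
      composed denominator is evaluated there and must not vanish.\<close>
    have rx: "r x \<in> {x \<in> F. \<pi> x \<in> W}" using rF[OF xU x(1)] r[OF xU] x by simp
    obtain a b where ab: "a \<in> algebra_generated_by G" "b \<in> algebra_generated_by G" "b (r x) \<noteq> 0"
      "\<forall>y\<in>F. b y \<noteq> 0 \<longrightarrow> y \<in> {x \<in> F. \<pi> x \<in> W}" "\<forall>y\<in>F. b y \<noteq> 0 \<longrightarrow> f (\<pi> y) = a y / b y"
      using locally_quotientE[OF l rx] .
    note B = local_section_basic_open[OF sc ab(1,2)]
    let ?B = "{z \<in> U. b (r z) \<noteq> 0}"
    obtain h where h: "h \<in> reg ?Q (\<pi> ` ?B)" "\<forall>x\<in>?B. h (\<pi> x) = a (r x) / b (r x)"
      using B(3) by (rule bexE)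
    have *: "z \<in> F \<and> \<pi> z \<in> W \<and> h (\<pi> z) = f (\<pi> z)" if zB: "z \<in> ?B" "\<pi> z \<in> \<pi> ` F" for z
    proof -
      obtain y where y: "y \<in> F" "\<pi> y = \<pi> z" using zB(2) by auto
      then have zF: "z \<in> F" using that(1) sat[OF y(1), of z] US by auto
      have zU: "z \<in> U" "b (r z) \<noteq> 0" using that by auto
      have "r z \<in> F" using rF zU zF by blast
      then have "\<pi> (r z) \<in> W" "f (\<pi> (r z)) = a (r z) / b (r z)" using ab(4,5) zU(2) by auto
      moreover have "h (\<pi> z) = a (r z) / b (r z)" using h(2) that(1) by simp
      moreover have "\<pi> (r z) = \<pi> z" using r zU by simp
      ultimately show ?thesis using zF by simp
    qed
    show ?thesis
    proof (intro exI[of _ "\<pi> ` ?B"] conjI bexI[of _ h])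
      show "\<pi> x \<in> \<pi> ` ?B" using xU ab(3) by auto
      show "\<pi> ` ?B \<inter> \<pi> ` F \<subseteq> W"
      proof
        fix y assume "y \<in> \<pi> ` ?B \<inter> \<pi> ` F"
        then obtain z where "z \<in> ?B" "y = \<pi> z" "\<pi> z \<in> \<pi> ` F" by auto
        then show "y \<in> W" using *[of z] by simp
      qed
      show "\<forall>y\<in>\<pi> ` ?B \<inter> W. h y = f y"
      proof
        fix y assume "y \<in> \<pi> ` ?B \<inter> W"
        then obtain z where "z \<in> ?B" "y = \<pi> z" "\<pi> z \<in> \<pi> ` F" using W by auto
        then show "h y = f y" using *[of z] by simp
      qed
    qed (rule B(1), rule h(1))
  qed
  have down: "openin (topo ?R) (O' \<inter> \<pi> ` F)" if "openin (topo ?Q) O'" for O'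
  proof -
    have "{x \<in> F. \<pi> x \<in> O' \<inter> \<pi> ` F} = {x \<in> S. \<pi> x \<in> O'} \<inter> F" using FS by auto
    then show ?thesis using that unfolding oR oQ openin_zar
      using locally_quotient_subset[OF _ FS] by auto
  qed
  show ?thesis
  proof (rule same_structureI)
    fix W
    show "openin (topo (subspace_of ?Q (\<pi> ` F))) W \<longleftrightarrow> openin (topo ?R) W"
    proof
      assume "openin (topo (subspace_of ?Q (\<pi> ` F))) W"
      then show "openin (topo ?R) W" unfolding topo openin_subtopology using down by auto
    next
      assume "openin (topo ?R) W"
      then have W: "W \<subseteq> \<pi> ` F" and l: "locally_quotient F G {x \<in> F. \<pi> x \<in> W} (\<lambda>x. 1)"
        unfolding oR openin_zar by auto
      show "openin (topo (subspace_of ?Q (\<pi> ` F))) W" unfolding topo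
      proof (subst openin_subopen, intro ballI)
        fix y assume y: "y \<in> W"
        then obtain x where x: "x \<in> F" "y = \<pi> x" using W by blast
        obtain O' where "openin (topo ?Q) O'" "\<pi> x \<in> O'" "O' \<inter> \<pi> ` F \<subseteq> W"
          using chart[OF W x(1) _ l] x y by blast
        then show "\<exists>T. openin (subtopology (topo ?Q) (\<pi> ` F)) T \<and> y \<in> T \<and> T \<subseteq> W"
          using x by (intro exI[of _ "O' \<inter> \<pi> ` F"]) (auto simp: openin_subtopology)
      qed
    qed
    fix f assume oW: "openin (topo ?R) W"
    then have W: "W \<subseteq> \<pi> ` F" and opn: "openin (topo (zar F G)) {x \<in> F. \<pi> x \<in> W}"
      unfolding oR by auto
    have "f \<in> reg ?R W \<longleftrightarrow> f \<in> extensional W \<and> pullback (zar F G) \<pi> W f \<in> reg (zar F G) {x \<in> F. \<pi> x \<in> W}"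
      by (simp add: quotient_space_def pts_zar)
    also have "\<dots> \<longleftrightarrow> f \<in> extensional W \<and> locally_quotient F G {x \<in> F. \<pi> x \<in> W} (\<lambda>x. f (\<pi> x))"
    proof -
      have "locally_quotient F G {x \<in> F. \<pi> x \<in> W} (\<lambda>x. f (\<pi> x)) \<longleftrightarrow>
        locally_quotient F G {x \<in> F. \<pi> x \<in> W} (pullback (zar F G) \<pi> W f)"
        by (rule iffI; erule locally_quotient_cong; auto simp: pullback_def pts_zar)
      then show ?thesis unfolding reg_zar[OF opn] by (simp add: pullback_def pts_zar)
    qed
    finally have rR: "f \<in> reg ?R W \<longleftrightarrow> f \<in> extensional W \<and> locally_quotient F G {x \<in> F. \<pi> x \<in> W} (\<lambda>x. f (\<pi> x))" .
    have rS: "f \<in> reg (subspace_of ?Q (\<pi> ` F)) W \<longleftrightarrow> f \<in> extensional W \<and>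
      (\<forall>x\<in>W. \<exists>W' g. openin (topo ?Q) W' \<and> x \<in> W' \<and> g \<in> reg ?Q W' \<and> (\<forall>y\<in>W' \<inter> W. f y = g y))"
      by (simp add: subspace_of_def)
    show "f \<in> reg (subspace_of ?Q (\<pi> ` F)) W \<longleftrightarrow> f \<in> reg ?R W"
    proof
      assume L: "f \<in> reg (subspace_of ?Q (\<pi> ` F)) W"
      have "locally_quotient F G {x \<in> F. \<pi> x \<in> W} (\<lambda>x. f (\<pi> x))"
      proof (rule locally_quotient_local)
        fix x assume x: "x \<in> {x \<in> F. \<pi> x \<in> W}"
        then obtain W' g where W': "openin (topo ?Q) W'" "\<pi> x \<in> W'" "g \<in> reg ?Q W'" "\<forall>y\<in>W' \<inter> W. f y = g y"
          using L unfolding rS by blast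
        have oW': "openin (topo (zar S G)) {x \<in> S. \<pi> x \<in> W'}" using W'(1) unfolding oQ by simp
        have "pullback (zar S G) \<pi> W' g \<in> reg (zar S G) {x \<in> S. \<pi> x \<in> W'}"
          using W'(3) by (simp add: quotient_space_def pts_zar)
        then have "locally_quotient S G {x \<in> S. \<pi> x \<in> W'} (pullback (zar S G) \<pi> W' g)"
          using reg_zar[OF oW'] by simp
        then have "locally_quotient F G ({x \<in> S. \<pi> x \<in> W'} \<inter> F \<inter> {x \<in> F. \<pi> x \<in> W}) (pullback (zar S G) \<pi> W' g)"
          by (intro locally_quotient_restrict[OF locally_quotient_subset[OF _ FS] opn])
        then show "\<exists>V h. x \<in> V \<and> V \<subseteq> {x \<in> F. \<pi> x \<in> W} \<and> locally_quotient F G V h \<and> (\<forall>y\<in>V. f (\<pi> y) = h y)"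
          using x W' FS by (intro exI[of _ "{x \<in> S. \<pi> x \<in> W'} \<inter> F \<inter> {x \<in> F. \<pi> x \<in> W}"]
            exI[of _ "pullback (zar S G) \<pi> W' g"]) (auto simp: pullback_def pts_zar)
      qed
      then show "f \<in> reg ?R W" using L unfolding rR rS by simp
    next
      assume R: "f \<in> reg ?R W"
      show "f \<in> reg (subspace_of ?Q (\<pi> ` F)) W"
        unfolding rS
      proof (intro conjI ballI)
        show "f \<in> extensional W" using R unfolding rR by simp
        fix y assume y: "y \<in> W"
        then obtain x where x: "x \<in> F" "y = \<pi> x" using W by blast
        have xW: "\<pi> x \<in> W" using x y by simp
        have l: "locally_quotient F G {x \<in> F. \<pi> x \<in> W} (\<lambda>x. f (\<pi> x))" using R unfolding rR by simp
        obtain O' h where "openin (topo ?Q) O'" "\<pi> x \<in> O'" "h\<in>reg ?Q O'" "\<forall>y\<in>O' \<inter> W. h y = f y"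
          using chart[OF W x(1) xW l] by blast
        then show "\<exists>W' g. openin (topo ?Q) W' \<and> y \<in> W' \<and> g \<in> reg ?Q W' \<and> (\<forall>y\<in>W' \<inter> W. f y = g y)"
          using x by (intro exI[of _ O'] exI[of _ h]) auto
      qed
    qed
  qed
qed

text \<open>With a global section the quotient is itself a Zariski space, and its coordinates are
  those of the chosen representatives. A function on the quotient is recovered from its pullback by
  composing with \<open>s\<close>.\<close>

lemma quotient_space_section:
  assumes s: "\<And>y. y \<in> \<pi> ` S \<Longrightarrow> s y \<in> S \<and> \<pi> (s y) = y"
    and gen: "\<And>g. g \<in> G \<Longrightarrow> locally_quotient S G S (\<lambda>x. g (s (\<pi> x)))"
  shows "quotient_space (zar S G) \<pi> \<doteq> zar (\<pi> ` S) ((\<lambda>g y. g (s y)) ` G)"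
proof -
  let ?Q = "quotient_space (zar S G) \<pi>" and ?K = "(\<lambda>g y. g (s y)) ` G"
  have S: "openin (topo (zar S G)) S" by (simp add: openin_zar locally_quotient_const)
  have oQ: "openin (topo ?Q) U \<longleftrightarrow> U \<subseteq> \<pi> ` S \<and> openin (topo (zar S G)) {x \<in> S. \<pi> x \<in> U}" for U
    by (simp add: openin_quotient_space pts_zar)
  have up: "locally_quotient S G {x \<in> S. \<pi> x \<in> W} (\<lambda>x. f (\<pi> x))" if "locally_quotient (\<pi> ` S) ?K W f" for W f
    using gen by (intro locally_quotient_comp[OF _ S _ that]) auto
  have alg: "(\<lambda>y. a (s y)) \<in> algebra_generated_by ?K" if "a \<in> algebra_generated_by G" for a
    using that by induction (auto intro: algebra_generated_by.intros)
  have down: "locally_quotient (\<pi> ` S) ?K W f" 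
    if l: "locally_quotient S G {x \<in> S. \<pi> x \<in> W} (\<lambda>x. f (\<pi> x))" and WS: "W \<subseteq> \<pi> ` S" for W f
  proof (rule locally_quotientI)
    fix y assume y: "y \<in> W"
    then have sy: "s y \<in> {x \<in> S. \<pi> x \<in> W}" using s[of y] WS by auto
    obtain a b where ab: "a \<in> algebra_generated_by G" "b \<in> algebra_generated_by G" "b (s y) \<noteq> 0"
      "\<forall>y\<in>S. b y \<noteq> 0 \<longrightarrow> y \<in> {x \<in> S. \<pi> x \<in> W}" "\<forall>y\<in>S. b y \<noteq> 0 \<longrightarrow> f (\<pi> y) = a y / b y"
      using locally_quotientE[OF l sy] .
    have "z \<in> W \<and> f z = a (s z) / b (s z)" if "z \<in> \<pi> ` S" "b (s z) \<noteq> 0" for z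
      using ab(4,5)[rule_format, of "s z"] s[OF that(1)] that(2) by auto
    then show "\<exists>a b. a \<in> algebra_generated_by ?K \<and> b \<in> algebra_generated_by ?K \<and> b y \<noteq> 0 \<and>
        (\<forall>y\<in>\<pi> ` S. b y \<noteq> 0 \<longrightarrow> y \<in> W \<and> f y = a y / b y)"
      using alg[OF ab(1)] alg[OF ab(2)] ab(3)
      by (intro exI[of _ "\<lambda>y. a (s y)"] exI[of _ "\<lambda>y. b (s y)"]) auto
  qed
  show ?thesis
  proof (rule same_structureI)
    show "openin (topo ?Q) U \<longleftrightarrow> openin (topo (zar (\<pi> ` S) ?K)) U" for U
      unfolding oQ openin_zar using up[of U "\<lambda>_. 1"] down[of U "\<lambda>_. 1"] by auto
    fix U f assume oU: "openin (topo ?Q) U" and oU': "openin (topo (zar (\<pi> ` S) ?K)) U"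
    have opn: "openin (topo (zar S G)) {x \<in> S. \<pi> x \<in> U}" using oU unfolding oQ by simp
    have "f \<in> reg ?Q U \<longleftrightarrow> f \<in> extensional U \<and> pullback (zar S G) \<pi> U f \<in> reg (zar S G) {x \<in> S. \<pi> x \<in> U}"
      by (simp add: quotient_space_def pts_zar)
    also have "\<dots> \<longleftrightarrow> f \<in> extensional U \<and> locally_quotient S G {x \<in> S. \<pi> x \<in> U} (\<lambda>x. f (\<pi> x))"
    proof -
      have "locally_quotient S G {x \<in> S. \<pi> x \<in> U} (\<lambda>x. f (\<pi> x)) \<longleftrightarrow>
        locally_quotient S G {x \<in> S. \<pi> x \<in> U} (pullback (zar S G) \<pi> U f)"
        by (rule iffI; erule locally_quotient_cong; auto simp: pullback_def pts_zar)
      then show ?thesis unfolding reg_zar[OF opn] by (simp add: pullback_def pts_zar)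
    qed
    also have "\<dots> \<longleftrightarrow> f \<in> reg (zar (\<pi> ` S) ?K) U"
      unfolding reg_zar[OF oU'] using up[of U f] down[of U f] oU unfolding oQ by auto
    finally show "f \<in> reg ?Q U \<longleftrightarrow> f \<in> reg (zar (\<pi> ` S) ?K) U" .
  qed
qed

section \<open>Products\<close>

definition product_generators ::
    "('a \<Rightarrow> complex) set \<Rightarrow> ('b \<Rightarrow> complex) set \<Rightarrow> ('a \<times> 'b \<Rightarrow> complex) set" where
  "product_generators G K = (\<lambda>g p. g (fst p)) ` G \<union> (\<lambda>k p. k (snd p)) ` K"

text \<open>Sums of separated products already form an algebra: addition joins the two index ranges,
  multiplication distributes. This is the shape demanded by \<open>tensor_functions\<close>.\<close>

lemma algebra_product_generators:
  assumes "h \<in> algebra_generated_by (product_generators G K)"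
  shows "\<exists>n::nat. \<exists>f g. (\<forall>i<n. f i \<in> algebra_generated_by G \<and> g i \<in> algebra_generated_by K) \<and>
           (\<forall>x y. h (x, y) = (\<Sum>i<n. f i x * g i y))"
proof -
  define P where "P h \<longleftrightarrow> (\<exists>n::nat. \<exists>f g. (\<forall>i<n. f i \<in> algebra_generated_by G \<and> g i \<in> algebra_generated_by K) \<and>
           (\<forall>x y. h (x, y) = (\<Sum>i<n. f i x * g i y)))" for h :: "'a \<times> 'b \<Rightarrow> complex"
  have simple: "P (\<lambda>p. f (fst p) * g (snd p))"
    if "f \<in> algebra_generated_by G" "g \<in> algebra_generated_by K" for f g
    unfolding P_def using that by (intro exI[of _ 1] exI[of _ "\<lambda>_. f"] exI[of _ "\<lambda>_. g"]) simp
  have add: "P (\<lambda>p. h p + h' p)" if "P h" "P h'" for h h'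
  proof -
    obtain n f g where 1: "\<forall>i<n::nat. f i \<in> algebra_generated_by G \<and> g i \<in> algebra_generated_by K"
      "\<forall>x y. h (x, y) = (\<Sum>i<n. f i x * g i y)" using \<open>P h\<close> unfolding P_def by (elim exE conjE)
    obtain m f' g' where 2: "\<forall>i<m::nat. f' i \<in> algebra_generated_by G \<and> g' i \<in> algebra_generated_by K"
      "\<forall>x y. h' (x, y) = (\<Sum>i<m. f' i x * g' i y)" using \<open>P h'\<close> unfolding P_def by (elim exE conjE)
    define f'' where "f'' i = (if i < n then f i else f' (i - n))" for i
    define g'' where "g'' i = (if i < n then g i else g' (i - n))" for i
    have "(\<Sum>i<n + k. f'' i x * g'' i y) = (\<Sum>i<n. f i x * g i y) + (\<Sum>i<k. f' i x * g' i y)" for k x y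
      by (induction k) (auto simp: f''_def g''_def)
    then show ?thesis unfolding P_def using 1 2
      by (intro exI[of _ "n + m"] exI[of _ f''] exI[of _ g'']) (auto simp: f''_def g''_def)
  qed
  have mult_simple: "P (\<lambda>p. f (fst p) * g (snd p) * h p)"
    if "f \<in> algebra_generated_by G" "g \<in> algebra_generated_by K" "P h" for f g h
  proof -
    obtain n f' g' where 1: "\<forall>i<n::nat. f' i \<in> algebra_generated_by G \<and> g' i \<in> algebra_generated_by K"
      "\<forall>x y. h (x, y) = (\<Sum>i<n. f' i x * g' i y)" using \<open>P h\<close> unfolding P_def by (elim exE conjE)
    have "\<forall>i<n. (\<lambda>x. f x * f' i x) \<in> algebra_generated_by G \<and> (\<lambda>y. g y * g' i y) \<in> algebra_generated_by K"
      using 1(1) that by (auto intro: algebra_generated_by.mult)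
    then show ?thesis unfolding P_def using 1(2)
      by (intro exI[of _ n] exI[of _ "\<lambda>i x. f x * f' i x"] exI[of _ "\<lambda>i y. g y * g' i y"])
        (auto simp: sum_distrib_left mult_ac)
  qed
  have mult: "P (\<lambda>p. h p * h' p)" if "P h" "P h'" for h h'
  proof -
    obtain n f g where 1: "\<forall>i<n::nat. f i \<in> algebra_generated_by G \<and> g i \<in> algebra_generated_by K"
      "\<forall>x y. h (x, y) = (\<Sum>i<n. f i x * g i y)" using \<open>P h\<close> unfolding P_def by (elim exE conjE)
    have "P (\<lambda>p. (\<Sum>i<k. f i (fst p) * g i (snd p)) * h' p)" if "k \<le> n" for k
      using that
    proof (induction k)
      case 0
      then show ?case using simple[OF algebra_generated_by.const[of 0] algebra_generated_by.const[of 0]] by simp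
    next
      case (Suc k)
      then have "P (\<lambda>p. (\<Sum>i<k. f i (fst p) * g i (snd p)) * h' p + f k (fst p) * g k (snd p) * h' p)"
        using 1(1) by (intro add mult_simple \<open>P h'\<close>) auto
      then show ?case by (simp add: algebra_simps)
    qed
    from this[of n] have "P (\<lambda>p. (\<Sum>i<n. f i (fst p) * g i (snd p)) * h' p)" by simp
    also have "(\<lambda>p. (\<Sum>i<n. f i (fst p) * g i (snd p)) * h' p) = (\<lambda>p. h p * h' p)"
      using 1(2) by auto
    finally show ?thesis .
  qed
  have "P h"
    using assms
  proof induction
    case (gen h)
    then consider g where "g \<in> G" "h = (\<lambda>p. g (fst p))" | k where "k \<in> K" "h = (\<lambda>p. k (snd p))"
      unfolding product_generators_def by blast
    then show ?case
    proof cases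
      case 1
      then show ?thesis using simple[OF algebra_generated_by.gen[of g] algebra_generated_by.const[of 1]] by simp
    next
      case 2
      then show ?thesis using simple[OF algebra_generated_by.const[of 1] algebra_generated_by.gen[of k]] by simp
    qed
  next
    case (const c)
    then show ?case using simple[OF algebra_generated_by.const[of c] algebra_generated_by.const[of 1]] by simp
  qed (auto intro: add mult)
  then show ?thesis unfolding P_def .
qed

lemma locally_quotient_tensor_functions:
  assumes "openin (topo (zar S G)) U" "openin (topo (zar T K)) V"
    and "h \<in> tensor_functions (zar S G) (zar T K) U V"
  shows "locally_quotient (S \<times> T) (product_generators G K) (U \<times> V) h"
proof -
  let ?GK = "product_generators G K"
  obtain n f g where fg: "\<forall>i<n::nat. f i \<in> reg (zar S G) U \<and> g i \<in> reg (zar T K) V"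
    and h: "h = (\<lambda>(x, y). \<Sum>i<n. f i x * g i y)"
    using assms(3) unfolding tensor_functions_def mem_Collect_eq by (elim exE conjE)
  have UV: "U \<subseteq> S" "V \<subseteq> T" using assms by (auto simp: openin_zar)
  have ST: "openin (topo (zar (S \<times> T) ?GK)) (S \<times> T)" by (simp add: openin_zar locally_quotient_const)
  have fst: "locally_quotient (S \<times> T) ?GK {p \<in> S \<times> T. fst p \<in> U} (\<lambda>p. f (fst p))"
    if "locally_quotient S G U f" for f
    by (rule locally_quotient_comp[OF _ ST _ that]) (auto simp: product_generators_def intro: locally_quotient_gen)
  have snd: "locally_quotient (S \<times> T) ?GK {p \<in> S \<times> T. snd p \<in> V} (\<lambda>p. f (snd p))"
    if "locally_quotient T K V f" for f
    by (rule locally_quotient_comp[OF _ ST _ that]) (auto simp: product_generators_def intro: locally_quotient_gen)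
  have eq: "{p \<in> S \<times> T. fst p \<in> U} \<inter> {p \<in> S \<times> T. snd p \<in> V} = U \<times> V" using UV by auto
  have summand: "locally_quotient (S \<times> T) ?GK (U \<times> V) (\<lambda>p. f (fst p) * g (snd p))"
    if "locally_quotient S G U f" "locally_quotient T K V g" for f g
    using locally_quotient_mult[OF fst[OF that(1)] snd[OF that(2)]] unfolding eq .
  have opn: "openin (topo (zar (S \<times> T) ?GK)) (U \<times> V)"
    using summand[of "\<lambda>_. 1" "\<lambda>_. 1"] assms UV unfolding openin_zar by auto
  have "locally_quotient (S \<times> T) ?GK (U \<times> V) (\<lambda>p. \<Sum>i<k. f i (fst p) * g i (snd p))" if "k \<le> n" for k
    using that
  proof (induction k)
    case 0
    then show ?case using locally_quotient_restrict[OF locally_quotient_const opn, of 0] UV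
      by (simp add: Times_Int_Times Int_absorb1)
  next
    case (Suc k)
    have "f k \<in> reg (zar S G) U \<and> g k \<in> reg (zar T K) V" using Suc.prems fg by auto
    then have "locally_quotient S G U (f k)" "locally_quotient T K V (g k)"
      using reg_zar[OF assms(1)] reg_zar[OF assms(2)] by auto
    then show ?case using locally_quotient_add[OF Suc.IH summand] Suc.prems by simp
  qed
  from this[of n] show ?thesis by (simp add: h case_prod_unfold)
qed

text \<open>Tensor functions over small rectangles add nothing new, as they are local fractions of
  polynomials in both sets of coordinates. Conversely each such polynomial is a tensor function over
  the whole rectangle, so its principal open set is open in the product.\<close>

lemma product_space_zar:
  "product_space (zar S G) (zar T K) \<doteq> zar (S \<times> T) (product_generators G K)"
proof -
  let ?X = "zar S G" and ?Y = "zar T K" and ?GK = "product_generators G K" and ?P = "product_space (zar S G) (zar T K)"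
  let ?B = "{{p \<in> U \<times> V. h p \<noteq> 0} | U V h.
                openin (topo ?X) U \<and> openin (topo ?Y) V \<and> h \<in> tensor_functions ?X ?Y U V}"
  have topo: "topo ?P = topology_generated_by ?B" by (simp add: product_space_def Let_def)
  have S: "openin (topo ?X) S" and T: "openin (topo ?Y) T" by (simp_all add: openin_zar locally_quotient_const)
  have basis: "openin (topo (zar (S \<times> T) ?GK)) {p \<in> U \<times> V. h p \<noteq> 0}"
    if "openin (topo ?X) U" "openin (topo ?Y) V" "h \<in> tensor_functions ?X ?Y U V" for U V h
  proof -
    have "U \<times> V \<subseteq> S \<times> T" using that by (auto simp: openin_zar)
    then show ?thesis using locally_quotient_open(2)[OF locally_quotient_tensor_functions[OF that]] by simp
  qed
  have tens: "\<exists>h \<in> tensor_functions ?X ?Y S T. \<forall>p\<in>S \<times> T. h p = a p" if a: "a \<in> algebra_generated_by ?GK" for a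
  proof -
    obtain n f g where fg: "\<forall>i<n::nat. f i \<in> algebra_generated_by G \<and> g i \<in> algebra_generated_by K"
      "\<forall>x y. a (x, y) = (\<Sum>i<n. f i x * g i y)" using algebra_product_generators[OF a] by (elim exE conjE)
    \<comment> \<open>The factors are cut off outside \<open>S\<close> and \<open>T\<close>, because
      elements of \<open>reg\<close> are extensional.\<close>
    have res: "restrict f S \<in> reg (zar S G) S" if "f \<in> algebra_generated_by G" for f and S :: "'c set" and G
    proof -
      have "openin (topo (zar S G)) S" by (simp add: openin_zar locally_quotient_const)
      moreover have "locally_quotient S G S (restrict f S)"
        using locally_quotient_algebra[OF that] by (rule locally_quotient_cong) simp
      ultimately show ?thesis by (simp add: reg_zar)
    qed
    have "\<forall>i<n. restrict (f i) S \<in> reg ?X S" "\<forall>i<n. restrict (g i) T \<in> reg ?Y T"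
      using fg(1) res by auto
    then have "(\<lambda>(x, y). \<Sum>i<n. restrict (f i) S x * restrict (g i) T y) \<in> tensor_functions ?X ?Y S T"
      unfolding tensor_functions_def mem_Collect_eq
      by (intro exI[of _ n] exI[of _ "\<lambda>i. restrict (f i) S"] exI[of _ "\<lambda>i. restrict (g i) T"]) auto
    then show ?thesis
      by (rule bexI[rotated]) (auto simp: fg(2))
  qed
  show ?thesis
  proof (rule same_structureI)
    fix W
    show op: "openin (topo ?P) W \<longleftrightarrow> openin (topo (zar (S \<times> T) ?GK)) W"
    proof
      assume "openin (topo ?P) W"
      then have "generate_topology_on ?B W" unfolding topo openin_topology_generated_by_iff .
      then show "openin (topo (zar (S \<times> T) ?GK)) W"
      proof (induction rule: generate_topology_on.induct)
        case (Basis s)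
        then obtain U V h where "s = {p \<in> U \<times> V. h p \<noteq> 0}" "openin (topo ?X) U" "openin (topo ?Y) V"
          "h \<in> tensor_functions ?X ?Y U V"
          unfolding mem_Collect_eq by (elim exE conjE)
        then show ?case using basis by simp
      qed auto
    next
      assume W: "openin (topo (zar (S \<times> T) ?GK)) W"
      show "openin (topo ?P) W"
      proof (subst openin_subopen, intro ballI)
        fix p assume p: "p \<in> W"
        have l: "locally_quotient (S \<times> T) ?GK W (\<lambda>_. 1)" and WS: "W \<subseteq> S \<times> T" using W by (auto simp: openin_zar)
        obtain b where b: "b \<in> algebra_generated_by ?GK" "b p \<noteq> 0" "\<forall>y\<in>S \<times> T. b y \<noteq> 0 \<longrightarrow> y \<in> W"
          by (rule locally_quotientE[OF l p]) blast
        obtain h where h: "h \<in> tensor_functions ?X ?Y S T" "\<forall>p\<in>S \<times> T. h p = b p" using tens[OF b(1)] by blast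
        have "{p \<in> S \<times> T. h p \<noteq> 0} \<in> ?B" unfolding mem_Collect_eq using h(1) S T
          by (intro exI[of _ S] exI[of _ T] exI[of _ h] conjI refl)
        then have "openin (topo ?P) {p \<in> S \<times> T. h p \<noteq> 0}"
          unfolding topo openin_topology_generated_by_iff by (rule generate_topology_on.Basis)
        moreover have "p \<in> {p \<in> S \<times> T. h p \<noteq> 0}" using p WS b h by auto
        moreover have "{p \<in> S \<times> T. h p \<noteq> 0} \<subseteq> W" using b(3) h(2) by auto
        ultimately show "\<exists>T. openin (topo ?P) T \<and> p \<in> T \<and> T \<subseteq> W" by (intro exI conjI)
      qed
    qed
    fix f assume W: "openin (topo (zar (S \<times> T) ?GK)) W"
    then have WS: "W \<subseteq> S \<times> T" by (simp add: openin_zar)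
    have r: "f \<in> reg ?P W \<longleftrightarrow> f \<in> extensional W \<and> (\<forall>p\<in>W. \<exists>U V a b.
                 openin (topo ?X) U \<and> openin (topo ?Y) V \<and>
                 a \<in> tensor_functions ?X ?Y U V \<and> b \<in> tensor_functions ?X ?Y U V \<and>
                 p \<in> {r \<in> U \<times> V. b r \<noteq> 0} \<and> {r \<in> U \<times> V. b r \<noteq> 0} \<subseteq> W \<and>
                 (\<forall>r\<in>U \<times> V. b r \<noteq> 0 \<longrightarrow> f r = a r / b r))"
      by (simp add: product_space_def Let_def)
    show "f \<in> reg ?P W \<longleftrightarrow> f \<in> reg (zar (S \<times> T) ?GK) W"
    proof
      assume L: "f \<in> reg ?P W"
      have "locally_quotient (S \<times> T) ?GK W f"
      proof (rule locally_quotient_local)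
        fix p assume p: "p \<in> W"
        then obtain U V a b where UV: "openin (topo ?X) U" "openin (topo ?Y) V"
          "a \<in> tensor_functions ?X ?Y U V" "b \<in> tensor_functions ?X ?Y U V"
          "p \<in> {r \<in> U \<times> V. b r \<noteq> 0}" "{r \<in> U \<times> V. b r \<noteq> 0} \<subseteq> W"
          "\<forall>r\<in>U \<times> V. b r \<noteq> 0 \<longrightarrow> f r = a r / b r"
          using L[unfolded r, THEN conjunct2, rule_format, OF p] by (elim conjE exE)
        have sub: "U \<times> V \<subseteq> S \<times> T" using UV(1,2) by (auto simp: openin_zar)
        have "locally_quotient (S \<times> T) ?GK (U \<times> V \<inter> {r \<in> U \<times> V. b r \<noteq> 0}) (\<lambda>r. a r * inverse (b r))"
          by (intro locally_quotient_mult locally_quotient_inverse locally_quotient_tensor_functions UV sub)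
        moreover have "U \<times> V \<inter> {r \<in> U \<times> V. b r \<noteq> 0} = {r \<in> U \<times> V. b r \<noteq> 0}" by auto
        ultimately have "locally_quotient (S \<times> T) ?GK {r \<in> U \<times> V. b r \<noteq> 0} (\<lambda>r. a r * inverse (b r))" by simp
        then show "\<exists>V g. p \<in> V \<and> V \<subseteq> W \<and> locally_quotient (S \<times> T) ?GK V g \<and> (\<forall>y\<in>V. f y = g y)"
          using UV(5-7) by (intro exI[of _ "{r \<in> U \<times> V. b r \<noteq> 0}"] exI[of _ "\<lambda>r. a r * inverse (b r)"] conjI)
            (auto simp: divide_inverse)
      qed
      then show "f \<in> reg (zar (S \<times> T) ?GK) W" using L W unfolding r by (simp add: reg_zar)
    next
      assume R: "f \<in> reg (zar (S \<times> T) ?GK) W"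
      show "f \<in> reg ?P W" unfolding r
      proof (intro conjI ballI)
        show "f \<in> extensional W" using R W by (simp add: reg_zar)
        fix p assume p: "p \<in> W"
        have l: "locally_quotient (S \<times> T) ?GK W f" using R W by (simp add: reg_zar)
        obtain a b where ab: "a \<in> algebra_generated_by ?GK" "b \<in> algebra_generated_by ?GK" "b p \<noteq> 0"
          "\<forall>y\<in>S \<times> T. b y \<noteq> 0 \<longrightarrow> y \<in> W" "\<forall>y\<in>S \<times> T. b y \<noteq> 0 \<longrightarrow> f y = a y / b y"
          using locally_quotientE[OF l p] .
        obtain a' where a': "a' \<in> tensor_functions ?X ?Y S T" "\<forall>p\<in>S \<times> T. a' p = a p" using tens[OF ab(1)] by blast
        obtain b' where b': "b' \<in> tensor_functions ?X ?Y S T" "\<forall>p\<in>S \<times> T. b' p = b p" using tens[OF ab(2)] by blast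
        have "p \<in> {r \<in> S \<times> T. b' r \<noteq> 0}" using p WS b'(2) ab(3) by auto
        moreover have "{r \<in> S \<times> T. b' r \<noteq> 0} \<subseteq> W" using b'(2) ab(4) by auto
        moreover have "\<forall>r\<in>S \<times> T. b' r \<noteq> 0 \<longrightarrow> f r = a' r / b' r" using a'(2) b'(2) ab(5) by auto
        ultimately show "\<exists>U V a b. openin (topo ?X) U \<and> openin (topo ?Y) V \<and>
                 a \<in> tensor_functions ?X ?Y U V \<and> b \<in> tensor_functions ?X ?Y U V \<and>
                 p \<in> {r \<in> U \<times> V. b r \<noteq> 0} \<and> {r \<in> U \<times> V. b r \<noteq> 0} \<subseteq> W \<and>
                 (\<forall>r\<in>U \<times> V. b r \<noteq> 0 \<longrightarrow> f r = a r / b r)"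
          using S T a'(1) b'(1) by (intro exI[of _ S] exI[of _ T] exI[of _ a'] exI[of _ b'] conjI)
      qed
    qed
  qed
qed

section \<open>Criteria for affine, separated and orbit spaces\<close>

lemma affine_space_zar: "affine_space n = zar {z. \<forall>i\<ge>n. z i = 0} {\<lambda>z. z i | i. i < n}"
  by (simp add: affine_space_def)

text \<open>Rabinowitsch's trick: the coordinates embed \<open>S\<close> as the locus where
  \<open>P\<close> vanishes and \<open>h\<close> does not, and one more coordinate turns the
  inequality into an equation. \<open>P\<close> may be infinite, since any common zero set is
  closed.\<close>

lemma affine_variety_zar:
  fixes e :: "'i::finite \<Rightarrow> 'a \<Rightarrow> complex"
  assumes inj: "\<And>x y. x \<in> S \<Longrightarrow> y \<in> S \<Longrightarrow> (\<And>i. e i x = e i y) \<Longrightarrow> x = y"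
    and P: "\<And>p. p \<in> P \<Longrightarrow> p \<in> algebra_generated_by (range (\<lambda>i z. z i))"
    and h: "h \<in> algebra_generated_by (range (\<lambda>i z. z i))"
    and img: "\<And>z. (\<exists>x\<in>S. \<forall>i. e i x = z i) \<longleftrightarrow> (\<forall>p\<in>P. p z = 0) \<and> h z \<noteq> 0"
  shows "affine_variety (zar S (range e))"
proof -
  \<comment> \<open>\<open>affine_space\<close> is indexed by numbers, so the index type is
    enumerated by \<open>c\<close>; below, \<open>r\<close> reads a point back as a function on the
    index type.\<close>
  define n where "n = CARD('i)"
  obtain c :: "nat \<Rightarrow> 'i" where c: "bij_betw c {0..<n} UNIV"
    using ex_bij_betw_nat_finite[of "UNIV :: 'i set"] unfolding n_def by auto
  define d where "d i = the_inv_into {0..<n} c i" for i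
  have d: "d i < n" "c (d i) = i" for i
    using bij_betwE[OF bij_betw_the_inv_into[OF c]] f_the_inv_into_f_bij_betw[OF c]
    by (auto simp: d_def)
  have dc: "d (c j) = j" if "j < n" for j
    using the_inv_into_f_f[of c "{0..<n}" j] c that unfolding d_def bij_betw_def by auto
  let ?A = "{z. \<forall>i\<ge>Suc n. z i = (0::complex)}"
  let ?X = "{\<lambda>z::nat \<Rightarrow> complex. z i | i. i < Suc n}"
  define r :: "(nat \<Rightarrow> complex) \<Rightarrow> 'i \<Rightarrow> complex" where "r z i = z (d i)" for z i
  have coord: "(\<lambda>z. z j) \<in> algebra_generated_by ?X" if "j < Suc n" for j
    using that by (intro algebra_generated_by.gen) auto
  have alg: "(\<lambda>z. a (r z)) \<in> algebra_generated_by ?X"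
    if "a \<in> algebra_generated_by (range (\<lambda>i z. z i))" for a
    using that
  proof induction
    case (gen g)
    then obtain i where "g = (\<lambda>z. z i)" by auto
    then show ?case unfolding r_def using d(1)[of i] coord[of "d i"] by auto
  qed (auto intro: algebra_generated_by.intros)
  define Z where "Z = {z \<in> ?A. (\<forall>p\<in>P. p (r z) = 0) \<and> h (r z) * z n = 1}"
  have ZA: "Z \<subseteq> ?A" by (auto simp: Z_def)
  define E where "E = insert (\<lambda>z. h (r z) * z n + (-1)) ((\<lambda>p z. p (r z)) ` P)"
  have E: "a \<in> algebra_generated_by ?X" if "a \<in> E" for a
  proof -
    have "(\<lambda>z. h (r z) * z n + (-1)) \<in> algebra_generated_by ?X"
      by (intro algebra_generated_by.add algebra_generated_by.mult algebra_generated_by.const alg h coord) simp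
    then show ?thesis using that alg[OF P] unfolding E_def by blast
  qed
  have ZE: "Z = ?A - (\<Union>a\<in>E. {z \<in> ?A. a z \<noteq> 0})"
  proof -
    have w: "w + (-1) = 0 \<longleftrightarrow> w = 1" for w :: complex by auto
    show ?thesis unfolding Z_def E_def by (auto simp only: w insert_iff ball_simps image_iff)
  qed
  have "openin (topo (zar ?A ?X)) {z \<in> ?A. a z \<noteq> 0}" if "a \<in> E" for a
    by (rule locally_quotient_open(2)[OF locally_quotient_algebra[OF E[OF that]] order_refl])
  then have oE: "openin (topo (affine_space (Suc n))) (\<Union>a\<in>E. {z \<in> ?A. a z \<noteq> 0})"
    unfolding affine_space_zar by (intro openin_Union) blast
  have cl: "closedin (topo (affine_space (Suc n))) Z"
  proof -
    have ts: "topspace (topo (affine_space (Suc n))) = ?A"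
      unfolding affine_space_zar pts_zar[unfolded pts_def] ..
    have "?A - Z = (\<Union>a\<in>E. {z \<in> ?A. a z \<noteq> 0})" unfolding ZE by blast
    with oE show ?thesis unfolding closedin_def ts using ZA by simp
  qed
  \<comment> \<open>The additional last coordinate \<open>1 / h\<close> makes the image closed.\<close>
  define \<phi> where "\<phi> x j = (if j < n then e (c j) x else if j = n then inverse (h (\<lambda>i. e i x)) else 0)" for x j
  have r\<phi>: "r (\<phi> x) = (\<lambda>i. e i x)" for x by (auto simp: r_def \<phi>_def d)
  have hS: "(\<forall>p\<in>P. p (\<lambda>i. e i x) = 0) \<and> h (\<lambda>i. e i x) \<noteq> 0" if "x \<in> S" for x
    by (rule img[of "\<lambda>i. e i x", THEN iffD1]) (use that in blast)
  have \<phi>Z: "\<phi> \<in> S \<rightarrow> Z"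
  proof
    fix x assume "x \<in> S"
    from hS[OF this] show "\<phi> x \<in> Z" unfolding Z_def mem_Collect_eq r\<phi> by (auto simp: \<phi>_def)
  qed
  have ex: "\<exists>x\<in>S. \<phi> x = z" if z: "z \<in> Z" for z
  proof -
    have rz: "(\<forall>p\<in>P. p (r z) = 0) \<and> h (r z) \<noteq> 0" and hz: "h (r z) * z n = 1" and sz: "\<forall>i\<ge>Suc n. z i = 0"
      using z unfolding Z_def by auto
    obtain x where x: "x \<in> S" "\<forall>i. e i x = r z i" using img[of "r z", THEN iffD2, OF rz] by (rule bexE)
    have ex: "(\<lambda>i. e i x) = r z" using x(2) by auto
    have "\<phi> x j = z j" for j
    proof -
      consider "j < n" | "j = n" | "j \<ge> Suc n" by linarith
      then show ?thesis
      proof cases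
        case 1 then show ?thesis using x(2) by (simp add: \<phi>_def r_def dc)
      next
        case 2 then show ?thesis using hz rz by (simp add: \<phi>_def ex field_simps)
      next
        case 3 then show ?thesis using sz by (simp add: \<phi>_def)
      qed
    qed
    then show ?thesis using x(1) by blast
  qed
  define \<psi> where "\<psi> z = (SOME x. x \<in> S \<and> \<phi> x = z)" for z
  have \<psi>: "\<psi> z \<in> S" "\<phi> (\<psi> z) = z" if "z \<in> Z" for z
    using someI_ex[of "\<lambda>x. x \<in> S \<and> \<phi> x = z"] ex[OF that] unfolding \<psi>_def by blast+
  have \<phi>_inj: "x = y" if "x \<in> S" "y \<in> S" "\<phi> x = \<phi> y" for x y
  proof (rule inj[OF that(1,2)])
    fix i
    have "r (\<phi> x) i = r (\<phi> y) i" using that(3) by simp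
    then show "e i x = e i y" unfolding r\<phi> .
  qed
  let ?Y = "zar Z ?X" and ?G = "range e"
  have e: "locally_quotient S ?G S (e i)" for i by (rule locally_quotient_gen) simp
  have he: "(\<lambda>x. h (\<lambda>i. e i x)) \<in> algebra_generated_by ?G"
    using h
  proof induction
    case (gen g)
    then obtain i where "g = (\<lambda>z. z i)" by auto
    then show ?case using algebra_generated_by.gen[of "e i" ?G] by simp
  qed (auto intro: algebra_generated_by.intros)
  have m1: "morphism (zar S ?G) ?Y \<phi>"
  proof (rule morphism_zar[OF \<phi>Z])
    fix k assume "k \<in> ?X"
    then obtain j where k: "k = (\<lambda>z. z j)" "j < Suc n" by blast
    show "locally_quotient S ?G S (\<lambda>x. k (\<phi> x))"
    proof (cases "j < n")
      case True
      then show ?thesis using e[of "c j"] by (simp add: k \<phi>_def)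
    next
      case False
      then have "j = n" using k by simp
      have "locally_quotient S ?G {x \<in> S. h (\<lambda>i. e i x) \<noteq> 0} (\<lambda>x. inverse (h (\<lambda>i. e i x)))"
        by (intro locally_quotient_inverse locally_quotient_algebra he order_refl)
      moreover have "{x \<in> S. h (\<lambda>i. e i x) \<noteq> 0} = S" using hS by blast
      ultimately show ?thesis by (simp add: k \<phi>_def \<open>j = n\<close>)
    qed
  qed
  \<comment> \<open>The inverse was obtained by choice, yet it is a morphism: the coordinate
    \<open>e i\<close> of its value at \<open>z\<close> is the coordinate \<open>d i\<close> of
    \<open>z\<close>.\<close>
  have m2: "morphism ?Y (zar S ?G) \<psi>"
  proof (rule morphism_zar)
    show "\<psi> \<in> Z \<rightarrow> S" using \<psi> by auto
    fix k assume "k \<in> ?G"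
    then obtain i where k: "k = e i" by auto
    have "locally_quotient Z ?X Z (\<lambda>z. z (d i))"
      using d(1)[of i] by (intro locally_quotient_algebra coord) simp
    then show "locally_quotient Z ?X Z (\<lambda>z. k (\<psi> z))"
    proof (rule locally_quotient_cong)
      fix z assume "z \<in> Z"
      then have "r (\<phi> (\<psi> z)) i = r z i" using \<psi>(2) by simp
      then show "z (d i) = k (\<psi> z)" unfolding r\<phi> k by (simp add: r_def)
    qed
  qed
  have "isomorphism (zar S ?G) ?Y \<phi>"
    unfolding isomorphism_def pts_zar using m1 m2 \<psi> \<phi>Z \<phi>_inj
    by (intro conjI exI[of _ \<psi>]) (auto simp: Pi_iff)
  then have "isomorphism (zar S ?G) (subspace_of (affine_space (Suc n)) Z) \<phi>"
    unfolding affine_space_zar isomorphism_cong[OF same_structure_refl subspace_of_zar[OF ZA]] .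
  then show ?thesis unfolding affine_variety_def using cl by blast
qed

text \<open>For a global function \<open>f\<close> with \<open>f x \<noteq> f y\<close>, the tensor
  function \<open>f a * 1 + (- 1) * f b\<close> of the pair (a, b) vanishes on the diagonal and is
  nonzero at (x, y). The constants supply its factors 1 and -1.\<close>

lemma separatedI:
  assumes const: "\<And>c. restrict (\<lambda>_. c) (pts X) \<in> reg X (pts X)"
    and sep: "\<And>x y. x \<in> pts X \<Longrightarrow> y \<in> pts X \<Longrightarrow> x \<noteq> y \<Longrightarrow> \<exists>f\<in>reg X (pts X). f x \<noteq> f y"
  shows "separated X"
proof -
  let ?P = "product_space X X"
  let ?B = "{{p \<in> U \<times> V. h p \<noteq> 0} | U V h.
                openin (topo X) U \<and> openin (topo X) V \<and> h \<in> tensor_functions X X U V}"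
  have topo: "topo ?P = topology_generated_by ?B" by (simp add: product_space_def Let_def)
  have opn: "openin (topo X) (pts X)" by (simp add: pts_def)
  have basis: "openin (topo ?P) {p \<in> pts X \<times> pts X. h p \<noteq> 0}" if "h \<in> tensor_functions X X (pts X) (pts X)" for h
  proof -
    have "{p \<in> pts X \<times> pts X. h p \<noteq> 0} \<in> ?B"
      unfolding mem_Collect_eq using opn that
      by (intro exI[of _ "pts X"] exI[of _ h] conjI refl)
    then show ?thesis unfolding topo openin_topology_generated_by_iff by (rule generate_topology_on.Basis)
  qed
  have sub: "topspace (topo ?P) \<subseteq> pts X \<times> pts X"
  proof -
    have "\<Union>?B \<subseteq> pts X \<times> pts X"
    proof
      fix p assume "p \<in> \<Union>?B"
      then obtain s where s: "s \<in> ?B" "p \<in> s" by (rule UnionE)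
      obtain U V h where UV: "s = {p \<in> U \<times> V. h p \<noteq> 0}" "openin (topo X) U" "openin (topo X) V"
        "h \<in> tensor_functions X X U V" using s(1) unfolding mem_Collect_eq by (elim exE conjE)
      have "U \<subseteq> pts X" "V \<subseteq> pts X" using UV(2,3) openin_subset unfolding pts_def by auto
      then show "p \<in> pts X \<times> pts X" using s(2) unfolding UV(1) by auto
    qed
    then show ?thesis unfolding topo by simp
  qed
  have "(\<lambda>(x, y). \<Sum>i<1::nat. restrict (\<lambda>_. 1) (pts X) x * restrict (\<lambda>_. 1) (pts X) y) \<in> tensor_functions X X (pts X) (pts X)"
    unfolding tensor_functions_def mem_Collect_eq using const[of 1]
    by (intro exI[of _ 1] exI[of _ "\<lambda>_. restrict (\<lambda>_. 1) (pts X)"]) simp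
  from openin_subset[OF basis[OF this]] have sup: "pts X \<times> pts X \<subseteq> topspace (topo ?P)"
    by auto
  have "openin (topo ?P) (topspace (topo ?P) - {(x, x) | x. x \<in> pts X})"
  proof (subst openin_subopen, intro ballI)
    fix p assume p: "p \<in> topspace (topo ?P) - {(x, x) | x. x \<in> pts X}"
    obtain x y where xy: "p = (x, y)" "x \<in> pts X" "y \<in> pts X" "x \<noteq> y"
    proof (cases p)
      case (Pair a b)
      then have "a \<in> pts X" "b \<in> pts X" "a \<noteq> b" using p sub by auto
      then show ?thesis using Pair that by blast
    qed
    from sep[OF xy(2-4)] obtain f where f: "f \<in> reg X (pts X)" "f x \<noteq> f y" by (rule bexE)
    define u where "u i = (if i = 0 then f else restrict (\<lambda>_. -1) (pts X))" for i :: nat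
    define v where "v i = (if i = 0 then restrict (\<lambda>_. 1) (pts X) else f)" for i :: nat
    define h where "h = (\<lambda>(x, y). \<Sum>i<2. u i x * v i y)"
    have h: "h \<in> tensor_functions X X (pts X) (pts X)"
      unfolding tensor_functions_def mem_Collect_eq h_def using const f(1)
      by (intro exI[of _ 2] exI[of _ u] exI[of _ v]) (simp add: u_def v_def)
    have h_eq: "h (a, b) = f a - f b" if "a \<in> pts X" "b \<in> pts X" for a b
      using that by (simp add: h_def u_def v_def numeral_2_eq_2)
    show "\<exists>T. openin (topo ?P) T \<and> p \<in> T \<and> T \<subseteq> topspace (topo ?P) - {(x, x) | x. x \<in> pts X}"
    proof (intro exI conjI)
      show "openin (topo ?P) {p \<in> pts X \<times> pts X. h p \<noteq> 0}" by (rule basis[OF h])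
      show "p \<in> {p \<in> pts X \<times> pts X. h p \<noteq> 0}" using xy f(2) h_eq by simp
      show "{p \<in> pts X \<times> pts X. h p \<noteq> 0} \<subseteq> topspace (topo ?P) - {(x, x) | x. x \<in> pts X}"
      proof
        fix r assume "r \<in> {p \<in> pts X \<times> pts X. h p \<noteq> 0}"
        then have r: "r \<in> pts X \<times> pts X" "h r \<noteq> 0" by auto
        moreover have "r \<notin> {(x, x) | x. x \<in> pts X}" using r h_eq by auto
        ultimately show "r \<in> topspace (topo ?P) - {(x, x) | x. x \<in> pts X}" using sup by blast
      qed
    qed
  qed
  moreover have "{(x, x) | x. x \<in> pts X} \<subseteq> topspace (topo ?P)" using sup by auto
  ultimately show ?thesis unfolding separated_def closedin_def by simp
qed

text \<open>For the topological quotient with the sheaf of invariants, most conditions are formal: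
  closed invariant sets are unions of orbits, hence full preimages, and invariant functions are
  exactly the pullbacks. What remains to be supplied is the variety structure and an affine cover
  with affine preimages.\<close>

lemma geometric_quotient_orbit:
  assumes act: "algebraic_action G XG \<alpha> X" and Y: "quotient_space X (orbit G \<alpha>) \<doteq> Y" and var: "variety Y"
    and cover: "\<And>y. y \<in> pts Y \<Longrightarrow> \<exists>U. y \<in> U \<and> openin (topo Y) U \<and> affine_variety (subspace_of Y U) \<and>
           affine_variety (subspace_of X {x \<in> pts X. orbit G \<alpha> x \<in> U})"
  shows "geometric_quotient G XG \<alpha> X Y (orbit G \<alpha>)"
proof -
  define \<pi> where "\<pi> = orbit G \<alpha>"
  let ?P = "\<lambda>U. {x \<in> pts X. \<pi> x \<in> U}"
  have group_act: "group_action G (pts X) (\<lambda>g. restrict (\<alpha> g) (pts X))"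
    using act unfolding algebraic_action_def by blast
  interpret group_action G "pts X" "\<lambda>g. restrict (\<alpha> g) (pts X)" by (rule group_act)
  have sheaf: "sheaf_of_functions X" using act unfolding algebraic_action_def variety_def by blast
  have \<alpha>: "\<alpha> g x \<in> pts X" if "g \<in> carrier G" "x \<in> pts X" for g x
    using element_image[OF that refl] that by simp
  \<comment> \<open>Reflexivity, symmetry and transitivity are available for the restricted action,
    which has the same orbits at points of \<open>X\<close>.\<close>
  have orb: "\<pi> x = orbit G (\<lambda>g. restrict (\<alpha> g) (pts X)) x" if "x \<in> pts X" for x
    using that unfolding \<pi>_def orbit_def by auto
  have mem: "x \<in> \<pi> x" if "x \<in> pts X" for x using orbit_refl[OF that] orb[OF that] by simp
  have sub: "y \<in> pts X" if "x \<in> pts X" "y \<in> \<pi> x" for x y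
    using that \<alpha> unfolding \<pi>_def orbit_def by auto
  have eq: "\<pi> y = \<pi> x" if xy: "x \<in> pts X" "y \<in> \<pi> x" for x y
  proof -
    have y: "y \<in> pts X" using sub xy by blast
    have "x \<in> \<pi> y" using orbit_sym[OF xy(1) y] xy orb[OF y] orb[OF xy(1)] by simp
    have tr: "\<pi> b \<subseteq> \<pi> a" if ab: "a \<in> pts X" "b \<in> \<pi> a" for a b
    proof
      fix c assume c: "c \<in> \<pi> b"
      have b: "b \<in> pts X" using sub ab by blast
      have "c \<in> pts X" using sub b c by blast
      then show "c \<in> \<pi> a" using orbit_trans[OF ab(1) b, of c] ab c orb[OF ab(1)] orb[OF b] by simp
    qed
    show ?thesis using tr[OF xy] tr[OF y \<open>x \<in> \<pi> y\<close>] by blast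
  qed
  have inv: "\<pi> (\<alpha> g x) = \<pi> x" if "g \<in> carrier G" "x \<in> pts X" for g x
    by (rule eq[OF that(2)]) (use that in \<open>auto simp: \<pi>_def orbit_def\<close>)
  have ptsY: "pts Y = \<pi> ` pts X"
    using same_structure_pts[OF Y] by (simp add: pts_quotient_space \<pi>_def)
  have oY: "openin (topo Y) U \<longleftrightarrow> U \<subseteq> \<pi> ` pts X \<and> openin (topo X) (?P U)" for U
    using same_structure_openin[OF Y] by (simp add: openin_quotient_space \<pi>_def)
  have rY: "f \<in> reg Y U \<longleftrightarrow> f \<in> extensional U \<and> pullback X \<pi> U f \<in> reg X (?P U)"
    if "openin (topo Y) U" for f U
    using same_structure_reg[OF Y, of U] that same_structure_openin[OF Y, of U]
    by (auto simp: quotient_space_def \<pi>_def)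
  have mor: "morphism X Y \<pi>"
    unfolding morphism_def continuous_map_def
    using oY rY ptsY unfolding pts_def by auto
  have good: "good_quotient G XG \<alpha> X Y \<pi>"
    unfolding good_quotient_def
  proof (intro conjI allI impI ballI)
    show "algebraic_action G XG \<alpha> X" "variety Y" "\<pi> ` pts X = pts Y" by (rule act var ptsY[symmetric])+
    show "affine_morphism X Y \<pi>"
      unfolding affine_morphism_def
    proof (intro conjI mor)
      define \<U> where "\<U> = {U. openin (topo Y) U \<and> affine_variety (subspace_of Y U) \<and>
           affine_variety (subspace_of X (?P U))}"
      have "\<Union>\<U> = pts Y"
      proof
        show "\<Union>\<U> \<subseteq> pts Y" using openin_subset unfolding \<U>_def pts_def by blast
        show "pts Y \<subseteq> \<Union>\<U>"
        proof
          fix y assume "y \<in> pts Y"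
          from cover[OF this] obtain U where "y \<in> U" "U \<in> \<U>" unfolding \<U>_def \<pi>_def by blast
          then show "y \<in> \<Union>\<U>" by blast
        qed
      qed
      then show "\<exists>\<U>. \<Union> \<U> = pts Y \<and> (\<forall>U\<in>\<U>. openin (topo Y) U \<and> affine_variety (subspace_of Y U) \<and>
           affine_variety (subspace_of X {x \<in> pts X. \<pi> x \<in> U}))"
        by (intro exI[of _ \<U>]) (simp add: \<U>_def)
    qed
    show "\<pi> (\<alpha> g x) = \<pi> x" if "g \<in> carrier G" "x \<in> pts X" for g x by (rule inv[OF that])
    show "bij_betw (pullback X \<pi> U) (reg Y U)
          {f \<in> reg X (?P U). \<forall>g\<in>carrier G. \<forall>x\<in>?P U. f (\<alpha> g x) = f x}" (is "bij_betw ?p ?R ?I")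
      if U: "openin (topo Y) U" for U
      unfolding bij_betw_def
    proof
      have US: "U \<subseteq> \<pi> ` pts X" and oP: "openin (topo X) (?P U)" using U unfolding oY by auto
      show "inj_on ?p ?R"
      proof (rule inj_onI)
        fix f g assume fg: "f \<in> ?R" "g \<in> ?R" "?p f = ?p g"
        show "f = g"
        proof (rule extensionalityI[of _ U])
          show "f \<in> extensional U" "g \<in> extensional U" using fg(1,2) unfolding rY[OF U] by auto
          fix y assume y: "y \<in> U"
          then obtain x where x: "x \<in> pts X" "y = \<pi> x" using US by auto
          have "?p f x = ?p g x" using fg(3) by simp
          then show "f y = g y" using x y by (simp add: pullback_def)
        qed
      qed
      show "?p ` ?R = ?I"
      proof
        show "?p ` ?R \<subseteq> ?I"
        proof
          fix f assume "f \<in> ?p ` ?R"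
          then obtain g where g: "f = ?p g" "g \<in> ?R" by auto
          have "f (\<alpha> a x) = f x" if "a \<in> carrier G" "x \<in> ?P U" for a x
            using that inv[of a x] \<alpha>[of a x] by (simp add: g(1) pullback_def)
          then show "f \<in> ?I" using g unfolding rY[OF U] by simp
        qed
        show "?I \<subseteq> ?p ` ?R"
        proof
          fix f assume f: "f \<in> ?I"
          have fe: "f \<in> extensional (?P U)"
            using f sheaf[unfolded sheaf_of_functions_def, THEN conjunct1, THEN spec, THEN spec, THEN mp, OF oP, of f] by simp
          define g where "g = restrict (\<lambda>y. f (SOME x. x \<in> pts X \<and> \<pi> x = y)) U"
          have g: "g (\<pi> x) = f x" if x: "x \<in> ?P U" for x
          proof -
            define z where "z = (SOME z. z \<in> pts X \<and> \<pi> z = \<pi> x)"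
            have z: "z \<in> pts X \<and> \<pi> z = \<pi> x" unfolding z_def by (rule someI[of _ x]) (use x in simp)
            then have "z \<in> \<pi> x" using mem[of z] by simp
            then obtain a where "a \<in> carrier G" "z = \<alpha> a x" unfolding \<pi>_def orbit_def by auto
            then have "f z = f x" using f x by auto
            then show ?thesis using x by (simp add: g_def z_def)
          qed
          have pg: "?p g = f"
            by (rule extensionalityI[OF _ fe]) (use g in \<open>auto simp: pullback_def\<close>)
          have "g \<in> ?R" unfolding rY[OF U] pg using f by (simp add: g_def)
          then show "f \<in> ?p ` ?R" using pg by (metis image_eqI)
        qed
      qed
    qed
    show "closedin (topo Y) (\<pi> ` Z)" if Z: "closedin (topo X) Z" "invariant_subset G \<alpha> Z" for Z
    proof -
      have ZX: "Z \<subseteq> pts X" using closedin_subset[OF Z(1)] unfolding pts_def .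
      have "x \<in> Z" if x: "x \<in> pts X" "z \<in> Z" "\<pi> x = \<pi> z" for x z
      proof -
        have "x \<in> \<pi> z" using mem[OF x(1)] x(3) by simp
        then obtain a where "a \<in> carrier G" "x = \<alpha> a z" unfolding \<pi>_def orbit_def by auto
        then show ?thesis using Z(2) x(2) unfolding invariant_subset_def by auto
      qed
      then have "?P (pts Y - \<pi> ` Z) = topspace (topo X) - Z"
        unfolding ptsY using ZX by (auto simp: pts_def)
      moreover have "openin (topo X) (topspace (topo X) - Z)" using Z(1) by auto
      ultimately have "openin (topo Y) (pts Y - \<pi> ` Z)"
        unfolding oY using ptsY by auto
      moreover have "\<pi> ` Z \<subseteq> pts Y" using ZX ptsY by auto
      ultimately show ?thesis unfolding closedin_def pts_def by simp
    qed
    show "\<pi> ` Z \<inter> \<pi> ` Z' = {}" if Z: "closedin (topo X) Z" "invariant_subset G \<alpha> Z"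
      "closedin (topo X) Z'" "invariant_subset G \<alpha> Z'" "Z \<inter> Z' = {}" for Z Z'
    proof (rule ccontr)
      assume "\<pi> ` Z \<inter> \<pi> ` Z' \<noteq> {}"
      then obtain z z' where zz: "z \<in> Z" "z' \<in> Z'" "\<pi> z = \<pi> z'" by blast
      then have "z \<in> pts X" using closedin_subset[OF Z(1)] unfolding pts_def by blast
      then have "z \<in> \<pi> z'" using mem zz(3) by blast
      then obtain a where "a \<in> carrier G" "z = \<alpha> a z'" unfolding \<pi>_def orbit_def by auto
      then have "z \<in> Z'" using Z(4) zz(2) unfolding invariant_subset_def by auto
      then show False using Z(5) zz(1) by blast
    qed
  qed
  have "{x' \<in> pts X. \<pi> x' = \<pi> x} = \<pi> x" if "x \<in> pts X" for x
    using mem sub[OF that] eq[OF that] by blast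
  then show ?thesis
    using good unfolding geometric_quotient_def \<pi>_def by blast
qed

section \<open>Quasi-periodic functions and theta functions\<close>

lemma holomorphic_on_compose_punctured:
  assumes "g holomorphic_on (- {0})" "u holomorphic_on (- {0})" "\<And>x. x \<noteq> 0 \<Longrightarrow> g x \<noteq> 0"
  shows "(\<lambda>x. u (g x)) holomorphic_on (- {0})"
proof -
  have "g ` (- {0}) \<subseteq> - {0}" using assms(3) by (intro image_subsetI) simp
  then show ?thesis using holomorphic_on_compose_gen[OF assms(1,2)] by (simp add: o_def)
qed

text \<open>Multiplication by a power of \<open>r\<close> moves every positive number into the
  half-open fundamental interval from \<open>r\<close> to 1: the exponent \<open>log r s\<close> is
  reduced to its fractional part.\<close>

lemma exists_power_scaling:
  fixes r s :: real
  assumes "0 < r" "r < 1" "0 < s"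
  shows "\<exists>k::int. r < s * r powi k \<and> s * r powi k \<le> 1"
proof -
  define t where "t = log r s"
  define k where "k = - \<lfloor>t\<rfloor>"
  have "s = r powr t" using assms by (simp add: t_def)
  moreover have "r powi k = r powr (real_of_int k)" using assms by (simp add: powr_real_of_int')
  ultimately have eq: "s * r powi k = r powr (frac t)"
    by (simp add: powr_add[symmetric] k_def frac_def)
  have "r powr 1 < r powr (frac t)"
    by (rule powr_less_mono') (use assms frac_lt_1 in auto)
  moreover have "r powr (frac t) \<le> r powr 0"
    by (rule powr_mono') (use assms in auto)
  ultimately show ?thesis using assms eq by (intro exI[of _ k]) auto
qed

text \<open>The annulus between \<open>norm q\<close> and 1 controls all values:
  \<open>norm l \<le> 1\<close> bounds \<open>g\<close> near 0, and \<open>norm q < norm l\<close>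
  gives at most linear growth at infinity, so \<open>g\<close> is affine linear by Liouville. The
  strict inequality also excludes \<open>l = q\<close>, the only multiplier that would allow a
  linear term.\<close>

lemma quasi_periodic_constant:
  fixes q l :: complex
  assumes q: "q \<noteq> 0" "norm q < 1" and hol: "g holomorphic_on (- {0})"
    and per: "\<And>x. x \<noteq> 0 \<Longrightarrow> g (q * x) = l * g x" and l: "norm q < norm l" "norm l \<le> 1"
  shows "\<exists>C. \<forall>x. x \<noteq> 0 \<longrightarrow> g x = C"
proof -
  define r where "r = norm q"
  have r: "0 < r" "r < 1" using q by (auto simp: r_def)
  let ?A = "cball 0 1 - ball (0::complex) r"
  have "compact ?A" by (intro compact_diff) auto
  moreover have "continuous_on ?A g"
    using r by (intro holomorphic_on_imp_continuous_on holomorphic_on_subset[OF hol]) auto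
  ultimately have "bounded (g ` ?A)" by (intro compact_imp_bounded compact_continuous_image)
  then obtain M where M: "M > 0" "\<And>x. x \<in> ?A \<Longrightarrow> norm (g x) \<le> M" unfolding bounded_pos by auto
  have pern: "g (q ^ n * x) = l ^ n * g x" if "x \<noteq> 0" for n x
  proof (induction n)
    case (Suc n)
    have "g (q ^ Suc n * x) = g (q * (q ^ n * x))" by (simp add: mult_ac)
    also have "\<dots> = l * g (q ^ n * x)" by (rule per) (use that q in auto)
    finally show ?case using Suc by simp
  qed simp
  have small: "norm (g x) \<le> M" if x: "x \<noteq> 0" "norm x \<le> 1" for x
  proof -
    obtain k where k: "r < norm x * r powi k" "norm x * r powi k \<le> 1"
      using exists_power_scaling[OF r, of "norm x"] x by auto
    show ?thesis
    proof (cases "k \<le> 0")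
      case True
      then obtain n where n: "k = - int n" by (metis nonpos_int_cases)
      define y where "y = x / q ^ n"
      have y: "x = q ^ n * y" "y \<noteq> 0" using q x by (auto simp: y_def)
      have "norm y = norm x * r powi k"
        by (simp add: y_def n norm_divide norm_mult norm_inverse norm_power r_def power_int_minus divide_inverse)
      then have "norm (g y) \<le> M" using k by (intro M(2)) auto
      moreover have "norm (l ^ n) \<le> 1" using l by (simp add: norm_power power_le_one)
      ultimately have "norm (l ^ n) * norm (g y) \<le> 1 * M" using M(1) by (intro mult_mono) auto
      then show ?thesis using pern[OF y(2), of n] y(1) by (simp add: norm_mult)
    next
      case False
      then have "r powi k \<le> r powi 1" using r by (intro power_int_decreasing) auto
      then have "norm x * r powi k \<le> 1 * r" using x r by (intro mult_mono) auto
      then show ?thesis using k(1) by simp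
    qed
  qed
  have large: "norm (g x) \<le> M / r * norm x" if x: "norm x \<ge> 1" for x
  proof -
    have x0: "x \<noteq> 0" using x by auto
    obtain k where k: "r < norm x * r powi k" "norm x * r powi k \<le> 1"
      using exists_power_scaling[OF r, of "norm x"] x by (auto simp: x0)
    show ?thesis
    proof (cases "k \<ge> 0")
      case True
      then obtain n where n: "k = int n" by (metis nonneg_int_cases)
      have "norm (q ^ n * x) = norm x * r powi k" by (simp add: n norm_mult norm_power r_def)
      then have "norm (g (q ^ n * x)) \<le> M" using k by (intro M(2)) auto
      then have "norm l ^ n * norm (g x) \<le> M" using pern[OF x0, of n] by (simp add: norm_mult norm_power)
      moreover have "r ^ n \<le> norm l ^ n" using l r by (intro power_mono) (auto simp: r_def)
      then have "r ^ n * norm (g x) \<le> norm l ^ n * norm (g x)" by (rule mult_right_mono) simp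
      ultimately have "r ^ n * norm (g x) \<le> M" by linarith
      moreover have "r / norm x \<le> r ^ n" using k(1) n x0 by (simp add: field_simps)
      then have "r / norm x * norm (g x) \<le> r ^ n * norm (g x)" by (rule mult_right_mono) simp
      ultimately have "r / norm x * norm (g x) \<le> M" by linarith
      then show ?thesis using r x0 by (simp add: field_simps)
    next
      case False
      then have "r powi 0 < r powi k" using r by (intro power_int_strict_decreasing) auto
      then have "1 * 1 < norm x * r powi k" using x by (intro mult_le_less_imp_less) auto
      then show ?thesis using k(2) by simp
    qed
  qed
  \<comment> \<open>Now \<open>y * g y\<close> extends to an entire function of at most quadratic growth.\<close>
  define f where "f = (\<lambda>y. if y = 0 then 0 else y * g y)"
  have "(\<lambda>y. y * g y) \<midarrow>0\<rightarrow> 0"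
  proof (rule Lim_null_comparison)
    show "\<forall>\<^sub>F y in at 0. norm (y * g y) \<le> norm y * M"
      unfolding eventually_at using small
      by (intro exI[of _ 1]) (auto simp: norm_mult intro!: mult_left_mono)
    show "((\<lambda>y::complex. norm y * M) \<longlongrightarrow> 0) (at 0)" by (auto intro!: tendsto_eq_intros)
  qed
  then have f: "f holomorphic_on UNIV"
    unfolding f_def by (intro removable_singularity) (auto intro!: holomorphic_intros hol simp: Compl_eq_Diff_UNIV[symmetric])
  have bound: "norm (f z) \<le> M / r * norm z ^ 2" if "1 \<le> norm z" for z
  proof -
    have "norm z * norm (g z) \<le> norm z * (M / r * norm z)" using large[OF that] by (intro mult_left_mono) auto
    then show ?thesis using that by (auto simp: f_def norm_mult power2_eq_square mult_ac)
  qed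
  define a where "a k = (deriv ^^ k) f 0 / fact k" for k
  have poly: "f z = a 0 + a 1 * z + a 2 * z ^ 2" for z
    using Liouville_polynomial[OF f bound, where \<xi> = z] by (simp add: a_def numeral_2_eq_2)
  have "a 0 = 0" using poly[of 0] by (simp add: f_def)
  have fq: "f (q * z) = q * l * f z" for z using per[of z] q by (simp add: f_def)
  \<comment> \<open>Comparing the functional equation at 1 and at -1 isolates the coefficient
    \<open>a 2\<close>.\<close>
  have e1: "a 1 * q + a 2 * q ^ 2 = q * l * (a 1 + a 2)"
    using fq[of 1] poly[of 1] poly[of q] \<open>a 0 = 0\<close> by simp
  have e2: "- (a 1 * q) + a 2 * q ^ 2 = q * l * (- a 1 + a 2)"
    using fq[of "-1"] poly[of "-1"] poly[of "- q"] \<open>a 0 = 0\<close> by simp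
  have "2 * (a 2 * q ^ 2) = 2 * (q * l * a 2)" using e1 e2 by algebra
  then have "a 2 * (q - l) = 0" using q(1) by (simp add: power2_eq_square algebra_simps)
  then have "a 2 = 0" using l by auto
  then have fz: "f z = a 1 * z" for z using poly \<open>a 0 = 0\<close> by simp
  have "g z = a 1" if "z \<noteq> 0" for z using fz[of z] that by (simp add: f_def)
  then show ?thesis by blast
qed

text \<open>Up to a constant factor the function is a monomial. A nonzero monomial has no zeros in
  the punctured plane, and its multiplier is a power of \<open>q\<close>.\<close>

lemma quasi_periodic_nowhere_zero:
  fixes q c :: complex
  assumes q: "q \<noteq> 0" "norm q < 1" and hol: "f holomorphic_on (- {0})" and c: "c \<noteq> 0"
    and per: "\<And>x. x \<noteq> 0 \<Longrightarrow> f (q * x) = c * f x"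
  shows "(\<forall>x. x \<noteq> 0 \<longrightarrow> f x = 0) \<or> (q_equiv q c 1 \<and> (\<forall>x. x \<noteq> 0 \<longrightarrow> f x \<noteq> 0))"
proof -
  obtain k where k: "norm q < norm c * norm q powi k" "norm c * norm q powi k \<le> 1"
    using exists_power_scaling[of "norm q" "norm c"] q c by auto
  \<comment> \<open>The power moves the norm of the multiplier into the interval in which the previous lemma applies.\<close>
  define g where "g x = x powi k * f x" for x
  have "\<exists>C. \<forall>x. x \<noteq> 0 \<longrightarrow> g x = C"
  proof (rule quasi_periodic_constant[OF q])
    show "g holomorphic_on - {0}" unfolding g_def by (intro holomorphic_intros hol) auto
    show "g (q * x) = (c * q powi k) * g x" if "x \<noteq> 0" for x
      using per[OF that] by (simp add: g_def power_int_mult_distrib mult_ac)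
  qed (use k in \<open>simp_all add: norm_mult norm_power_int\<close>)
  then obtain C where C: "\<And>x. x \<noteq> 0 \<Longrightarrow> g x = C" by auto
  have f: "f x = C * x powi (- k)" if "x \<noteq> 0" for x
    using C[OF that] that by (simp add: g_def power_int_minus field_simps)
  show ?thesis
  proof (cases "C = 0")
    case True then show ?thesis using f by simp
  next
    case False
    have "q powi (-k) = c" using per[of 1] f[of 1] f[of q] q False by simp
    then have "q_equiv q c 1" unfolding q_equiv_def by (intro exI[of _ "-k"]) simp
    then show ?thesis using f False by simp
  qed
qed

lemma q_equiv_scale: "a \<noteq> 0 \<Longrightarrow> q_equiv q (x / a) 1 \<longleftrightarrow> q_equiv q x a"
  by (simp add: q_equiv_def)

section \<open>The theta function and its zeros\<close>

text \<open>The infinite q-Pochhammer symbol of \<open>x\<close>; it accounts for the zeros of theta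
  at the powers of \<open>q\<close> with exponent at most 0.\<close>

definition q_product :: "complex \<Rightarrow> complex \<Rightarrow> complex" where
  "q_product q x = (\<Prod>n. 1 - q ^ n * x)"

text \<open>By the Jacobi triple product this is, up to a constant factor, the sum of (-x)^n
  q^(n(n-1)/2) over all integers n. The second product contributes the zeros at the positive powers
  of \<open>q\<close>.\<close>

definition theta :: "complex \<Rightarrow> complex \<Rightarrow> complex" where
  "theta q x = q_product q x * q_product q (q / x)"

context
  fixes q :: complex
  assumes q: "q \<noteq> 0" "norm q < 1"
begin

lemma summable_q: "summable (\<lambda>n. norm (q ^ n * x))"
  using q by (auto simp: norm_mult norm_power intro!: summable_mult2 summable_geometric)

lemma convergent_q_product: "convergent_prod (\<lambda>n. 1 - q ^ n * x)"
proof -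
  have "summable (\<lambda>n. norm (1 - q ^ n * x - 1))" using summable_q[of x] by simp
  then show ?thesis
    by (intro abs_convergent_prod_imp_convergent_prod) (simp only: abs_convergent_prod_conv_summable)
qed

lemma q_product_LIMSEQ: "(\<lambda>n. \<Prod>i<n. 1 - q ^ i * x) \<longlonglongrightarrow> q_product q x"
  using convergent_prod_LIMSEQ[OF convergent_q_product[of x]]
  unfolding q_product_def LIMSEQ_lessThan_iff_atMost .

lemma holomorphic_q_product: "q_product q holomorphic_on UNIV"
proof (rule holomorphic_uniform_sequence[where f = "\<lambda>n x. \<Prod>i<n. 1 - q ^ i * x"])
  fix x :: complex
  let ?A = "cball x 1"
  have "uniformly_convergent_on ?A (\<lambda>n y. \<Sum>i<n. norm (1 - q ^ i * y - 1))"
  proof (rule Weierstrass_m_test')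
    show "norm (norm (1 - q ^ n * y - 1)) \<le> norm (q ^ n * of_real (norm x + 1))" if "y \<in> ?A" for n y
    proof -
      have "norm y \<le> norm x + 1" using that norm_triangle_ineq2[of y x] by (simp add: dist_norm norm_minus_commute)
      then have "norm q ^ n * norm y \<le> norm q ^ n * (norm x + 1)" by (intro mult_left_mono) auto
      moreover have "norm (complex_of_real (norm x + 1)) = norm x + 1"
        unfolding norm_of_real by simp
      ultimately show ?thesis by (simp only: norm_mult norm_power) (simp add: norm_mult norm_power)
    qed
  qed (rule summable_q)
  then have "uniformly_convergent_on ?A (\<lambda>n y. \<Prod>i<n. 1 - q ^ i * y)"
    by (intro uniformly_convergent_on_prod') (auto intro!: continuous_intros)
  then have "uniform_limit ?A (\<lambda>n y. \<Prod>i<n. 1 - q ^ i * y) (\<lambda>y. lim (\<lambda>n. \<Prod>i<n. 1 - q ^ i * y)) sequentially"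
    unfolding uniformly_convergent_uniform_limit_iff .
  also have "(\<lambda>y. lim (\<lambda>n. \<Prod>i<n. 1 - q ^ i * y)) = q_product q"
    using q_product_LIMSEQ by (auto intro!: limI)
  finally show "\<exists>d>0. cball x d \<subseteq> UNIV \<and> uniform_limit (cball x d) (\<lambda>n y. \<Prod>i<n. 1 - q ^ i * y) (q_product q) sequentially"
    by (intro exI[of _ 1]) auto
qed (auto intro!: holomorphic_intros)

lemma q_product_shift: "q_product q x = (1 - x) * q_product q (q * x)"
proof (rule LIMSEQ_unique)
  show "(\<lambda>n. \<Prod>i<Suc n. 1 - q ^ i * x) \<longlonglongrightarrow> q_product q x"
    by (rule LIMSEQ_Suc[OF q_product_LIMSEQ])
  have "(\<Prod>i<Suc n. 1 - q ^ i * x) = (1 - x) * (\<Prod>i<n. 1 - q ^ i * (q * x))" for n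
    by (subst prod.lessThan_Suc_shift) (simp add: mult_ac)
  then show "(\<lambda>n. \<Prod>i<Suc n. 1 - q ^ i * x) \<longlonglongrightarrow> (1 - x) * q_product q (q * x)"
    using tendsto_mult_left[OF q_product_LIMSEQ[of "q * x"], of "1 - x"] by simp
qed

lemma q_product_nonzero: "(\<And>n. q ^ n * x \<noteq> 1) \<Longrightarrow> q_product q x \<noteq> 0"
  unfolding q_product_def by (intro prodinf_nonzero convergent_q_product) (metis right_minus_eq)

lemma holomorphic_theta: "theta q holomorphic_on (- {0})"
proof -
  have "(\<lambda>x. q / x) holomorphic_on (- {0})"
    by (intro holomorphic_on_divide holomorphic_on_const holomorphic_on_ident) auto
  then have "(\<lambda>x. q_product q (q / x)) holomorphic_on (- {0})"
    using holomorphic_on_compose_gen[OF _ holomorphic_q_product, of "\<lambda>x. q / x" "- {0}"]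
    by (simp add: o_def)
  then show ?thesis
    unfolding theta_def by (intro holomorphic_intros holomorphic_on_subset[OF holomorphic_q_product]) auto
qed

text \<open>Passing from \<open>x\<close> to \<open>q * x\<close> removes the factor 1 - x from one
  product and adds the factor 1 - 1/x to the other.\<close>

lemma theta_shift:
  assumes "x \<noteq> 0"
  shows "theta q (q * x) = - theta q x / x"
proof -
  have "q_product q (1 / x) = (1 - 1 / x) * q_product q (q / x)"
    using q_product_shift[of "1 / x"] by simp
  then have "theta q (q * x) = q_product q (q * x) * ((1 - 1 / x) * q_product q (q / x))"
    using q by (simp add: theta_def)
  moreover have "theta q x = (1 - x) * q_product q (q * x) * q_product q (q / x)"
    using q_product_shift[of x] by (simp add: theta_def)
  \<comment> \<open>The comparison multiplies by \<open>x\<close> instead of dividing by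
    \<open>1 - x\<close>, so \<open>x = 1\<close> is no exception.\<close>
  moreover have "x * (q_product q (q * x) * ((1 - 1 / x) * q_product q (q / x))) =
      - ((1 - x) * q_product q (q * x) * q_product q (q / x))"
    using assms by (simp add: field_simps)
  ultimately have "x * theta q (q * x) = - theta q x" by simp
  then show ?thesis using assms by (simp add: field_simps)
qed

lemma theta_nonzero:
  assumes "x \<noteq> 0" "\<not> q_equiv q x 1"
  shows "theta q x \<noteq> 0"
proof -
  have "q_product q x \<noteq> 0"
  proof (rule q_product_nonzero, rule notI)
    fix n assume "q ^ n * x = 1"
    then have "x = q powi (- int n)" using q by (simp add: power_int_minus field_simps)
    then show False using assms(2) unfolding q_equiv_def by (metis div_by_1)
  qed
  moreover have "q_product q (q / x) \<noteq> 0"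
  proof (rule q_product_nonzero, rule notI)
    fix n assume "q ^ n * (q / x) = 1"
    then have "x = q powi (int (Suc n))" using q assms by (simp add: field_simps del: of_nat_Suc)
    then show False using assms(2) unfolding q_equiv_def by (metis div_by_1)
  qed
  ultimately show ?thesis by (simp add: theta_def)
qed

text \<open>At 1 the linear factor stands in the product itself, and the remaining factors are
  nonzero because no positive power of \<open>q\<close> is 1. The shift rule carries this
  factorisation to the neighbouring powers in both directions.\<close>

lemma theta_simple_zero:
  "\<exists>u. u holomorphic_on (- {0}) \<and> u (q powi n) \<noteq> 0 \<and> (\<forall>x. x \<noteq> 0 \<longrightarrow> theta q x = (x - q powi n) * u x)"
    (is "?Z n")
proof (induction n rule: int_induct[of _ 0])
  case base
  define u where "u x = - (q_product q (q * x) * q_product q (q / x))" for x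
  have "(\<lambda>x. q / x) holomorphic_on (- {0})" "(\<lambda>x. q * x) holomorphic_on (- {0})"
    by (intro holomorphic_on_divide holomorphic_on_mult holomorphic_on_const holomorphic_on_ident; auto)+
  then have "(\<lambda>x. q_product q (q / x)) holomorphic_on (- {0})" "(\<lambda>x. q_product q (q * x)) holomorphic_on (- {0})"
    using holomorphic_on_compose_gen[OF _ holomorphic_q_product, of "\<lambda>x. q / x" "- {0}"]
      holomorphic_on_compose_gen[OF _ holomorphic_q_product, of "\<lambda>x. q * x" "- {0}"]
    by (simp_all add: o_def)
  then have "u holomorphic_on (- {0})" unfolding u_def by (intro holomorphic_intros)
  moreover have "q ^ n * q \<noteq> 1" for n
  proof
    assume "q ^ n * q = 1"
    then have "norm q ^ Suc n = 1" by (metis mult.commute norm_one norm_power power_Suc)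
    moreover have "norm q ^ Suc n < 1" using q by (intro power_Suc_less_one) auto
    ultimately show False by simp
  qed
  then have "u 1 \<noteq> 0" using q_product_nonzero[of q] by (simp add: u_def)
  moreover have "theta q x = (x - 1) * u x" for x
    unfolding theta_def u_def by (subst q_product_shift[of x]) (simp add: algebra_simps)
  ultimately show ?case by auto
next
  case (step1 i)
  then obtain u where u: "u holomorphic_on (- {0})" "u (q powi i) \<noteq> 0"
    "\<forall>x. x \<noteq> 0 \<longrightarrow> theta q x = (x - q powi i) * u x" by blast
  define v where "v x = - u (x / q) / x" for x
  have pw: "q powi (i + 1) = q * q powi i" using q by (simp add: power_int_add)
  have "(\<lambda>x. x / q) holomorphic_on (- {0})"
    using q by (intro holomorphic_on_divide holomorphic_on_const holomorphic_on_ident) auto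
  then have "(\<lambda>x. u (x / q)) holomorphic_on (- {0})"
    by (rule holomorphic_on_compose_punctured[OF _ u(1)]) (use q in auto)
  then have "v holomorphic_on (- {0})" unfolding v_def by (intro holomorphic_intros) auto
  moreover have "v (q powi (i + 1)) \<noteq> 0" using u(2) q by (simp add: v_def pw)
  moreover have "theta q x = (x - q powi (i + 1)) * v x" if "x \<noteq> 0" for x
  proof -
    have 1: "theta q x = - theta q (x / q) / (x / q)"
      using theta_shift[of "x / q"] that q by simp
    have 2: "theta q (x / q) = (x / q - q powi i) * u (x / q)" using u(3) that q by simp
    have 3: "- ((x / q - p) * w) / (x / q) = (x - q * p) * (- w / x)" for p w :: complex
      using that q by (simp add: divide_simps)
    show ?thesis unfolding v_def pw 1 2 by (rule 3)
  qed
  ultimately show ?case by blast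
next
  case (step2 i)
  then obtain u where u: "u holomorphic_on (- {0})" "u (q powi i) \<noteq> 0"
    "\<forall>x. x \<noteq> 0 \<longrightarrow> theta q x = (x - q powi i) * u x" by blast
  define v where "v x = - q * x * u (q * x)" for x
  have pw: "q powi i = q * q powi (i - 1)" using q by (simp add: power_int_diff)
  have "(\<lambda>x. u (q * x)) holomorphic_on (- {0})"
    by (rule holomorphic_on_compose_punctured[OF _ u(1)]) (use q in \<open>auto intro!: holomorphic_intros\<close>)
  then have "v holomorphic_on (- {0})" unfolding v_def by (intro holomorphic_intros)
  moreover have "v (q powi (i - 1)) \<noteq> 0" using u(2) q by (simp add: v_def pw)
  moreover have "theta q x = (x - q powi (i - 1)) * v x" if "x \<noteq> 0" for x
  proof -
    have 1: "theta q x = - x * theta q (q * x)" using theta_shift[OF that] that by simp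
    have 2: "theta q (q * x) = (q * x - q * q powi (i - 1)) * u (q * x)" using u(3) that q by (simp add: pw)
    have 3: "- x * ((q * x - q * p) * w) = (x - p) * (- q * x * w)" for p w :: complex
      by (simp add: algebra_simps)
    show ?thesis unfolding v_def 1 2 by (rule 3)
  qed
  ultimately show ?case by blast
qed

text \<open>The local form that makes division and cancellation by theta possible without speaking
  of orders of zeros. The neighbourhood is the set where the factor \<open>u\<close> does not
  vanish.\<close>

lemma isolated_theta_zero:
  assumes "x \<noteq> 0" "a \<noteq> 0"
  shows "\<exists>N u. open N \<and> x \<in> N \<and> N \<subseteq> - {0} \<and> u holomorphic_on N \<and> (\<forall>y\<in>N. u y \<noteq> 0) \<and>
    ((\<forall>y\<in>N. theta q (y / a) = u y) \<or> theta q (x / a) = 0 \<and> (\<forall>y\<in>N. theta q (y / a) = (y - x) * u y))"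
proof -
  have div: "(\<lambda>y. y / a) holomorphic_on (- {0})"
    using assms by (intro holomorphic_on_divide holomorphic_on_const holomorphic_on_ident) auto
  have comp: "(\<lambda>y. u (y / a)) holomorphic_on (- {0})" if "u holomorphic_on (- {0})" for u
    by (rule holomorphic_on_compose_punctured[OF div that]) (use assms in auto)
  have opn: "open {y \<in> - {0}. u y \<noteq> 0}" if "u holomorphic_on (- {0})" for u :: "complex \<Rightarrow> complex"
  proof -
    have "open (- {0} \<inter> u -` (- {0}))"
      using holomorphic_on_imp_continuous_on[OF that] by (intro continuous_open_preimage) auto
    also have "- {0} \<inter> u -` (- {0}) = {y \<in> - {0}. u y \<noteq> 0}" by auto
    finally show ?thesis .
  qed
  show ?thesis
  proof (cases "theta q (x / a) = 0")
    case False
    define u where "u y = theta q (y / a)" for y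
    have u: "u holomorphic_on (- {0})" unfolding u_def by (rule comp[OF holomorphic_theta])
    show ?thesis
      using opn[OF u] False assms holomorphic_on_subset[OF u]
      by (intro exI[of _ "{y \<in> - {0}. u y \<noteq> 0}"] exI[of _ u]) (auto simp: u_def)
  next
    case True
    then have "q_equiv q (x / a) 1" using theta_nonzero[of "x / a"] assms by auto
    then obtain n where n: "x / a = q powi n" unfolding q_equiv_def by auto
    obtain v where v: "v holomorphic_on (- {0})" "v (x / a) \<noteq> 0"
      "\<forall>y. y \<noteq> 0 \<longrightarrow> theta q y = (y - x / a) * v y" using theta_simple_zero[of n] unfolding n by blast
    define u where "u y = v (y / a) / a" for y
    have u: "u holomorphic_on (- {0})"
      unfolding u_def using assms by (intro holomorphic_on_divide comp[OF v(1)] holomorphic_on_const) auto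
    have th: "theta q (y / a) = (y - x) * u y" if "y \<noteq> 0" for y
      using v(3)[rule_format, of "y / a"] that assms by (simp add: u_def diff_divide_distrib[symmetric])
    show ?thesis
    proof (intro exI conjI disjI2 ballI)
      show "open {y \<in> - {0}. u y \<noteq> 0}" by (rule opn[OF u])
      show "x \<in> {y \<in> - {0}. u y \<noteq> 0}" using assms v(2) by (simp add: u_def)
      show "u holomorphic_on {y \<in> - {0}. u y \<noteq> 0}" by (rule holomorphic_on_subset[OF u]) auto
    qed (use True th in auto)
  qed
qed

section \<open>Dividing out prescribed zeros\<close>

lemma theta_division:
  assumes a: "a \<noteq> 0" and f: "f holomorphic_on (- {0})"
    and zero: "\<And>x. x \<noteq> 0 \<Longrightarrow> theta q (x / a) = 0 \<Longrightarrow> f x = 0"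
  shows "\<exists>g. g holomorphic_on (- {0}) \<and> (\<forall>x. x \<noteq> 0 \<longrightarrow> f x = theta q (x / a) * g x)"
proof -
  define g where "g x = Lim (at x) (\<lambda>z. f z / theta q (z / a))" for x
  have local: "\<exists>N k. open N \<and> x \<in> N \<and> N \<subseteq> - {0} \<and> k holomorphic_on N \<and>
      (\<forall>y\<in>N. f y = theta q (y / a) * k y) \<and> (\<forall>y\<in>N. g y = k y)" if x: "x \<noteq> 0" for x
  proof -
    obtain N u where N: "open N" "x \<in> N" "N \<subseteq> - {0}" and u: "u holomorphic_on N" "\<forall>y\<in>N. u y \<noteq> 0"
      and th: "(\<forall>y\<in>N. theta q (y / a) = u y) \<or>
        theta q (x / a) = 0 \<and> (\<forall>y\<in>N. theta q (y / a) = (y - x) * u y)"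
      using isolated_theta_zero[OF x a] by (elim exE conjE)
    have fN: "f holomorphic_on N" by (rule holomorphic_on_subset[OF f N(3)])
    have "\<exists>k. k holomorphic_on N \<and> (\<forall>y\<in>N. f y = theta q (y / a) * k y)"
      using th
    proof
      assume "\<forall>y\<in>N. theta q (y / a) = u y"
      then show ?thesis using u fN
        by (intro exI[of _ "\<lambda>y. f y / u y"]) (auto intro!: holomorphic_intros)
    next
      assume *: "theta q (x / a) = 0 \<and> (\<forall>y\<in>N. theta q (y / a) = (y - x) * u y)"
      define v where "v = (\<lambda>z. if z = x then deriv f x else (f z - f x) / (z - x))"
      have v: "v holomorphic_on N" unfolding v_def by (rule pole_lemma_open[OF fN N(1)])
      have "f x = 0" using zero[OF x] * by blast
      then have "f y = (y - x) * v y" for y by (simp add: v_def)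
      then show ?thesis using u v *
        by (intro exI[of _ "\<lambda>y. v y / u y"]) (auto intro!: holomorphic_intros)
    qed
    then obtain k where k: "k holomorphic_on N" "\<forall>y\<in>N. f y = theta q (y / a) * k y" by blast
    have nz: "theta q (y / a) \<noteq> 0" if "y \<in> N - {x}" for y using th that u(2) by auto
    have "g y = k y" if y: "y \<in> N" for y
    proof -
      \<comment> \<open>Theta has no zeros in this set, which is a punctured neighbourhood of
        \<open>x\<close> and a neighbourhood of every other point of \<open>N\<close>.\<close>
      have "open (N - {x})" using N(1) by (intro open_Diff) auto
      have "\<forall>\<^sub>F z in at y. z \<in> N - {x}"
      proof (cases "y = x")
        case True
        then show ?thesis using N(1,2) by (metis Diff_iff eventually_at_in_open insertE)
      next
        case False
        then show ?thesis using \<open>open (N - {x})\<close> y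
          by (intro eventually_at_in_open') auto
      qed
      then have "\<forall>\<^sub>F z in at y. k z = f z / theta q (z / a)"
        by eventually_elim (use nz k(2) in auto)
      moreover have "isCont k y"
        using holomorphic_on_imp_continuous_on[OF k(1)] N(1) y by (simp add: continuous_on_eq_continuous_at)
      ultimately have "((\<lambda>z. f z / theta q (z / a)) \<longlongrightarrow> k y) (at y)"
        unfolding isCont_def by (rule Lim_transform_eventually[rotated])
      then show ?thesis unfolding g_def by (intro tendsto_Lim) auto
    qed
    then show ?thesis using N k by blast
  qed
  have "g field_differentiable (at x)" if x: "x \<noteq> 0" for x
  proof -
    obtain N k where N: "open N" "x \<in> N" "k holomorphic_on N" "\<forall>y\<in>N. g y = k y"
      using local[OF x] by (elim exE conjE)
    have "g holomorphic_on N" using holomorphic_cong[of N N g k] N by auto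
    then show ?thesis using N by (simp add: holomorphic_on_open field_differentiable_def)
  qed
  then have "g holomorphic_on (- {0})"
    unfolding holomorphic_on_def by (auto intro: field_differentiable_at_within)
  moreover have "f x = theta q (x / a) * g x" if x: "x \<noteq> 0" for x
    using local[OF x] by (elim exE conjE) auto
  ultimately show ?thesis by blast
qed

text \<open>Near \<open>x\<close> theta can vanish only at \<open>x\<close> itself, so
  \<open>h\<close> is zero on a punctured neighbourhood and, by continuity, at
  \<open>x\<close>.\<close>

lemma theta_cancel:
  assumes a: "a \<noteq> 0" and h: "continuous_on (- {0}) h"
    and zero: "\<And>x. x \<noteq> 0 \<Longrightarrow> theta q (x / a) * h x = 0" and x: "x \<noteq> 0"
  shows "h x = 0"
proof -
  obtain N u where N: "open N" "x \<in> N" "N \<subseteq> - {0}" and u: "u holomorphic_on N" "\<forall>y\<in>N. u y \<noteq> 0"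
      and th: "(\<forall>y\<in>N. theta q (y / a) = u y) \<or>
        theta q (x / a) = 0 \<and> (\<forall>y\<in>N. theta q (y / a) = (y - x) * u y)"
      using isolated_theta_zero[OF x a] by (elim exE conjE)
  have "\<forall>\<^sub>F z in at x. z \<in> N - {x}" using N by (intro eventually_at_in_open) auto
  then have "\<forall>\<^sub>F z in at x. h z = 0"
  proof eventually_elim
    case (elim z)
    then have "theta q (z / a) \<noteq> 0" using th u(2) by auto
    moreover have "z \<noteq> 0" using elim N(3) by auto
    ultimately show ?case using zero by auto
  qed
  then have "(h \<longlongrightarrow> 0) (at x)" by (simp add: tendsto_eventually)
  moreover have "(h \<longlongrightarrow> h x) (at x)"
    using h x by (simp add: continuous_on_eq_continuous_at open_Compl isCont_def)
  ultimately show ?thesis by (intro tendsto_unique[of "at x" h]) auto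
qed

text \<open>Each point of \<open>A\<close> is removed by dividing by \<open>theta q (x / a)\<close>,
  which lowers the exponent \<open>card A\<close> by one and replaces \<open>c\<close> by
  \<open>- c / a\<close>. When no point is left, the quotient is zero or nowhere zero; in the second
  case the zeros of \<open>f\<close> are those of the theta factors, and the last multiplier is a
  power of \<open>q\<close>.\<close>

lemma quasi_periodic_zeros:
  assumes "finite A" "0 \<notin> A" "\<And>a b. a \<in> A \<Longrightarrow> b \<in> A \<Longrightarrow> a \<noteq> b \<Longrightarrow> \<not> q_equiv q a b"
    and "f holomorphic_on (- {0})" "c \<noteq> 0" "\<And>x. x \<noteq> 0 \<Longrightarrow> f (q * x) * x ^ card A = c * f x"
    and "\<And>a. a \<in> A \<Longrightarrow> f a = 0"
  shows "(\<forall>x. x \<noteq> 0 \<longrightarrow> f x = 0) \<or>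
    (q_equiv q c (\<Prod>a\<in>A. - a) \<and> (\<forall>x. x \<noteq> 0 \<longrightarrow> (\<forall>a\<in>A. \<not> q_equiv q x a) \<longrightarrow> f x \<noteq> 0))"
  using assms
proof (induction A arbitrary: f c rule: finite_induct)
  case empty
  then show ?case using quasi_periodic_nowhere_zero[OF q, of f c] by auto
next
  case (insert a A)
  have a: "a \<noteq> 0" using insert.prems(1) by auto
  have f: "f holomorphic_on (- {0})" by fact
  have per: "f (q * x) * x ^ Suc (card A) = c * f x" if "x \<noteq> 0" for x
    using insert.prems(5)[OF that] insert.hyps by simp
  \<comment> \<open>The functional equation spreads the zero at \<open>a\<close> over its whole
    class, that is, over all zeros of \<open>theta q (x / a)\<close>.\<close>
  have down: "f (q powi n * a) = 0" for n
  proof (induction n rule: int_induct[of _ 0])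
    case base then show ?case using insert.prems(6)[of a] by simp
  next
    case (step1 i)
    have "f (q * (q powi i * a)) = 0" using per[of "q powi i * a"] step1 q a by simp
    then show ?case using q by (simp add: power_int_add mult_ac)
  next
    case (step2 i)
    have "q * (q powi (i - 1) * a) = q powi i * a" using q by (simp add: power_int_diff)
    then have "f (q * (q powi (i - 1) * a)) = 0" using step2 by (simp only:)
    then show ?case using per[of "q powi (i - 1) * a"] q a \<open>c \<noteq> 0\<close> by simp
  qed
  have "f x = 0" if "x \<noteq> 0" "theta q (x / a) = 0" for x
  proof -
    have "q_equiv q (x / a) 1" using theta_nonzero[of "x / a"] that a by auto
    then obtain n where "x / a = q powi n" unfolding q_equiv_def by auto
    then have "x = q powi n * a" using a by (simp add: field_simps)
    then show ?thesis using down by simp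
  qed
  then obtain g where g: "g holomorphic_on (- {0})" and fg: "\<And>x. x \<noteq> 0 \<Longrightarrow> f x = theta q (x / a) * g x"
    using theta_division[OF a f] by blast
  have nz: "theta q (x / a) \<noteq> 0" if "x \<noteq> 0" "\<not> q_equiv q x a" for x
    using theta_nonzero[of "x / a"] that a q_equiv_scale by auto
  \<comment> \<open>The shift of \<open>x\<close> by \<open>q\<close> multiplies
    \<open>theta q (x / a)\<close> by \<open>- a / x\<close>, whence both the sign and the division
    by \<open>a\<close>.\<close>
  define c' where "c' = - c / a"
  have gper: "g (q * x) * x ^ card A = c' * g x" if x: "x \<noteq> 0" for x
  proof -
    have gq: "(\<lambda>x. g (q * x)) holomorphic_on (- {0})"
    proof -
      have "(\<lambda>x. q * x) holomorphic_on (- {0})" by (intro holomorphic_intros)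
      from holomorphic_on_compose_punctured[OF this g] show ?thesis using q by simp
    qed
    \<comment> \<open>The equation for \<open>g\<close> is immediate only after multiplication by
      theta; at the zeros of theta it follows by continuity.\<close>
    have "a * g (q * x) * x ^ card A + c * g x = 0"
    proof (rule theta_cancel[OF a _ _ x])
      show "continuous_on (- {0}) (\<lambda>x. a * g (q * x) * x ^ card A + c * g x)"
        by (intro holomorphic_on_imp_continuous_on holomorphic_intros g gq)
      fix y :: complex assume y: "y \<noteq> 0"
      have "theta q (q * (y / a)) = - theta q (y / a) / (y / a)" using theta_shift[of "y / a"] y a by simp
      then have "theta q (q * y / a) * y = - a * theta q (y / a)" using y a by (simp add: field_simps)
      moreover have "theta q (q * y / a) * g (q * y) * (y * y ^ card A) = c * (theta q (y / a) * g y)"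
        using per[OF y] fg[of "q * y"] fg[OF y] y q by simp
      then have "theta q (y / a) * (a * g (q * y) * y ^ card A + c * g y) =
          g (q * y) * y ^ card A * (theta q (q * y / a) * y + a * theta q (y / a))"
        by (simp add: algebra_simps)
      ultimately show "theta q (y / a) * (a * g (q * y) * y ^ card A + c * g y) = 0" by simp
    qed
    then have "a * g (q * x) * x ^ card A = - (c * g x)" by (rule eq_neg_iff_add_eq_0[THEN iffD2])
    then show ?thesis using a unfolding c'_def by (simp add: field_simps)
  qed
  have "(\<forall>x. x \<noteq> 0 \<longrightarrow> g x = 0) \<or>
    (q_equiv q c' (\<Prod>a\<in>A. - a) \<and> (\<forall>x. x \<noteq> 0 \<longrightarrow> (\<forall>a\<in>A. \<not> q_equiv q x a) \<longrightarrow> g x \<noteq> 0))"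
  proof (rule insert.IH)
    show "g b = 0" if b: "b \<in> A" for b
    proof -
      have b0: "b \<noteq> 0" using b insert.prems(1) by auto
      have "b \<noteq> a" using b insert.hyps by auto
      then have "\<not> q_equiv q b a" using insert.prems(2)[of b a] b by auto
      then show ?thesis using nz[OF b0] fg[OF b0] insert.prems(6)[of b] b by simp
    qed
    show "0 \<notin> A" using insert.prems(1) by simp
    show "\<not> q_equiv q b b'" if "b \<in> A" "b' \<in> A" "b \<noteq> b'" for b b'
      using insert.prems(2) that by simp
    show "c' \<noteq> 0" using a \<open>c \<noteq> 0\<close> by (simp add: c'_def)
  qed (fact g gper)+
  moreover have eqv: "q_equiv q c (\<Prod>a\<in>insert a A. - a) \<longleftrightarrow> q_equiv q c' (\<Prod>a\<in>A. - a)"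
    unfolding q_equiv_def c'_def using insert.hyps by (simp add: field_simps)
  ultimately show ?case
  proof (elim disjE)
    assume "\<forall>x. x \<noteq> 0 \<longrightarrow> g x = 0"
    then show ?thesis using fg by simp
  next
    assume *: "q_equiv q c' (\<Prod>a\<in>A. - a) \<and> (\<forall>x. x \<noteq> 0 \<longrightarrow> (\<forall>a\<in>A. \<not> q_equiv q x a) \<longrightarrow> g x \<noteq> 0)"
    have "f x \<noteq> 0" if "x \<noteq> 0" "\<forall>a\<in>insert a A. \<not> q_equiv q x a" for x
      using fg[OF that(1)] nz[OF that(1)] * that by simp
    then show ?thesis using * eqv by simp
  qed
qed

end

section \<open>The torus\<close>

lemma variety_if_affine:
  assumes "X \<doteq> zar S G" "affine_variety (zar S G)"
  shows "variety X"
proof -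
  have sub: "subspace_of (zar S G) S \<doteq> zar S G" by (rule subspace_of_zar) simp
  have "openin (topo (zar S G)) S" by (simp add: openin_zar locally_quotient_const)
  then have "variety (zar S G)"
    unfolding variety_def pts_zar using assms(2) affine_variety_cong[OF sub]
    by (intro conjI sheaf_of_functions_zar exI[of _ "{S}"]) auto
  then show ?thesis by (rule variety_cong[OF same_structure_sym[OF assms(1)]])
qed

section \<open>Diagonal matrices and the quotient group\<close>

definition diag2 :: "complex \<Rightarrow> complex \<Rightarrow> complex^2^2" where
  "diag2 a b = (\<chi> i j. if i = j then (if i = 1 then a else b) else 0)"

lemma diag2_nth [simp]:
  "diag2 a b $ i $ j = (if i = j then (if i = 1 then a else b) else 0)"
  by (simp add: diag2_def)

lemma diag2_mult [simp]: "diag2 a b ** diag2 c d = diag2 (a * c) (b * d)"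
  by (simp add: vec_eq_iff matrix_matrix_mult_def sum_2 forall_2)

lemma mat_eq_diag2: "mat c = diag2 c c"
  by (simp add: vec_eq_iff mat_def)

lemma diag2_inj [simp]: "diag2 a b = diag2 c d \<longleftrightarrow> a = c \<and> b = d"
  by (auto simp: vec_eq_iff forall_2)

lemma carrier_D2: "carrier D2 = {diag2 a b | a b. a \<noteq> 0 \<and> b \<noteq> 0}"
proof -
  have "(\<forall>i j. i \<noteq> j \<longrightarrow> A $ i $ j = 0) \<and> invertible A \<longleftrightarrow> (\<exists>a b. A = diag2 a b \<and> a \<noteq> 0 \<and> b \<noteq> 0)"
    for A :: "complex^2^2"
  proof
    assume *: "(\<forall>i j. i \<noteq> j \<longrightarrow> A $ i $ j = 0) \<and> invertible A"
    then have "A = diag2 (A $ 1 $ 1) (A $ 2 $ 2)" by (auto simp: vec_eq_iff forall_2)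
    moreover have "A $ 1 $ 1 \<noteq> 0 \<and> A $ 2 $ 2 \<noteq> 0" using * by (auto simp: invertible_det_nz det_2)
    ultimately show "\<exists>a b. A = diag2 a b \<and> a \<noteq> 0 \<and> b \<noteq> 0" by blast
  qed (auto simp: invertible_det_nz det_2)
  then show ?thesis unfolding D2_def by auto
qed

lemma matrix_inv_diag2:
  assumes "a \<noteq> 0" "b \<noteq> 0"
  shows "matrix_inv (diag2 a b) = diag2 (1 / a) (1 / b)"
proof -
  let ?A = "diag2 a b" and ?B = "diag2 (1 / a) (1 / b)"
  have AB: "?A ** ?B = mat 1" "?B ** ?A = mat 1" using assms by (simp_all add: mat_eq_diag2)
  then have "?A ** matrix_inv ?A = mat 1"
    unfolding matrix_inv_def by (metis (mono_tags, lifting) someI_ex)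
  then have "?B ** (?A ** matrix_inv ?A) = ?B" by (simp only: matrix_mul_rid)
  then show ?thesis unfolding matrix_mul_assoc AB by (simp only: matrix_mul_lid)
qed

lemma comm_group_D2: "comm_group D2"
proof (rule comm_groupI)
  show "\<exists>y\<in>carrier D2. y \<otimes>\<^bsub>D2\<^esub> x = \<one>\<^bsub>D2\<^esub>" if x: "x \<in> carrier D2" for x
  proof -
    obtain a b where ab: "x = diag2 a b" "a \<noteq> 0" "b \<noteq> 0" using x unfolding carrier_D2 by blast
    have "diag2 (1 / a) (1 / b) \<in> carrier D2" unfolding carrier_D2 using ab by auto
    moreover have "diag2 (1 / a) (1 / b) \<otimes>\<^bsub>D2\<^esub> x = \<one>\<^bsub>D2\<^esub>" using ab by (simp add: D2_def mat_eq_diag2)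
    ultimately show ?thesis by blast
  qed
qed (auto simp: carrier_D2, auto simp: D2_def mat_eq_diag2 mult.commute mult.assoc)

abbreviation DD :: "((complex^2^2) \<times> (complex^2^2)) monoid" where
  "DD \<equiv> D2 \<times>\<times> D2"

lemma comm_group_DD: "comm_group DD"
proof -
  interpret comm_group D2 by (rule comm_group_D2)
  interpret DD: group DD by (rule DirProd_group) (rule group_axioms)+
  show ?thesis
    by (rule DD.group_comm_groupI) (auto simp: DirProd_def m_comm)
qed

lemma carrier_DD: "carrier DD = {(diag2 a b, diag2 c d) | a b c d. a \<noteq> 0 \<and> b \<noteq> 0 \<and> c \<noteq> 0 \<and> d \<noteq> 0}"
  by (auto simp: DirProd_def carrier_D2)

lemma mult_D2 [simp]: "A \<otimes>\<^bsub>D2\<^esub> B = A ** B"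
  by (simp add: D2_def)

lemma mult_DD: "(A, B) \<otimes>\<^bsub>DD\<^esub> (C, D) = (A ** C, B ** D)"
  by simp

lemma scalar_pairs_diag2: "scalar_pairs = {(diag2 c c, diag2 c c) | c. c \<noteq> 0}"
  by (simp add: scalar_pairs_def mat_eq_diag2)

lemma normal_scalar_pairs: "scalar_pairs \<lhd> DD"
proof -
  interpret DD: comm_group DD by (rule comm_group_DD)
  have one: "\<one>\<^bsub>DD\<^esub> = (diag2 1 1, diag2 1 1)" by (simp add: DirProd_def D2_def mat_eq_diag2)
  have "subgroup scalar_pairs DD"
  proof (rule DD.subgroupI)
    show "scalar_pairs \<subseteq> carrier DD" unfolding scalar_pairs_diag2 carrier_DD by blast
    show "scalar_pairs \<noteq> {}" unfolding scalar_pairs_diag2 using zero_neq_one by blast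
    show "inv\<^bsub>DD\<^esub> a \<in> scalar_pairs" if a: "a \<in> scalar_pairs" for a
    proof -
      obtain c where c: "a = (diag2 c c, diag2 c c)" "c \<noteq> 0" using a unfolding scalar_pairs_diag2 by blast
      define b where "b = (diag2 (1 / c) (1 / c), diag2 (1 / c) (1 / c))"
      have b: "b \<in> scalar_pairs" unfolding scalar_pairs_diag2 b_def using c by (auto intro!: exI[of _ "1 / c"])
      have "b \<otimes>\<^bsub>DD\<^esub> a = \<one>\<^bsub>DD\<^esub>" unfolding b_def one using c by (simp add: mult_DD)
      moreover have "a \<in> carrier DD" "b \<in> carrier DD"
        using a b \<open>scalar_pairs \<subseteq> carrier DD\<close> by auto
      ultimately have "inv\<^bsub>DD\<^esub> a = b" by (intro DD.inv_equality)
      then show ?thesis using b by simp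
    qed
    show "a \<otimes>\<^bsub>DD\<^esub> b \<in> scalar_pairs" if ab: "a \<in> scalar_pairs" "b \<in> scalar_pairs" for a b
    proof -
      obtain c where c: "a = (diag2 c c, diag2 c c)" "c \<noteq> 0" using ab(1) unfolding scalar_pairs_diag2 by blast
      obtain d where d: "b = (diag2 d d, diag2 d d)" "d \<noteq> 0" using ab(2) unfolding scalar_pairs_diag2 by blast
      show ?thesis unfolding scalar_pairs_diag2 c d mult_DD using c(2) d(2)
        by (auto intro!: exI[of _ "c * d"])
    qed
  qed
  then show ?thesis by (rule DD.subgroup_imp_normal)
qed

lemma group_H: "group H"
  unfolding H_def by (rule normal.factorgroup_is_group[OF normal_scalar_pairs])

text \<open>Every class has exactly one representative whose first diagonal entry is \<open>1\<close>.\<close>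

definition torus_class :: "complex \<Rightarrow> complex \<Rightarrow> complex \<Rightarrow> ((complex^2^2) \<times> (complex^2^2)) set" where
  "torus_class u v w = scalar_pairs #>\<^bsub>DD\<^esub> (diag2 1 u, diag2 v w)"

lemma scalar_pairs_image: "scalar_pairs = (\<lambda>t. (diag2 t t, diag2 t t)) ` (- {0})"
  unfolding scalar_pairs_diag2 by auto

lemma coset_scalar_pairs:
  "scalar_pairs #>\<^bsub>DD\<^esub> (diag2 a b, diag2 c d) =
    (\<lambda>t. (diag2 (t * a) (t * b), diag2 (t * c) (t * d))) ` (- {0})"
  unfolding r_coset_def UNION_singleton_eq_range scalar_pairs_image image_image by simp

lemma coset_eq_torus_class:
  assumes "a \<noteq> 0"
  shows "scalar_pairs #>\<^bsub>DD\<^esub> (diag2 a b, diag2 c d) = torus_class (b / a) (c / a) (d / a)"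
proof -
  \<comment> \<open>Multiplication by \<open>a\<close> permutes the nonzero scalars, so the coset
    may be parametrised from its representative with first entry 1.\<close>
  have "t \<in> (\<lambda>t. t * a) ` (- {0})" if "t \<noteq> 0" for t
    using assms that by (intro image_eqI[of _ _ "t / a"]) auto
  then have "(\<lambda>t. t * a) ` (- {0}) = - {0}" using assms by auto
  then have "torus_class (b / a) (c / a) (d / a) =
      (\<lambda>t. (diag2 (t * 1) (t * (b / a)), diag2 (t * (c / a)) (t * (d / a)))) ` ((\<lambda>t. t * a) ` (- {0}))"
    unfolding torus_class_def coset_scalar_pairs by simp
  then show ?thesis unfolding coset_scalar_pairs image_image using assms by simp
qed

lemma carrier_H: "carrier H = {torus_class u v w | u v w. u \<noteq> 0 \<and> v \<noteq> 0 \<and> w \<noteq> 0}"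
proof -
  have "carrier H = (\<lambda>g. scalar_pairs #>\<^bsub>DD\<^esub> g) ` carrier DD"
    unfolding H_def FactGroup_def RCOSETS_def by auto
  also have "\<dots> = {torus_class u v w | u v w. u \<noteq> 0 \<and> v \<noteq> 0 \<and> w \<noteq> 0}"
  proof (intro equalityI subsetI)
    fix h assume "h \<in> (\<lambda>g. scalar_pairs #>\<^bsub>DD\<^esub> g) ` carrier DD"
    then obtain a b c d where abcd: "h = scalar_pairs #>\<^bsub>DD\<^esub> (diag2 a b, diag2 c d)"
      "a \<noteq> 0" "b \<noteq> 0" "c \<noteq> 0" "d \<noteq> 0" unfolding carrier_DD by blast
    then have "h = torus_class (b / a) (c / a) (d / a)" using coset_eq_torus_class by simp
    moreover have "b / a \<noteq> 0" "c / a \<noteq> 0" "d / a \<noteq> 0" using abcd by auto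
    ultimately show "h \<in> {torus_class u v w | u v w. u \<noteq> 0 \<and> v \<noteq> 0 \<and> w \<noteq> 0}" by blast
  next
    fix h assume "h \<in> {torus_class u v w | u v w. u \<noteq> 0 \<and> v \<noteq> 0 \<and> w \<noteq> 0}"
    then obtain u v w where uvw: "h = torus_class u v w" "u \<noteq> 0" "v \<noteq> 0" "w \<noteq> 0" by blast
    have "(diag2 1 u, diag2 v w) \<in> carrier DD" unfolding carrier_DD using uvw(2-4) zero_neq_one by auto
    then show "h \<in> (\<lambda>g. scalar_pairs #>\<^bsub>DD\<^esub> g) ` carrier DD" unfolding uvw(1) torus_class_def by (rule imageI)
  qed
  finally show ?thesis .
qed

lemma torus_class_inj: "torus_class u v w = torus_class u' v' w' \<longleftrightarrow> u = u' \<and> v = v' \<and> w = w'"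
proof
  assume *: "torus_class u v w = torus_class u' v' w'"
  have "(diag2 1 u, diag2 v w) \<in> torus_class u v w"
    unfolding torus_class_def coset_scalar_pairs by (auto intro!: exI[of _ 1])
  then show "u = u' \<and> v = v' \<and> w = w'"
    unfolding * unfolding torus_class_def coset_scalar_pairs by auto
qed auto

lemma torus_class_in_carrier [simp]: "torus_class u v w \<in> carrier H \<longleftrightarrow> u \<noteq> 0 \<and> v \<noteq> 0 \<and> w \<noteq> 0"
  unfolding carrier_H by (auto simp: torus_class_inj)

lemma mult_H: "torus_class u v w \<otimes>\<^bsub>H\<^esub> torus_class u' v' w' = torus_class (u * u') (v * v') (w * w')"
  if "u \<noteq> 0" "v \<noteq> 0" "w \<noteq> 0" "u' \<noteq> 0" "v' \<noteq> 0" "w' \<noteq> 0"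
proof -
  have "(diag2 1 u, diag2 v w) \<in> carrier DD" "(diag2 1 u', diag2 v' w') \<in> carrier DD"
    unfolding carrier_DD using that zero_neq_one by auto
  from normal.rcos_sum[OF normal_scalar_pairs this] show ?thesis
    unfolding torus_class_def H_def FactGroup_def by (simp add: mult_DD)
qed

lemma one_H: "\<one>\<^bsub>H\<^esub> = torus_class 1 1 1"
  unfolding H_def FactGroup_def torus_class_def coset_scalar_pairs by (simp add: scalar_pairs_image)

lemma inv_H:
  assumes "u \<noteq> 0" "v \<noteq> 0" "w \<noteq> 0"
  shows "inv\<^bsub>H\<^esub> (torus_class u v w) = torus_class (inverse u) (inverse v) (inverse w)"
proof -
  interpret group H by (rule group_H)
  show ?thesis
    by (rule inv_equality) (use assms in \<open>simp_all add: mult_H one_H\<close>)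
qed

section \<open>The torus as an affine algebraic group\<close>

text \<open>These three functions identify \<open>H\<close> with the third power of the
  multiplicative group; by \<open>torus_class_inj\<close> the description determines a unique value
  on every class.\<close>

definition torus_coord :: "3 \<Rightarrow> ((complex^2^2) \<times> (complex^2^2)) set \<Rightarrow> complex" where
  "torus_coord i h = (THE c. \<exists>u v w. h = torus_class u v w \<and> c = (if i = 1 then u else if i = 2 then v else w))"

lemma torus_coord_class [simp]:
  "torus_coord i (torus_class u v w) = (if i = 1 then u else if i = 2 then v else w)"
  unfolding torus_coord_def by (auto simp: torus_class_inj)

text \<open>On diagonal matrices every linear form is a combination of the two diagonal entries; the
  off-diagonal coordinates restrict to zero.\<close>

lemma D2_variety_zar: "D2_variety \<doteq> zar (carrier D2) {\<lambda>A::complex^2^2. A $ 1 $ 1, \<lambda>A::complex^2^2. A $ 2 $ 2}"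
proof -
  have "D2_variety \<doteq> zar (carrier D2) (linear_forms matrix_scale UNIV)"
    unfolding D2_variety_def vector_space_variety_def by (rule subspace_of_zar) simp
  also have "\<dots> \<doteq> zar (carrier D2) {\<lambda>A::complex^2^2. A $ 1 $ 1, \<lambda>A::complex^2^2. A $ 2 $ 2}"
  proof (rule zar_cong)
    fix l assume "l \<in> linear_forms matrix_scale UNIV"
    then have l: "\<And>v w. l (v + w) = l v + l w" "\<And>c v. l (matrix_scale c v) = c * l v"
      unfolding linear_forms_def by auto
    have dec: "diag2 a b = matrix_scale a (diag2 1 0) + matrix_scale b (diag2 0 1)" for a b
      by (simp add: vec_eq_iff matrix_scale_def forall_2)
    define c d where "c = l (diag2 1 0)" and "d = l (diag2 0 1)"
    have "l (diag2 a b) = c * a + d * b" for a b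
      unfolding dec[of a b] l c_def d_def by (simp add: mult.commute)
    then have "\<forall>A\<in>carrier D2. l A = c * A $ 1 $ 1 + d * A $ 2 $ 2"
      unfolding carrier_D2 by auto
    moreover have "(\<lambda>A::complex^2^2. c * A $ 1 $ 1 + d * A $ 2 $ 2) \<in>
        algebra_generated_by {\<lambda>A::complex^2^2. A $ 1 $ 1, \<lambda>A::complex^2^2. A $ 2 $ 2}"
      by (intro algebra_generated_by.add algebra_generated_by.mult algebra_generated_by.const algebra_generated_by.gen) auto
    ultimately show "\<exists>a\<in>algebra_generated_by {\<lambda>A::complex^2^2. A $ 1 $ 1, \<lambda>A::complex^2^2. A $ 2 $ 2}. \<forall>x\<in>carrier D2. l x = a x"
      by (intro bexI)
  next
    fix g :: "complex^2^2 \<Rightarrow> complex" assume "g \<in> {\<lambda>A::complex^2^2. A $ 1 $ 1, \<lambda>A::complex^2^2. A $ 2 $ 2}"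
    then have "g \<in> linear_forms matrix_scale UNIV"
      by (auto simp: linear_forms_def matrix_scale_def)
    then show "\<exists>a\<in>algebra_generated_by (linear_forms matrix_scale UNIV). \<forall>x\<in>carrier D2. g x = a x"
      by (intro bexI[of _ g] algebra_generated_by.gen) auto
  qed
  finally show ?thesis .
qed

text \<open>Normalising the first diagonal entry to 1 is a global section of the projection to
  \<open>H\<close>. It is regular because the coordinates of a class are ratios whose denominator,
  that entry, never vanishes.\<close>

lemma H_variety_zar: "H_variety \<doteq> zar (carrier H) (range torus_coord)"
proof -
  let ?Gd = "{\<lambda>A::complex^2^2. A $ 1 $ 1, \<lambda>A::complex^2^2. A $ 2 $ 2} :: (complex^2^2 \<Rightarrow> complex) set"
  let ?G = "product_generators ?Gd ?Gd" and ?S = "carrier D2 \<times> carrier D2"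
  let ?\<pi> = "\<lambda>g. scalar_pairs #>\<^bsub>DD\<^esub> g"
  define s where "s h = (diag2 1 (torus_coord 1 h), diag2 (torus_coord 2 h) (torus_coord 3 h))" for h
  have S: "?S = carrier DD" by (simp add: DirProd_def)
  have img: "?\<pi> ` ?S = carrier H"
    unfolding S H_def FactGroup_def RCOSETS_def by auto
  have "H_variety \<doteq> quotient_space (zar ?S ?G) ?\<pi>"
    unfolding H_variety_def
    by (intro quotient_space_cong)
      (simp add: product_space_cong[OF D2_variety_zar D2_variety_zar] product_space_zar)
  also have "\<dots> \<doteq> zar (?\<pi> ` ?S) ((\<lambda>g y. g (s y)) ` ?G)"
  proof (rule quotient_space_section)
    fix h assume "h \<in> ?\<pi> ` ?S"
    then obtain u v w where uvw: "h = torus_class u v w" "u \<noteq> 0" "v \<noteq> 0" "w \<noteq> 0"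
      unfolding img carrier_H by blast
    have "s h = (diag2 1 u, diag2 v w)" unfolding uvw(1) s_def by simp
    then show "s h \<in> ?S \<and> ?\<pi> (s h) = h"
      unfolding S carrier_DD uvw(1) torus_class_def using uvw(2-4) zero_neq_one by auto
  next
    fix g assume g: "g \<in> ?G"
    have c: "torus_coord i (?\<pi> p) = (if i = 1 then fst p $ 2 $ 2 else if i = 2 then snd p $ 1 $ 1 else snd p $ 2 $ 2) * inverse (fst p $ 1 $ 1)"
      if p: "p \<in> ?S" for i p
    proof -
      obtain a b c d where "p = (diag2 a b, diag2 c d)" "a \<noteq> 0" using p unfolding S carrier_DD by blast
      then show ?thesis by (simp add: coset_eq_torus_class divide_inverse)
    qed
    have gens: "locally_quotient ?S ?G ?S (\<lambda>p. fst p $ 1 $ 1)" "locally_quotient ?S ?G ?S (\<lambda>p. fst p $ 2 $ 2)"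
      "locally_quotient ?S ?G ?S (\<lambda>p. snd p $ 1 $ 1)" "locally_quotient ?S ?G ?S (\<lambda>p. snd p $ 2 $ 2)"
      by (intro locally_quotient_gen; simp add: product_generators_def)+
    have "locally_quotient ?S ?G {p \<in> ?S. fst p $ 1 $ 1 \<noteq> 0} (\<lambda>p. inverse (fst p $ 1 $ 1))"
      by (rule locally_quotient_inverse[OF gens(1) order_refl])
    moreover have "{p \<in> ?S. fst p $ 1 $ 1 \<noteq> 0} = ?S" unfolding S carrier_DD by auto
    ultimately have inv: "locally_quotient ?S ?G ?S (\<lambda>p. inverse (fst p $ 1 $ 1))" by simp
    have tc: "locally_quotient ?S ?G ?S (\<lambda>p. torus_coord i (?\<pi> p))" for i
    proof -
      have "locally_quotient ?S ?G ?S (\<lambda>p. (if i = 1 then fst p $ 2 $ 2 else if i = 2 then snd p $ 1 $ 1 else snd p $ 2 $ 2))"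
        using gens by (cases "i = 1"; cases "i = 2") simp_all
      from locally_quotient_mult[OF this inv] show ?thesis
        unfolding Int_absorb by (rule locally_quotient_cong) (use c in auto)
    qed
    from g consider "g = (\<lambda>p. fst p $ 1 $ 1)" | "g = (\<lambda>p. fst p $ 2 $ 2)" | "g = (\<lambda>p. snd p $ 1 $ 1)" | "g = (\<lambda>p. snd p $ 2 $ 2)"
      unfolding product_generators_def by auto
    then show "locally_quotient ?S ?G ?S (\<lambda>p. g (s (?\<pi> p)))"
      by cases (simp_all add: s_def tc locally_quotient_const)
  qed
  also have "\<dots> \<doteq> zar (carrier H) (range torus_coord)"
    unfolding img
  proof (rule zar_cong)
    fix g assume "g \<in> (\<lambda>g y. g (s y)) ` ?G"
    then have "g = (\<lambda>y. 1) \<or> g = torus_coord 1 \<or> g = torus_coord 2 \<or> g = torus_coord 3"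
      unfolding product_generators_def s_def by auto
    then have "g \<in> algebra_generated_by (range torus_coord)"
      by (auto intro: algebra_generated_by.const algebra_generated_by.gen)
    then show "\<exists>a\<in>algebra_generated_by (range torus_coord). \<forall>x\<in>carrier H. g x = a x"
      by (intro bexI[of _ g]) auto
  next
    fix g assume "g \<in> range torus_coord"
    then obtain i where i: "g = torus_coord i" by auto
    have mem: "torus_coord 1 \<in> (\<lambda>g y. g (s y)) ` ?G" "torus_coord 2 \<in> (\<lambda>g y. g (s y)) ` ?G"
      "torus_coord 3 \<in> (\<lambda>g y. g (s y)) ` ?G"
      unfolding product_generators_def s_def by (simp_all add: image_Un image_image fun_eq_iff image_iff)
    have "i = 1 \<or> i = 2 \<or> i = 3" by (rule exhaust_3)
    then have "g \<in> (\<lambda>g y. g (s y)) ` ?G" using mem unfolding i by (elim disjE) simp_all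
    then show "\<exists>a\<in>algebra_generated_by ((\<lambda>g y. g (s y)) ` ?G). \<forall>x\<in>carrier H. g x = a x"
      by (intro bexI[of _ g] algebra_generated_by.gen) auto
  qed
  finally show ?thesis .
qed

lemma torus_coord_nonzero: "h \<in> carrier H \<Longrightarrow> torus_coord i h \<noteq> 0"
  unfolding carrier_H by (auto split: if_splits)

lemma torus_coord_eqI:
  assumes "h \<in> carrier H" "h' \<in> carrier H" "\<And>i. torus_coord i h = torus_coord i h'"
  shows "h = h'"
proof -
  obtain u v w where "h = torus_class u v w" using assms(1) unfolding carrier_H by blast
  moreover obtain u' v' w' where "h' = torus_class u' v' w'" using assms(2) unfolding carrier_H by blast
  ultimately show ?thesis using assms(3)[of 1] assms(3)[of 2] assms(3)[of 3] by simp
qed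

lemma torus_coord_mult:
  "h \<in> carrier H \<Longrightarrow> h' \<in> carrier H \<Longrightarrow> torus_coord i (h \<otimes>\<^bsub>H\<^esub> h') = torus_coord i h * torus_coord i h'"
  unfolding carrier_H by (auto simp: mult_H)

lemma torus_coord_inv: "h \<in> carrier H \<Longrightarrow> torus_coord i (inv\<^bsub>H\<^esub> h) = inverse (torus_coord i h)"
  unfolding carrier_H by (auto simp: inv_H)

lemma affine_variety_H: "affine_variety (zar (carrier H) (range torus_coord))"
proof (rule affine_variety_zar[where P = "{}" and h = "\<lambda>z. z 1 * z 2 * z 3"])
  show "(\<exists>x\<in>carrier H. \<forall>i. torus_coord i x = z i) \<longleftrightarrow> (\<forall>p\<in>{}. p z = 0) \<and> z 1 * z 2 * z 3 \<noteq> 0" for z :: "3 \<Rightarrow> complex"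
  proof
    assume "\<exists>x\<in>carrier H. \<forall>i. torus_coord i x = z i"
    then show "(\<forall>p\<in>{}. p z = 0) \<and> z 1 * z 2 * z 3 \<noteq> 0" using torus_coord_nonzero by (metis empty_iff mult_eq_0_iff)
  next
    assume "(\<forall>p\<in>{}. p z = 0) \<and> z 1 * z 2 * z 3 \<noteq> 0"
    then have "torus_class (z 1) (z 2) (z 3) \<in> carrier H" unfolding carrier_H by auto
    moreover have "\<forall>i. torus_coord i (torus_class (z 1) (z 2) (z 3)) = z i" by (simp add: forall_3)
    ultimately show "\<exists>x\<in>carrier H. \<forall>i. torus_coord i x = z i" by blast
  qed
  show "(\<lambda>z. z 1 * z 2 * z 3) \<in> algebra_generated_by (range (\<lambda>(i::3) z. z i :: complex))"
    by (intro algebra_generated_by.mult algebra_generated_by.gen rangeI)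
  show "h = h'" if "h \<in> carrier H" "h' \<in> carrier H" "\<And>i. torus_coord i h = torus_coord i h'" for h h'
    using that by (rule torus_coord_eqI)
qed simp

lemma algebraic_group_H: "algebraic_group H H_variety"
proof -
  interpret group H by (rule group_H)
  let ?Z = "zar (carrier H) (range torus_coord)" and ?C = "product_generators (range torus_coord) (range torus_coord)"
  have gen: "locally_quotient (carrier H) (range torus_coord) (carrier H) (torus_coord i)" for i
    by (rule locally_quotient_gen) simp
  have fst: "locally_quotient (carrier H \<times> carrier H) ?C (carrier H \<times> carrier H) (\<lambda>p. torus_coord i (fst p))" for i
    by (rule locally_quotient_gen) (auto simp: product_generators_def)
  have snd: "locally_quotient (carrier H \<times> carrier H) ?C (carrier H \<times> carrier H) (\<lambda>p. torus_coord i (snd p))" for i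
    by (rule locally_quotient_gen) (auto simp: product_generators_def)
  have prod: "product_space H_variety H_variety \<doteq> zar (carrier H \<times> carrier H) ?C"
    unfolding product_space_cong[OF H_variety_zar H_variety_zar] by (rule product_space_zar)
  show ?thesis
    unfolding algebraic_group_def
  proof (intro conjI group_H)
    show "variety H_variety" by (rule variety_if_affine[OF H_variety_zar affine_variety_H])
    show "pts H_variety = carrier H" using same_structure_pts[OF H_variety_zar] by (simp add: pts_zar)
    show "morphism (product_space H_variety H_variety) H_variety (\<lambda>(g, h). g \<otimes>\<^bsub>H\<^esub> h)"
      unfolding morphism_cong[OF prod H_variety_zar]
    proof (rule morphism_zar)
      fix k assume "k \<in> range torus_coord"
      then obtain i where k: "k = torus_coord i" by auto
      show "locally_quotient (carrier H \<times> carrier H) ?C (carrier H \<times> carrier H) (\<lambda>x. k (case x of (g, h) \<Rightarrow> g \<otimes>\<^bsub>H\<^esub> h))"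
        using locally_quotient_mult[OF fst[of i] snd[of i]] unfolding Int_absorb
        by (rule locally_quotient_cong) (simp add: k torus_coord_mult case_prod_unfold mem_Times_iff)
    next
      show "(\<lambda>(g, h). g \<otimes>\<^bsub>H\<^esub> h) \<in> carrier H \<times> carrier H \<rightarrow> carrier H"
        by (intro Pi_I) (simp add: case_prod_unfold mem_Times_iff)
    qed
    show "morphism H_variety H_variety (\<lambda>g. inv\<^bsub>H\<^esub> g)"
      unfolding morphism_cong[OF H_variety_zar H_variety_zar]
    proof (rule morphism_zar)
      fix k assume "k \<in> range torus_coord"
      then obtain i where k: "k = torus_coord i" by auto
      have "{h \<in> carrier H. torus_coord i h \<noteq> 0} = carrier H" using torus_coord_nonzero by auto
      then have "locally_quotient (carrier H) (range torus_coord) (carrier H) (\<lambda>h. inverse (torus_coord i h))"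
        using locally_quotient_inverse[OF gen order_refl, of i] by simp
      then show "locally_quotient (carrier H) (range torus_coord) (carrier H) (\<lambda>x. k (inv\<^bsub>H\<^esub> x))"
        by (rule locally_quotient_cong) (simp add: k torus_coord_inv)
    qed simp
  qed
qed

section \<open>The weights of the torus on the matrix entries\<close>

text \<open>The weight on the entry at row \<open>i\<close> and column \<open>j\<close>: the
  \<open>i\<close>-th diagonal entry of the left matrix over the \<open>j\<close>-th of the right
  one, for the representative whose first entry is 1.\<close>

definition torus_character :: "((complex^2^2) \<times> (complex^2^2)) set \<Rightarrow> 2 \<Rightarrow> 2 \<Rightarrow> complex" where
  "torus_character h i j = (if i = 1 then 1 else torus_coord 1 h) * inverse (if j = 1 then torus_coord 2 h else torus_coord 3 h)"

text \<open>The common scalar \<open>t\<close> of a representative cancels between the left matrix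
  and the inverse of the right one, so the image in \<open>H_act\<close> is a singleton.\<close>

lemma H_act_eq:
  assumes "h \<in> carrier H"
  shows "H_act h M = (\<lambda>x. \<chi> i j. torus_character h i j * M x $ i $ j)"
proof -
  obtain u v w where uvw: "h = torus_class u v w" "u \<noteq> 0" "v \<noteq> 0" "w \<noteq> 0"
    using assms unfolding carrier_H by blast
  have "diag2 (t * 1) (t * u) ** A ** matrix_inv (diag2 (t * v) (t * w)) =
      (\<chi> i j. torus_character h i j * A $ i $ j)" if "t \<noteq> 0" for t A
    using that uvw(2-4) unfolding uvw(1)
    by (simp add: matrix_inv_diag2 vec_eq_iff forall_2 matrix_matrix_mult_def sum_2 torus_character_def divide_inverse)
  then have "(\<lambda>(\<Gamma>, \<Delta>). (\<lambda>x. \<Gamma> ** M x ** matrix_inv \<Delta>)) ` h =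
      {\<lambda>x. \<chi> i j. torus_character h i j * M x $ i $ j}"
    using zero_neq_one unfolding uvw(1) torus_class_def coset_scalar_pairs by (auto simp: image_iff)
  then show ?thesis unfolding H_act_def by simp
qed

lemma torus_character_mult:
  "h \<in> carrier H \<Longrightarrow> h' \<in> carrier H \<Longrightarrow>
    torus_character (h \<otimes>\<^bsub>H\<^esub> h') i j = torus_character h i j * torus_character h' i j"
  by (simp add: torus_character_def torus_coord_mult)

lemma torus_character_nonzero: "h \<in> carrier H \<Longrightarrow> torus_character h i j \<noteq> 0"
  by (simp add: torus_character_def torus_coord_nonzero)

lemma torus_character_one: "torus_character \<one>\<^bsub>H\<^esub> i j = 1"
  by (simp add: torus_character_def one_H)

lemma torus_character_rel:
  "h \<in> carrier H \<Longrightarrow> torus_character h 1 1 * torus_character h 2 2 = torus_character h 1 2 * torus_character h 2 1"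
  by (simp add: torus_character_def)

text \<open>The four weights satisfy a single relation. The first row gives the two entries of the
  right matrix, the first column gives the left one, and the relation takes care of the position (2,
  2).\<close>

lemma exists_torus_character:
  assumes "\<And>i j. c i j \<noteq> 0" "c 1 1 * c 2 2 = c 1 2 * c 2 1"
  shows "\<exists>h\<in>carrier H. \<forall>i j. torus_character h i j = c i j"
proof (intro bexI)
  let ?h = "torus_class (c 2 1 / c 1 1) (1 / c 1 1) (1 / c 1 2)"
  show "?h \<in> carrier H" using assms(1) by simp
  have "c 2 1 / c 1 1 * c 1 2 = c 2 2" using assms by (simp add: field_simps)
  then show "\<forall>i j. torus_character ?h i j = c i j" using assms(1) by (simp add: forall_2 torus_character_def)
qed

section \<open>Coordinates on the space of matrices\<close>

lemma q_equiv_sym: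
  assumes "q_equiv q a b"
  shows "q_equiv q b a"
proof -
  obtain n where "a / b = q powi n" using assms unfolding q_equiv_def by (rule exE)
  then have "inverse (a / b) = q powi (- n)" by (simp only: power_int_minus)
  then have "b / a = q powi (- n)" by (simp only: inverse_divide)
  then show ?thesis unfolding q_equiv_def by (rule exI)
qed

lemma countable_q_equiv:
  assumes "b \<noteq> 0"
  shows "countable {a. q_equiv q a b}"
proof -
  have "{a. q_equiv q a b} \<subseteq> range (\<lambda>n::int. q powi n * b)"
  proof
    fix a assume "a \<in> {a. q_equiv q a b}"
    then obtain n where n: "a / b = q powi n" unfolding q_equiv_def mem_Collect_eq by (rule exE)
    have "a = a / b * b" using assms by simp
    then have "a = q powi n * b" unfolding n .
    then show "a \<in> range (\<lambda>n::int. q powi n * b)" by (rule range_eqI)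
  qed
  then show ?thesis by (rule countable_subset) simp
qed

locale monodromy =
  fixes q :: complex and \<rho> \<sigma> :: "2 \<Rightarrow> complex" and X :: "4 \<Rightarrow> complex"
  assumes q: "q \<noteq> 0" "norm q < 1"
    and \<rho>: "\<rho> i \<noteq> 0" and \<sigma>: "\<sigma> i \<noteq> 0" and X: "X k \<noteq> 0"
    and NR: "NR q \<rho> \<sigma> X" and NS: "NS q \<rho> \<sigma> X"
begin

abbreviation "V \<equiv> Vmat q \<rho> \<sigma>"

lemma X_nequiv: "k \<noteq> l \<Longrightarrow> \<not> q_equiv q (X k) (X l)"
  using NR unfolding NR_def by blast

lemma X_inj: "X k = X l \<longleftrightarrow> k = l"
proof
  assume *: "X k = X l"
  show "k = l"
  proof (rule ccontr)
    assume "k \<noteq> l"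
    then have "\<not> q_equiv q (X k) (X l)" by (rule X_nequiv)
    moreover have "q_equiv q (X k) (X l)"
      unfolding q_equiv_def * using X[of l] by (intro exI[of _ 0]) simp
    ultimately show False by simp
  qed
qed simp

text \<open>Two prescribed zeros exhaust the exponent 2 of the functional equation, so a nonzero
  function would have \<open>\<rho> i / \<sigma> j\<close> equivalent to \<open>X k * X l\<close>;
  the two signs cancel. This is what (NS) excludes.\<close>

lemma Vij_two_zeros:
  assumes m: "m \<in> Vij q \<rho> \<sigma> i j" and kl: "k \<noteq> l" and z: "m (X k) = 0" "m (X l) = 0"
  shows "m = (\<lambda>x. 0)"
proof -
  let ?c = "\<rho> i / \<sigma> j"
  have hol: "m holomorphic_on (- {0})" and m0: "m 0 = 0"
    and per: "\<And>x. x \<noteq> 0 \<Longrightarrow> m (q * x) = ?c * x powi (-2) * m x"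
    using m unfolding Vij_def by auto
  have neq: "X k \<noteq> X l" using kl by (simp add: X_inj)
  have "(\<forall>x. x \<noteq> 0 \<longrightarrow> m x = 0) \<or>
    (q_equiv q ?c (\<Prod>a\<in>{X k, X l}. - a) \<and> (\<forall>x. x \<noteq> 0 \<longrightarrow> (\<forall>a\<in>{X k, X l}. \<not> q_equiv q x a) \<longrightarrow> m x \<noteq> 0))"
  proof (rule quasi_periodic_zeros[OF q _ _ _ hol])
    show "\<not> q_equiv q a b" if "a \<in> {X k, X l}" "b \<in> {X k, X l}" "a \<noteq> b" for a b
      using that X_nequiv[OF kl] X_nequiv[OF kl[symmetric]] by auto
    show "m (q * x) * x ^ card {X k, X l} = ?c * m x" if "x \<noteq> 0" for x
      using per[OF that] neq that by (simp add: power_int_minus power2_eq_square field_simps)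
  qed (use X z \<rho> \<sigma> in auto)
  moreover have "\<not> q_equiv q ?c (\<Prod>a\<in>{X k, X l}. - a)"
    using NS kl neq unfolding NS_def by simp
  ultimately have "m x = 0" for x using m0 by (cases "x = 0") blast+
  then show ?thesis by (rule ext)
qed

text \<open>The two sample points, indexed by the type \<open>2\<close> so that the coordinates on
  \<open>V\<close> are indexed by triples over \<open>2\<close>.\<close>

definition Y :: "2 \<Rightarrow> complex" where "Y k = X (if k = 1 then 1 else 2)"

lemma Y_neq: "k \<noteq> l \<Longrightarrow> \<exists>k' l'. Y k = X k' \<and> Y l = X l' \<and> k' \<noteq> l'"
  using exhaust_2[of k] exhaust_2[of l] unfolding Y_def
  by (intro exI[of _ "if k = 1 then 1 else 2"] exI[of _ "if l = 1 then 1 else 2"]) auto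

lemma Vij_Y_zero:
  assumes "m \<in> Vij q \<rho> \<sigma> i j" "\<And>k. m (Y k) = 0"
  shows "m = (\<lambda>x. 0)"
  using Vij_two_zeros[OF assms(1), of 1 2] assms(2)[of 1] assms(2)[of 2] by (simp add: Y_def)

lemma Vij_add: "m \<in> Vij q \<rho> \<sigma> i j \<Longrightarrow> n \<in> Vij q \<rho> \<sigma> i j \<Longrightarrow> (\<lambda>x. m x + n x) \<in> Vij q \<rho> \<sigma> i j"
  unfolding Vij_def by (auto intro!: holomorphic_intros simp: distrib_left add_divide_distrib)

lemma Vij_scale: "m \<in> Vij q \<rho> \<sigma> i j \<Longrightarrow> (\<lambda>x. c * m x) \<in> Vij q \<rho> \<sigma> i j"
  unfolding Vij_def by (auto intro!: holomorphic_intros)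

text \<open>A product of two theta functions, one of which vanishes at the other sample point. The
  second has its zeros in the class of \<open>d\<close>, and (NS) says precisely that this class
  does not contain \<open>Y k\<close>; rescaling gives the value 1 there.\<close>

lemma exists_Vij_basis: "\<exists>m\<in>Vij q \<rho> \<sigma> i j. \<forall>l. m (Y l) = (if l = k then 1 else 0)"
proof -
  let ?c = "\<rho> i / \<sigma> j"
  have c: "?c \<noteq> 0" using \<rho> \<sigma> by simp
  define k' :: 2 where "k' = (if k = 1 then 2 else 1)"
  have k': "k' \<noteq> k" "\<And>l. l = k \<or> l = k'"
    using exhaust_2[of k] exhaust_2 unfolding k'_def by auto
  obtain a b where ab: "Y k = X a" "Y k' = X b" "a \<noteq> b" using Y_neq[of k k'] k'(1) by metis
  \<comment> \<open>The product \<open>theta q (x / X b) * theta q (x / d)\<close> has multiplier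
    \<open>X b * d * x powi (-2)\<close>, which determines \<open>d\<close>.\<close>
  define d where "d = ?c / X b"
  have d: "d \<noteq> 0" using c X by (simp add: d_def)
  define m where "m x = (if x = 0 then 0 else theta q (x / X b) * theta q (x / d))" for x
  have th: "(\<lambda>x. theta q (x / e)) holomorphic_on (- {0})" if "e \<noteq> 0" for e
  proof (rule holomorphic_on_compose_punctured[OF _ holomorphic_theta[OF q]])
    show "(\<lambda>x. x / e) holomorphic_on - {0}"
      using that by (intro holomorphic_on_divide holomorphic_on_const holomorphic_on_ident) auto
  qed (use that in auto)
  have "m holomorphic_on (- {0}) \<longleftrightarrow> (\<lambda>x. theta q (x / X b) * theta q (x / d)) holomorphic_on (- {0})"
    by (rule holomorphic_cong) (auto simp: m_def)
  then have hol: "m holomorphic_on (- {0})" using th[OF X] th[OF d] by (simp add: holomorphic_on_mult)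
  have sh: "theta q (q * x / e) = - (e / x) * theta q (x / e)" if "x \<noteq> 0" "e \<noteq> 0" for x e
    using theta_shift[OF q, of "x / e"] that by simp
  have per: "m (q * x) = ?c * x powi (-2) * m x" if x: "x \<noteq> 0" for x
  proof -
    have "m (q * x) = theta q (q * x / X b) * theta q (q * x / d)" using x q by (simp add: m_def)
    also have "\<dots> = (X b * d) * x powi (-2) * m x"
      unfolding sh[OF x X] sh[OF x d] using x
      by (simp add: m_def power_int_minus power2_eq_square field_simps)
    also have "X b * d = ?c" using X by (simp add: d_def)
    finally show ?thesis .
  qed
  have m: "m \<in> Vij q \<rho> \<sigma> i j" unfolding Vij_def using hol per by (simp add: m_def)
  have "theta q 1 = 0" using theta_simple_zero[OF q, of 0] by auto
  then have m0: "m (Y k') = 0" using X by (simp add: ab(2) m_def)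
  have "theta q (X a / X b) \<noteq> 0"
    using X_nequiv[OF ab(3)] q_equiv_scale[OF X[of b]] X by (intro theta_nonzero[OF q]) auto
  moreover have "theta q (X a / d) \<noteq> 0"
  proof (rule theta_nonzero[OF q])
    show "\<not> q_equiv q (X a / d) 1"
    proof
      assume "q_equiv q (X a / d) 1"
      then have "q_equiv q (X a * X b) ?c" unfolding q_equiv_def d_def by (simp add: mult_ac)
      then have "q_equiv q ?c (X a * X b)" by (rule q_equiv_sym)
      then show False using NS ab(3) unfolding NS_def by blast
    qed
  qed (use X d in auto)
  ultimately have m1: "m (Y k) \<noteq> 0" using X by (simp add: ab(1) m_def)
  show ?thesis
  proof (rule bexI)
    show "(\<lambda>x. 1 / m (Y k) * m x) \<in> Vij q \<rho> \<sigma> i j" by (rule Vij_scale[OF m])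
    show "\<forall>l. 1 / m (Y k) * m (Y l) = (if l = k then 1 else 0)"
    proof
      fix l show "1 / m (Y k) * m (Y l) = (if l = k then 1 else 0)"
        using k'(2)[of l] m0 m1 by auto
    qed
  qed
qed

definition basis :: "2 \<Rightarrow> 2 \<Rightarrow> 2 \<Rightarrow> complex \<Rightarrow> complex" where
  "basis k i j = (SOME m. m \<in> Vij q \<rho> \<sigma> i j \<and> (\<forall>l. m (Y l) = (if l = k then 1 else 0)))"

lemma basis: "basis k i j \<in> Vij q \<rho> \<sigma> i j" "basis k i j (Y l) = (if l = k then 1 else 0)"
proof -
  have "\<exists>m. m \<in> Vij q \<rho> \<sigma> i j \<and> (\<forall>l. m (Y l) = (if l = k then 1 else 0))"
    using exists_Vij_basis by blast
  from someI_ex[OF this] show "basis k i j \<in> Vij q \<rho> \<sigma> i j" "basis k i j (Y l) = (if l = k then 1 else 0)"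
    unfolding basis_def by auto
qed

lemma Vij_basis_expansion:
  assumes "m \<in> Vij q \<rho> \<sigma> i j"
  shows "m t = m (Y 1) * basis 1 i j t + m (Y 2) * basis 2 i j t"
proof -
  let ?n = "\<lambda>t. m (Y 1) * basis 1 i j t + m (Y 2) * basis 2 i j t"
  have n: "?n \<in> Vij q \<rho> \<sigma> i j" by (intro Vij_add Vij_scale basis)
  have "(\<lambda>t. m t + (-1) * ?n t) = (\<lambda>t. 0)"
  proof (rule Vij_Y_zero)
    show "(\<lambda>t. m t + (-1) * ?n t) \<in> Vij q \<rho> \<sigma> i j" by (intro Vij_add[OF assms] Vij_scale[OF n])
    show "m (Y k) + (-1) * ?n (Y k) = 0" for k
      using exhaust_2[of k] by (auto simp: basis)
  qed
  from fun_cong[OF this, of t] show ?thesis by (simp add: algebra_simps)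
qed

definition ev :: "2 \<times> 2 \<times> 2 \<Rightarrow> (complex \<Rightarrow> complex^2^2) \<Rightarrow> complex" where
  "ev = (\<lambda>(k, i, j) M. M (Y k) $ i $ j)"

text \<open>The inverse of the coordinate map \<open>ev\<close>: the matrix with prescribed values
  at the two sample points.\<close>

definition lift :: "(2 \<times> 2 \<times> 2 \<Rightarrow> complex) \<Rightarrow> complex \<Rightarrow> complex^2^2" where
  "lift z t = (\<chi> i j. z (1, i, j) * basis 1 i j t + z (2, i, j) * basis 2 i j t)"

lemma VD: "M \<in> V \<Longrightarrow> (\<lambda>t. M t $ i $ j) \<in> Vij q \<rho> \<sigma> i j"
  unfolding Vmat_def by auto

lemma lift_in_V: "lift z \<in> V"
proof -
  have "(\<lambda>t. z (1, i, j) * basis 1 i j t + z (2, i, j) * basis 2 i j t) \<in> Vij q \<rho> \<sigma> i j" for i j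
    by (intro Vij_add Vij_scale basis)
  then show ?thesis unfolding Vmat_def lift_def by simp
qed

lemma ev_lift: "ev c (lift z) = z c"
proof -
  obtain k i j where c: "c = (k, i, j)" by (cases c)
  show ?thesis unfolding c ev_def lift_def using exhaust_2[of k] by (auto simp: basis)
qed

lemma lift_ev:
  assumes "M \<in> V"
  shows "lift (\<lambda>c. ev c M) = M"
proof
  fix t show "lift (\<lambda>c. ev c M) t = M t"
    unfolding vec_eq_iff lift_def ev_def by (simp add: Vij_basis_expansion[OF VD[OF assms], where t = t])
qed

lemma ev_eqI:
  assumes "M \<in> V" "N \<in> V" "\<And>c. ev c M = ev c N"
  shows "M = N"
proof -
  have "(\<lambda>c. ev c M) = (\<lambda>c. ev c N)" using assms(3) by (rule ext)
  then show ?thesis using lift_ev[OF assms(1)] lift_ev[OF assms(2)] by metis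
qed

lemma Vstar_iff: "M \<in> Vstar q \<rho> \<sigma> \<longleftrightarrow> M \<in> V \<and> (\<forall>i j. \<exists>k. ev (k, i, j) M \<noteq> 0)"
proof -
  have "(\<lambda>t. M t $ i $ j) \<noteq> (\<lambda>t. 0) \<longleftrightarrow> (\<exists>k. ev (k, i, j) M \<noteq> 0)" if "M \<in> V" for i j
  proof
    show "\<exists>k. ev (k, i, j) M \<noteq> 0" if "(\<lambda>t. M t $ i $ j) \<noteq> (\<lambda>t. 0)"
    proof (rule ccontr)
      assume "\<nexists>k. ev (k, i, j) M \<noteq> 0"
      then have "M (Y k) $ i $ j = 0" for k by (simp add: ev_def)
      then show False using Vij_Y_zero[OF VD[OF \<open>M \<in> V\<close>], of i j] that by auto
    qed
    show "(\<lambda>t. M t $ i $ j) \<noteq> (\<lambda>t. 0)" if "\<exists>k. ev (k, i, j) M \<noteq> 0"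
    proof
      assume "(\<lambda>t. M t $ i $ j) = (\<lambda>t. 0)"
      then have "M t $ i $ j = 0" for t by (rule fun_cong)
      then show False using that by (simp add: ev_def)
    qed
  qed
  moreover have "M \<in> Vstar q \<rho> \<sigma> \<longleftrightarrow> M \<in> V \<and> (\<forall>i j. (\<lambda>t. M t $ i $ j) \<noteq> (\<lambda>t. 0))"
    unfolding Vstar_def Vmat_def by auto
  ultimately show ?thesis by auto
qed

section \<open>The monodromy matrices in these coordinates\<close>

definition base_point :: complex where
  "base_point = (SOME p. p \<noteq> 0 \<and> (\<forall>k. \<not> q_equiv q p (X k)))"

text \<open>The excluded set consists of 0 and four classes modulo powers of \<open>q\<close>, so it
  is countable.\<close>

lemma base_point: "base_point \<noteq> 0" "\<not> q_equiv q base_point (X k)"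
proof -
  have "countable (insert 0 (\<Union>k. {a. q_equiv q a (X k)}))"
    using countable_q_equiv X by (intro countable_insert countable_UN) auto
  then have "insert 0 (\<Union>k. {a. q_equiv q a (X k)}) \<noteq> UNIV"
    using uncountable_UNIV_complex by metis
  then have "\<exists>p. p \<noteq> 0 \<and> (\<forall>k. \<not> q_equiv q p (X k))" by blast
  from someI_ex[OF this] show "base_point \<noteq> 0" "\<not> q_equiv q base_point (X k)"
    unfolding base_point_def by auto
qed

abbreviation "F \<equiv> monodromy_matrices q \<rho> \<sigma> X"

text \<open>Both terms of the determinant have the multiplier
  \<open>\<rho> 1 * \<rho> 2 / (\<sigma> 1 * \<sigma> 2)\<close> times \<open>x powi (-4)\<close>,
  whose exponent matches the four prescribed zeros. So a determinant that is not identically zero is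
  nonzero off their classes, and one polynomial inequality expresses this.\<close>

lemma F_iff: "M \<in> F \<longleftrightarrow> M \<in> V \<and> (\<forall>k. det (M (X k)) = 0) \<and> det (M base_point) \<noteq> 0"
proof -
  have "det (M base_point) \<noteq> 0" if M: "M \<in> V" and z: "\<And>k. det (M (X k)) = 0" and t: "t \<noteq> 0" "det (M t) \<noteq> 0" for t
  proof -
    let ?f = "\<lambda>t. det (M t)" and ?c = "\<rho> 1 * \<rho> 2 / (\<sigma> 1 * \<sigma> 2)" and ?A = "range X"
    have h: "(\<lambda>t. M t $ i $ j) holomorphic_on (- {0})"
      and p: "\<And>x. x \<noteq> 0 \<Longrightarrow> M (q * x) $ i $ j = (\<rho> i / \<sigma> j) * x powi (-2) * M x $ i $ j" for i j
      using VD[OF M, of i j] unfolding Vij_def by auto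
    have card: "card ?A = 4" using card_image[of X UNIV] by (simp add: inj_on_def X_inj)
    have "(\<forall>x. x \<noteq> 0 \<longrightarrow> ?f x = 0) \<or>
      (q_equiv q ?c (\<Prod>a\<in>?A. - a) \<and> (\<forall>x. x \<noteq> 0 \<longrightarrow> (\<forall>a\<in>?A. \<not> q_equiv q x a) \<longrightarrow> ?f x \<noteq> 0))"
    proof (rule quasi_periodic_zeros[OF q])
      show "?f holomorphic_on - {0}" unfolding det_2 by (intro holomorphic_intros h)
      show "\<not> q_equiv q a b" if "a \<in> ?A" "b \<in> ?A" "a \<noteq> b" for a b
        using that X_nequiv by (auto simp: X_inj)
      show "?f (q * x) * x ^ card ?A = ?c * ?f x" if "x \<noteq> 0" for x
      proof -
        define r where "r = x powi (-2)"
        have r: "r * r * x ^ 4 = 1" using that by (simp add: r_def power_int_minus field_simps power2_eq_square power4_eq_xxxx)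
        have "?f (q * x) = ?c * (r * r) * ?f x"
          unfolding det_2 p[OF that] r_def[symmetric] by (simp add: algebra_simps)
        then have "?f (q * x) * x ^ 4 = ?c * ?f x * (r * r * x ^ 4)" by (simp only: mult_ac)
        then show ?thesis unfolding card r by simp
      qed
    qed (use X \<rho> \<sigma> z in auto)
    then show ?thesis using t base_point by auto
  qed
  then show ?thesis
    unfolding monodromy_matrices_def mem_Collect_eq using base_point(1) by auto
qed

text \<open>If an entry vanished identically, the determinant would be, up to sign, a product of two
  entries. Neither factor is zero, so each vanishes at no more than one of the points
  \<open>X k\<close>, which is too few.\<close>

lemma F_subset_Vstar: "F \<subseteq> Vstar q \<rho> \<sigma>"
proof
  fix M assume MF: "M \<in> F"
  then have M: "M \<in> V" and z: "\<And>k. det (M (X k)) = 0" and nz: "det (M base_point) \<noteq> 0" unfolding F_iff by auto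
  have no: False
    if gh: "g \<in> Vij q \<rho> \<sigma> i j" "h \<in> Vij q \<rho> \<sigma> i' j'" and dt: "\<And>t. det (M t) = 0 \<longleftrightarrow> g t = 0 \<or> h t = 0"
    for g h i j i' j'
  proof -
    have gne: "g \<noteq> (\<lambda>t. 0)" and hne: "h \<noteq> (\<lambda>t. 0)" using dt[of base_point] nz by auto
    have g2: "\<not> (g (X k) = 0 \<and> g (X l) = 0)" if "k \<noteq> l" for k l
      using Vij_two_zeros[OF gh(1) that] gne by blast
    have h2: "\<not> (h (X k) = 0 \<and> h (X l) = 0)" if "k \<noteq> l" for k l
      using Vij_two_zeros[OF gh(2) that] hne by blast
    have "g (X k) = 0 \<or> h (X k) = 0" for k using dt z by blast
    from this[of 1] this[of 2] this[of 3] show False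
      using g2[of 1 2] g2[of 1 3] g2[of 2 3] h2[of 1 2] h2[of 1 3] h2[of 2 3] by auto
  qed
  have "(\<lambda>t. M t $ i $ j) \<noteq> (\<lambda>t. 0)" for i j
  proof
    assume "(\<lambda>t. M t $ i $ j) = (\<lambda>t. 0)"
    then have 0: "M t $ i $ j = 0" for t by (rule fun_cong)
    consider "i = j" | "i \<noteq> j" by blast
    then show False
    proof cases
      case 1
      have pr: "M t $ 1 $ 1 * M t $ 2 $ 2 = 0" for t
        using 0[of t] 1 exhaust_2[of j] by auto
      have "det (M t) = - (M t $ 1 $ 2 * M t $ 2 $ 1)" for t by (simp only: det_2 pr diff_0)
      then have "det (M t) = 0 \<longleftrightarrow> M t $ 1 $ 2 = 0 \<or> M t $ 2 $ 1 = 0" for t by simp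
      then show False by (rule no[OF VD[OF M] VD[OF M]])
    next
      case 2
      have pr: "M t $ 1 $ 2 * M t $ 2 $ 1 = 0" for t
        using 0[of t] 2 exhaust_2[of i] exhaust_2[of j] by auto
      have "det (M t) = M t $ 1 $ 1 * M t $ 2 $ 2" for t by (simp only: det_2 pr diff_zero)
      then have "det (M t) = 0 \<longleftrightarrow> M t $ 1 $ 1 = 0 \<or> M t $ 2 $ 2 = 0" for t by simp
      then show False by (rule no[OF VD[OF M] VD[OF M]])
    qed
  qed
  then show "M \<in> Vstar q \<rho> \<sigma>" unfolding Vstar_def using VD[OF M] by blast
qed

end

section \<open>The action of the torus\<close>

lemma algebra_sum:
  assumes "finite I" "\<And>i. i \<in> I \<Longrightarrow> f i \<in> algebra_generated_by G"
  shows "(\<lambda>x. \<Sum>i\<in>I. f i x) \<in> algebra_generated_by G"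
  using assms
proof (induction I rule: finite_induct)
  case empty
  then show ?case using algebra_generated_by.const[of 0] by simp
next
  case (insert i I)
  then have "(\<lambda>x. f i x + (\<Sum>i\<in>I. f i x)) \<in> algebra_generated_by G"
    by (intro algebra_generated_by.add) simp_all
  then show ?case using insert.hyps by simp
qed

lemma group_action_restrict:
  assumes "group G" and closed: "\<And>g x. g \<in> carrier G \<Longrightarrow> x \<in> S \<Longrightarrow> \<alpha> g x \<in> S"
    and mult: "\<And>g h x. g \<in> carrier G \<Longrightarrow> h \<in> carrier G \<Longrightarrow> x \<in> S \<Longrightarrow> \<alpha> (g \<otimes>\<^bsub>G\<^esub> h) x = \<alpha> g (\<alpha> h x)"
    and one: "\<And>x. x \<in> S \<Longrightarrow> \<alpha> \<one>\<^bsub>G\<^esub> x = x"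
  shows "group_action G S (\<lambda>g. restrict (\<alpha> g) S)"
proof -
  interpret G: group G by fact
  have inv: "\<alpha> (inv\<^bsub>G\<^esub> g) (\<alpha> g x) = x" "\<alpha> g (\<alpha> (inv\<^bsub>G\<^esub> g) x) = x" if "g \<in> carrier G" "x \<in> S" for g x
    using mult[of "inv\<^bsub>G\<^esub> g" g x] mult[of g "inv\<^bsub>G\<^esub> g" x] one[OF that(2)] that by simp_all
  have bij: "restrict (\<alpha> g) S \<in> Bij S" if g: "g \<in> carrier G" for g
  proof -
    have "bij_betw (\<alpha> g) S S"
    proof (rule bij_betw_byWitness[where f' = "\<alpha> (inv\<^bsub>G\<^esub> g)"])
      show "\<alpha> g ` S \<subseteq> S" "\<alpha> (inv\<^bsub>G\<^esub> g) ` S \<subseteq> S" using closed g by auto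
    qed (use inv g in auto)
    then have "bij_betw (restrict (\<alpha> g) S) S S" by (simp cong: bij_betw_cong)
    then show ?thesis unfolding Bij_def by simp
  qed
  have "(\<lambda>g. restrict (\<alpha> g) S) \<in> hom G (BijGroup S)"
  proof (rule homI)
    show "restrict (\<alpha> g) S \<in> carrier (BijGroup S)" if "g \<in> carrier G" for g
      using bij[OF that] by (simp add: BijGroup_def)
    show "restrict (\<alpha> (g \<otimes>\<^bsub>G\<^esub> h)) S = restrict (\<alpha> g) S \<otimes>\<^bsub>BijGroup S\<^esub> restrict (\<alpha> h) S"
      if gh: "g \<in> carrier G" "h \<in> carrier G" for g h
    proof -
      have "restrict (\<alpha> (g \<otimes>\<^bsub>G\<^esub> h)) S = compose S (restrict (\<alpha> g) S) (restrict (\<alpha> h) S)"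
        using mult[OF gh] closed[OF gh(2)] by (auto simp: compose_def restrict_def fun_eq_iff)
      then show ?thesis using bij[OF gh(1)] bij[OF gh(2)] by (simp add: BijGroup_def)
    qed
  qed
  then show ?thesis
    unfolding group_action_def group_hom_def group_hom_axioms_def
    using \<open>group G\<close> group_BijGroup by blast
qed

text \<open>The explicit formula \<open>H_act_eq\<close> provides the action laws for every
  matrix-valued function, so orbits are equivalence classes.\<close>

lemma orbit_H_eq_iff: "orbit H H_act M = orbit H H_act N \<longleftrightarrow> (\<exists>h\<in>carrier H. N = H_act h M)"
proof -
  interpret group H by (rule group_H)
  have mult: "H_act (g \<otimes>\<^bsub>H\<^esub> h) M = H_act g (H_act h M)" if "g \<in> carrier H" "h \<in> carrier H" for g h M
    using that by (simp add: H_act_eq torus_character_mult mult.assoc)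
  have one: "H_act \<one>\<^bsub>H\<^esub> M = M" for M
    by (simp add: H_act_eq torus_character_one)
  show ?thesis
  proof
    assume *: "orbit H H_act M = orbit H H_act N"
    have "N \<in> orbit H H_act N" unfolding orbit_def mem_Collect_eq
      by (intro exI[of _ "\<one>\<^bsub>H\<^esub>"]) (simp add: one)
    then show "\<exists>h\<in>carrier H. N = H_act h M" unfolding *[symmetric] unfolding orbit_def by auto
  next
    assume "\<exists>h\<in>carrier H. N = H_act h M"
    then obtain h where h: "h \<in> carrier H" "N = H_act h M" by blast
    show "orbit H H_act M = orbit H H_act N"
    proof (intro equalityI subsetI)
      fix P assume "P \<in> orbit H H_act M"
      then obtain g where g: "g \<in> carrier H" "P = H_act g M" unfolding orbit_def by auto
      have "M = H_act (inv\<^bsub>H\<^esub> h) N" unfolding h(2) using h(1) by (simp add: mult[symmetric] one)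
      then have "P = H_act (g \<otimes>\<^bsub>H\<^esub> inv\<^bsub>H\<^esub> h) N" using g h(1) by (simp add: mult)
      then show "P \<in> orbit H H_act N" unfolding orbit_def mem_Collect_eq
        using g h(1) by (intro exI[of _ "g \<otimes>\<^bsub>H\<^esub> inv\<^bsub>H\<^esub> h"]) simp
    next
      fix P assume "P \<in> orbit H H_act N"
      then obtain g where g: "g \<in> carrier H" "P = H_act g N" unfolding orbit_def by auto
      then have "P = H_act (g \<otimes>\<^bsub>H\<^esub> h) M" using h by (simp add: mult)
      then show "P \<in> orbit H H_act M" unfolding orbit_def mem_Collect_eq
        using g h(1) by (intro exI[of _ "g \<otimes>\<^bsub>H\<^esub> h"]) simp
    qed
  qed
qed

lemma locally_quotient_torus_character:
  "locally_quotient (carrier H) (range torus_coord) (carrier H) (\<lambda>h. torus_character h i j)"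
proof -
  have gen: "locally_quotient (carrier H) (range torus_coord) (carrier H) (torus_coord i)" for i
    by (rule locally_quotient_gen) simp
  have "{h \<in> carrier H. torus_coord i h \<noteq> 0} = carrier H" for i using torus_coord_nonzero by blast
  then have inv: "locally_quotient (carrier H) (range torus_coord) (carrier H) (\<lambda>h. inverse (torus_coord i h))" for i
    using locally_quotient_inverse[OF gen order_refl, of i] by simp
  have 1: "locally_quotient (carrier H) (range torus_coord) (carrier H) (\<lambda>h. if i = 1 then 1 else torus_coord 1 h)"
    using gen locally_quotient_const by (cases "i = 1") simp_all
  have 2: "locally_quotient (carrier H) (range torus_coord) (carrier H) (\<lambda>h. inverse (if j = 1 then torus_coord 2 h else torus_coord 3 h))"
    using inv by (cases "j = 1") simp_all
  show ?thesis
    using locally_quotient_mult[OF 1 2] unfolding torus_character_def Int_absorb .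
qed

context monodromy
begin

section \<open>The action in coordinates\<close>

lemma lift_add: "lift z + lift w = lift (\<lambda>c. z c + w c)"
  by (simp add: fun_eq_iff vec_eq_iff lift_def algebra_simps)

lemma lift_scale: "(\<lambda>t. matrix_scale a (lift z t)) = lift (\<lambda>c. a * z c)"
  by (simp add: fun_eq_iff vec_eq_iff lift_def matrix_scale_def algebra_simps)

lemma linear_form_expansion:
  assumes "l \<in> linear_forms (\<lambda>a M t. matrix_scale a (M t)) V"
  shows "l (lift z) = (\<Sum>c\<in>UNIV. l (lift (\<lambda>d. if d = c then 1 else 0)) * z c)"
proof -
  have add: "l (lift (\<lambda>c. z c + w c)) = l (lift z) + l (lift w)"
    and scale: "l (lift (\<lambda>c. a * z c)) = a * l (lift z)" for z w a
    unfolding lift_add[symmetric] lift_scale[symmetric]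
    using assms lift_in_V unfolding linear_forms_def by auto
  \<comment> \<open>Induction over finite sets of coordinates, with \<open>z\<close> truncated to
    \<open>A\<close>; the claim is the case of all eight.\<close>
  have "l (lift (\<lambda>d. if d \<in> A then z d else 0)) = (\<Sum>c\<in>A. l (lift (\<lambda>d. if d = c then 1 else 0)) * z c)"
    if "finite A" for A
    using that
  proof (induction A rule: finite_induct)
    case empty
    show ?case using scale[of 0 "\<lambda>_. 0"] by simp
  next
    case (insert c A)
    have eq: "(\<lambda>d. if d \<in> insert c A then z d else 0) =
        (\<lambda>d. z c * (if d = c then 1 else 0) + (if d \<in> A then z d else 0))"
      using insert.hyps by auto
    have "l (lift (\<lambda>d. if d \<in> insert c A then z d else 0)) =
        z c * l (lift (\<lambda>d. if d = c then 1 else 0)) + l (lift (\<lambda>d. if d \<in> A then z d else 0))"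
      unfolding eq add scale ..
    then show ?case using insert by (simp add: mult.commute)
  qed
  from this[of UNIV] show ?thesis by simp
qed

text \<open>Every linear form on \<open>V\<close> is a combination of the eight evaluations, which
  are linear forms themselves, so both families generate the same functions on
  \<open>V\<close>.\<close>

lemma Vmat_variety_zar: "Vmat_variety q \<rho> \<sigma> \<doteq> zar V (range ev)"
  unfolding Vmat_variety_def vector_space_variety_def
proof (rule zar_cong)
  fix l assume l: "l \<in> linear_forms (\<lambda>c M x. matrix_scale c (M x)) V"
  define e where "e c = l (lift (\<lambda>d. if d = c then 1 else 0))" for c
  have "l M = (\<Sum>c\<in>UNIV. e c * ev c M)" if "M \<in> V" for M
    using linear_form_expansion[OF l, of "\<lambda>c. ev c M"] unfolding lift_ev[OF that] e_def .
  moreover have "(\<lambda>M. \<Sum>c\<in>UNIV. e c * ev c M) \<in> algebra_generated_by (range ev)"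
    by (intro algebra_sum algebra_generated_by.mult algebra_generated_by.const algebra_generated_by.gen) auto
  ultimately show "\<exists>a\<in>algebra_generated_by (range ev). \<forall>M\<in>V. l M = a M" by (intro bexI) auto
next
  fix g assume "g \<in> range ev"
  then obtain c where g: "g = ev c" by auto
  have "g \<in> linear_forms (\<lambda>c M x. matrix_scale c (M x)) V"
    unfolding g linear_forms_def ev_def by (auto simp: matrix_scale_def split: prod.splits)
  then show "\<exists>a\<in>algebra_generated_by (linear_forms (\<lambda>c M x. matrix_scale c (M x)) V). \<forall>M\<in>V. g M = a M"
    by (intro bexI[of _ g] algebra_generated_by.gen) auto
qed

lemma subspace_of_Vmat_variety:
  assumes "S \<subseteq> V"
  shows "subspace_of (Vmat_variety q \<rho> \<sigma>) S \<doteq> zar S (range ev)"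
  unfolding subspace_of_cong[OF Vmat_variety_zar] by (rule subspace_of_zar[OF assms])

lemma F_subset_V: "F \<subseteq> V" using F_iff by blast

lemma Vstar_subset_V: "Vstar q \<rho> \<sigma> \<subseteq> V" using Vstar_iff by blast

lemma ev_H_act: "h \<in> carrier H \<Longrightarrow> ev (k, i, j) (H_act h M) = torus_character h i j * ev (k, i, j) M"
  by (simp add: ev_def H_act_eq)

lemma H_act_in_V:
  assumes "h \<in> carrier H" "M \<in> V"
  shows "H_act h M \<in> V"
proof -
  have "(\<lambda>t. torus_character h i j * M t $ i $ j) \<in> Vij q \<rho> \<sigma> i j" for i j
    by (intro Vij_scale VD assms)
  then show ?thesis unfolding Vmat_def H_act_eq[OF assms(1)] by simp
qed

lemma H_act_in_Vstar:
  assumes "h \<in> carrier H" "M \<in> Vstar q \<rho> \<sigma>"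
  shows "H_act h M \<in> Vstar q \<rho> \<sigma>"
  using assms H_act_in_V torus_character_nonzero unfolding Vstar_iff by (simp add: ev_H_act)

text \<open>By \<open>torus_character_rel\<close> both terms of the determinant have the same
  weight. This makes \<open>F\<close> stable and qualifies the determinant as a common denominator
  of invariants.\<close>

lemma det_H_act:
  "h \<in> carrier H \<Longrightarrow> det (H_act h M t) = torus_character h 1 1 * torus_character h 2 2 * det (M t)"
  using torus_character_rel[of h] by (simp add: H_act_eq det_2 algebra_simps)

lemma H_act_in_F: "h \<in> carrier H \<Longrightarrow> M \<in> F \<Longrightarrow> H_act h M \<in> F"
  unfolding F_iff by (simp add: H_act_in_V det_H_act torus_character_nonzero)

definition entry_poly :: "complex \<Rightarrow> 2 \<Rightarrow> 2 \<Rightarrow> (2 \<times> 2 \<times> 2 \<Rightarrow> complex) \<Rightarrow> complex" where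
  "entry_poly t i j z = basis 1 i j t * z (1, i, j) + basis 2 i j t * z (2, i, j)"

text \<open>Subtraction is written with the factor -1, to match the operations of
  \<open>algebra_generated_by\<close>.\<close>

definition det_poly :: "complex \<Rightarrow> (2 \<times> 2 \<times> 2 \<Rightarrow> complex) \<Rightarrow> complex" where
  "det_poly t z = entry_poly t 1 1 z * entry_poly t 2 2 z + (- 1) * (entry_poly t 1 2 z * entry_poly t 2 1 z)"

lemma det_poly_algebra: "det_poly t \<in> algebra_generated_by (range (\<lambda>c z. z c))"
proof -
  have "entry_poly t i j \<in> algebra_generated_by (range (\<lambda>c z. z c))" for i j
    unfolding entry_poly_def
    by (intro algebra_generated_by.add algebra_generated_by.mult algebra_generated_by.const algebra_generated_by.gen rangeI)
  then show ?thesis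
    unfolding det_poly_def
    by (intro algebra_generated_by.add algebra_generated_by.mult algebra_generated_by.const)
qed

lemma det_lift: "det (lift z t) = det_poly t z"
  by (simp add: det_2 lift_def det_poly_def entry_poly_def mult.commute)

lemma det_eq_det_poly: "M \<in> V \<Longrightarrow> det (M t) = det_poly t (\<lambda>c. ev c M)"
  using det_lift[of "\<lambda>c. ev c M" t] by (simp add: lift_ev)

lemma lift_in_F_iff: "lift z \<in> F \<longleftrightarrow> (\<forall>k. det_poly (X k) z = 0) \<and> det_poly base_point z \<noteq> 0"
  unfolding F_iff det_lift using lift_in_V by simp

text \<open>The extra factor \<open>h\<close> serves two cases: the constant 1 gives
  \<open>F\<close> itself, and the product of the selected coordinates gives the charts.\<close>

lemma affine_variety_localised_F:
  assumes "h \<in> algebra_generated_by (range (\<lambda>c z. z c))"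
  shows "affine_variety (zar {M \<in> F. h (\<lambda>c. ev c M) \<noteq> 0} (range ev))"
proof (rule affine_variety_zar[where P = "range (\<lambda>k. det_poly (X k))" and h = "\<lambda>z. det_poly base_point z * h z"])
  fix z :: "2 \<times> 2 \<times> 2 \<Rightarrow> complex"
  show "(\<exists>M\<in>{M \<in> F. h (\<lambda>c. ev c M) \<noteq> 0}. \<forall>c. ev c M = z c) \<longleftrightarrow>
      (\<forall>p\<in>range (\<lambda>k. det_poly (X k)). p z = 0) \<and> det_poly base_point z * h z \<noteq> 0"
  proof
    assume "\<exists>M\<in>{M \<in> F. h (\<lambda>c. ev c M) \<noteq> 0}. \<forall>c. ev c M = z c"
    then obtain M where M: "M \<in> F" "h (\<lambda>c. ev c M) \<noteq> 0" "\<forall>c. ev c M = z c" by blast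
    have z: "(\<lambda>c. ev c M) = z" using M(3) by auto
    have "M = lift z" using lift_ev[of M] F_subset_V M(1) unfolding z by auto
    then show "(\<forall>p\<in>range (\<lambda>k. det_poly (X k)). p z = 0) \<and> det_poly base_point z * h z \<noteq> 0"
      using M(1,2) lift_in_F_iff[of z] unfolding z by simp
  next
    assume *: "(\<forall>p\<in>range (\<lambda>k. det_poly (X k)). p z = 0) \<and> det_poly base_point z * h z \<noteq> 0"
    then have "lift z \<in> F" unfolding lift_in_F_iff by simp
    then show "\<exists>M\<in>{M \<in> F. h (\<lambda>c. ev c M) \<noteq> 0}. \<forall>c. ev c M = z c"
      using * by (intro bexI[of _ "lift z"]) (simp_all add: ev_lift)
  qed
next
  show "M = N" if "M \<in> {M \<in> F. h (\<lambda>c. ev c M) \<noteq> 0}" "N \<in> {M \<in> F. h (\<lambda>c. ev c M) \<noteq> 0}"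
    "\<And>c. ev c M = ev c N" for M N
    using that F_subset_V by (intro ev_eqI) auto
  show "p \<in> algebra_generated_by (range (\<lambda>c z. z c))" if "p \<in> range (\<lambda>k. det_poly (X k))" for p
    using that det_poly_algebra by auto
  show "(\<lambda>z. det_poly base_point z * h z) \<in> algebra_generated_by (range (\<lambda>c z. z c))"
    by (intro algebra_generated_by.mult det_poly_algebra assms)
qed

lemma F_variety_zar: "F_variety q \<rho> \<sigma> X \<doteq> zar F (range ev)"
  unfolding F_variety_def by (rule subspace_of_Vmat_variety[OF F_subset_V])

text \<open>Each coordinate of \<open>H_act g M\<close> is a character of \<open>g\<close> times a
  coordinate of \<open>M\<close>; both factors are regular on the product.\<close>

lemma algebraic_action_F: "algebraic_action H H_variety H_act (F_variety q \<rho> \<sigma> X)"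
  unfolding algebraic_action_def
proof (intro conjI algebraic_group_H)
  have "affine_variety (zar F (range ev))"
    using affine_variety_localised_F[OF algebra_generated_by.const[of 1]] by simp
  then show "variety (F_variety q \<rho> \<sigma> X)" by (rule variety_if_affine[OF F_variety_zar])
  have pts: "pts (F_variety q \<rho> \<sigma> X) = F" using same_structure_pts[OF F_variety_zar] by (simp add: pts_zar)
  show "group_action H (pts (F_variety q \<rho> \<sigma> X)) (\<lambda>g. restrict (H_act g) (pts (F_variety q \<rho> \<sigma> X)))"
    unfolding pts
  proof (rule group_action_restrict[OF group_H])
    interpret group H by (rule group_H)
    show "H_act (g \<otimes>\<^bsub>H\<^esub> h) M = H_act g (H_act h M)" if "g \<in> carrier H" "h \<in> carrier H" "M \<in> F" for g h M
      using that by (simp add: H_act_eq torus_character_mult mult.assoc)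
    show "H_act \<one>\<^bsub>H\<^esub> M = M" for M by (simp add: H_act_eq torus_character_one)
  qed (rule H_act_in_F)
  let ?C = "product_generators (range torus_coord) (range ev)" and ?P = "carrier H \<times> F"
  have prod: "product_space H_variety (F_variety q \<rho> \<sigma> X) \<doteq> zar ?P ?C"
    unfolding product_space_cong[OF H_variety_zar F_variety_zar] by (rule product_space_zar)
  show "morphism (product_space H_variety (F_variety q \<rho> \<sigma> X)) (F_variety q \<rho> \<sigma> X) (\<lambda>(g, x). H_act g x)"
    unfolding morphism_cong[OF prod F_variety_zar]
  proof (rule morphism_zar)
    show "(\<lambda>(g, x). H_act g x) \<in> ?P \<rightarrow> F"
      by (intro Pi_I) (simp add: case_prod_unfold mem_Times_iff H_act_in_F)
    fix e assume "e \<in> range ev"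
    then obtain k i j where e: "e = ev (k, i, j)" by (metis prod_cases3 rangeE)
    have P: "openin (topo (zar ?P ?C)) ?P" by (simp add: openin_zar locally_quotient_const)
    have "locally_quotient ?P ?C {p \<in> ?P. fst p \<in> carrier H} (\<lambda>p. torus_character (fst p) i j)"
      by (rule locally_quotient_comp[OF _ P _ locally_quotient_torus_character])
        (auto simp: product_generators_def intro: locally_quotient_gen)
    moreover have "{p \<in> ?P. fst p \<in> carrier H} = ?P" by auto
    ultimately have 1: "locally_quotient ?P ?C ?P (\<lambda>p. torus_character (fst p) i j)" by simp
    have 2: "locally_quotient ?P ?C ?P (\<lambda>p. ev (k, i, j) (snd p))"
      by (rule locally_quotient_gen) (auto simp: product_generators_def)
    show "locally_quotient ?P ?C ?P (\<lambda>x. e (case x of (g, x) \<Rightarrow> H_act g x))"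
      using locally_quotient_mult[OF 1 2] unfolding Int_absorb
      by (rule locally_quotient_cong) (simp add: e ev_H_act case_prod_unfold mem_Times_iff)
  qed
qed

end

section \<open>The orbit space\<close>

text \<open>A nonzero matrix of rank one determines its two factors up to scalars. These are read
  off at the indices \<open>k0\<close> and \<open>l0\<close>, and the entry there fixes their
  product.\<close>

lemma proportional_if_outer_products_eq:
  fixes a b a' b' :: "'i \<Rightarrow> complex"
  assumes eq: "\<And>k l. a k * b l / d = a' k * b' l / d'" and d: "d \<noteq> 0" "d' \<noteq> 0"
    and nz: "a k0 \<noteq> 0" "b l0 \<noteq> 0"
  shows "\<exists>\<alpha> \<beta>. \<alpha> \<noteq> 0 \<and> \<beta> \<noteq> 0 \<and> \<alpha> * \<beta> = d' / d \<and> (\<forall>k. a' k = \<alpha> * a k) \<and> (\<forall>l. b' l = \<beta> * b l)"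
proof -
  have eq': "a' k * b' l = d' / d * (a k * b l)" for k l
    using eq[of k l] d by (simp add: field_simps)
  have nz': "a' k0 * b' l0 \<noteq> 0" unfolding eq' using d nz by simp
  define \<alpha> \<beta> where "\<alpha> = a' k0 / a k0" and "\<beta> = b' l0 / b l0"
  have ab: "\<alpha> * \<beta> = d' / d" using eq'[of k0 l0] nz by (simp add: \<alpha>_def \<beta>_def field_simps)
  have \<alpha>0: "\<alpha> \<noteq> 0" "\<beta> \<noteq> 0" using nz nz' by (auto simp: \<alpha>_def \<beta>_def)
  have "a' k = \<alpha> * a k" for k
  proof -
    have "a' k * (\<beta> * b l0) = \<alpha> * \<beta> * (a k * b l0)"
      using eq'[of k l0] nz unfolding ab by (simp add: \<beta>_def)
    then have "(a' k - \<alpha> * a k) * (\<beta> * b l0) = 0" by (simp add: algebra_simps)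
    then show ?thesis using \<alpha>0 nz by simp
  qed
  moreover have "b' l = \<beta> * b l" for l
  proof -
    have "(\<alpha> * a k0) * b' l = \<alpha> * \<beta> * (a k0 * b l)"
      using eq'[of k0 l] nz unfolding ab by (simp add: \<alpha>_def)
    then have "(b' l - \<beta> * b l) * (\<alpha> * a k0) = 0" by (simp add: algebra_simps)
    then show ?thesis using \<alpha>0 nz by simp
  qed
  ultimately show ?thesis using ab \<alpha>0 by blast
qed

section \<open>Charts and normal forms\<close>

context monodromy
begin

text \<open>
  A chart \<open>L\<close> selects for each entry one of the two sample points at which that entry must not
  vanish; on it the orbits have unique representatives whose selected values are \<open>1\<close> in all
  positions but the last.
\<close>

definition pivot :: "(2 \<Rightarrow> 2 \<Rightarrow> 2) \<Rightarrow> 2 \<Rightarrow> 2 \<Rightarrow> (complex \<Rightarrow> complex^2^2) \<Rightarrow> complex" where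
  "pivot L i j M = ev (L i j, i, j) M"

definition chart :: "(complex \<Rightarrow> complex^2^2) set \<Rightarrow> (2 \<Rightarrow> 2 \<Rightarrow> 2) \<Rightarrow> (complex \<Rightarrow> complex^2^2) set" where
  "chart S L = {M \<in> S. \<forall>i j. pivot L i j M \<noteq> 0}"

text \<open>Three scalars turn the selected values into 1; the scalar at (2, 2) is then forced by
  the relation in \<open>exists_torus_character\<close>.\<close>

definition scaling :: "(2 \<Rightarrow> 2 \<Rightarrow> 2) \<Rightarrow> (complex \<Rightarrow> complex^2^2) \<Rightarrow> 2 \<Rightarrow> 2 \<Rightarrow> complex" where
  "scaling L M i j =
     (if i = 2 \<and> j = 2 then pivot L 1 1 M * (inverse (pivot L 1 2 M) * inverse (pivot L 2 1 M))
      else inverse (pivot L i j M))"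

definition normal_form :: "(2 \<Rightarrow> 2 \<Rightarrow> 2) \<Rightarrow> (complex \<Rightarrow> complex^2^2) \<Rightarrow> complex \<Rightarrow> complex^2^2" where
  "normal_form L M t = (\<chi> i j. scaling L M i j * M t $ i $ j)"

lemma ev_normal_form: "ev (k, i, j) (normal_form L M) = scaling L M i j * ev (k, i, j) M"
  by (simp add: ev_def normal_form_def)

lemma pivot_H_act: "h \<in> carrier H \<Longrightarrow> pivot L i j (H_act h M) = torus_character h i j * pivot L i j M"
  by (simp add: pivot_def ev_H_act)

text \<open>The scalar at each position has the weight inverse to that of the entry, at (2, 2)
  because of the relation among the characters. Where a pivot vanishes, the convention that the
  inverse of 0 is 0 keeps the identity true.\<close>

lemma normal_form_H_act:
  assumes h: "h \<in> carrier H"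
  shows "normal_form L (H_act h M) = normal_form L M"
proof -
  have nz: "torus_character h i j \<noteq> 0" for i j by (rule torus_character_nonzero[OF h])
  have "scaling L (H_act h M) i j * torus_character h i j = scaling L M i j" for i j
  proof (cases "i = 2 \<and> j = 2")
    case False
    then have "scaling L N i j = inverse (pivot L i j N)" for N unfolding scaling_def by (rule if_not_P)
    then show ?thesis using nz[of i j] by (simp add: pivot_H_act[OF h])
  next
    case True
    have "torus_character h 1 1 * (inverse (torus_character h 1 2) * inverse (torus_character h 2 1)) *
        torus_character h 2 2 = 1"
      using torus_character_rel[OF h] nz by (simp add: field_simps)
    then show ?thesis
      using True by (simp add: scaling_def pivot_H_act[OF h] mult_ac)
  qed
  then have "scaling L (H_act h M) i j * (torus_character h i j * M t $ i $ j) = scaling L M i j * M t $ i $ j" for i j t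
    by (simp only: mult.assoc[symmetric])
  then show ?thesis
    by (simp add: fun_eq_iff vec_eq_iff normal_form_def H_act_eq[OF h])
qed

lemma normal_form_eq_H_act:
  assumes "M \<in> chart S L"
  shows "\<exists>h\<in>carrier H. normal_form L M = H_act h M"
proof -
  have nz: "pivot L i j M \<noteq> 0" for i j using assms unfolding chart_def by blast
  have "scaling L M i j \<noteq> 0" for i j using nz by (simp add: scaling_def)
  moreover have "scaling L M 1 1 * scaling L M 2 2 = scaling L M 1 2 * scaling L M 2 1"
    using nz by (simp add: scaling_def)
  ultimately obtain h where h: "h \<in> carrier H" "\<forall>i j. torus_character h i j = scaling L M i j"
    using exists_torus_character[of "scaling L M"] by blast
  then have "normal_form L M = H_act h M" by (simp add: fun_eq_iff normal_form_def H_act_eq)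
  then show ?thesis using h(1) by blast
qed

lemma orbit_normal_form: "M \<in> chart S L \<Longrightarrow> orbit H H_act (normal_form L M) = orbit H H_act M"
  using normal_form_eq_H_act[of M S L] orbit_H_eq_iff[of M "normal_form L M"] by auto

lemma pivot_normal_form:
  assumes "M \<in> chart S L" "\<not> (i = 2 \<and> j = 2)"
  shows "pivot L i j (normal_form L M) = 1"
  using assms unfolding pivot_def ev_normal_form by (auto simp: scaling_def chart_def pivot_def[symmetric])

text \<open>Fixed points are found from three pivots, since \<open>scaling\<close> is built from
  these alone except for the inverse pivot at positions other than (2, 2).\<close>

lemma normal_form_id:
  assumes "\<And>i j. \<not> (i = 2 \<and> j = 2) \<Longrightarrow> pivot L i j M = 1"
  shows "normal_form L M = M"
proof -
  have "scaling L M i j = 1" for i j using assms by (auto simp: scaling_def)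
  then show ?thesis by (simp add: fun_eq_iff vec_eq_iff normal_form_def)
qed

lemma openin_chart: "openin (topo (zar S (range ev))) (chart S L)"
proof -
  define f where "f M = pivot L 1 1 M * (pivot L 1 2 M * (pivot L 2 1 M * pivot L 2 2 M))" for M
  have "f \<in> algebra_generated_by (range ev)"
    unfolding f_def pivot_def by (intro algebra_generated_by.mult algebra_generated_by.gen rangeI)
  from locally_quotient_open(2)[OF locally_quotient_algebra[OF this] order_refl, of S]
  have "openin (topo (zar S (range ev))) {M \<in> S. f M \<noteq> 0}" .
  moreover have "{M \<in> S. f M \<noteq> 0} = chart S L"
    by (auto simp: chart_def f_def forall_2)
  ultimately show ?thesis by simp
qed

lemma locally_quotient_normal_form:
  "locally_quotient S (range ev) (chart S L) (\<lambda>M. ev c (normal_form L M))"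
proof -
  obtain k i j where c: "c = (k, i, j)" by (cases c)
  let ?lq = "locally_quotient S (range ev) (chart S L)"
  have US: "chart S L \<subseteq> S" by (auto simp: chart_def)
  have e: "?lq (ev d)" for d
  proof -
    have "locally_quotient S (range ev) (S \<inter> chart S L) (ev d)"
      by (rule locally_quotient_restrict[OF locally_quotient_gen openin_chart]) simp
    then show ?thesis using US by (simp add: Int_absorb1)
  qed
  have inv: "?lq (\<lambda>M. inverse (pivot L i j M))" for i j
  proof -
    have "locally_quotient S (range ev) {M \<in> chart S L. pivot L i j M \<noteq> 0} (\<lambda>M. inverse (pivot L i j M))"
      unfolding pivot_def by (rule locally_quotient_inverse[OF e US])
    moreover have "{M \<in> chart S L. pivot L i j M \<noteq> 0} = chart S L" unfolding chart_def by blast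
    ultimately show ?thesis by simp
  qed
  have mult: "?lq (\<lambda>M. f M * g M)" if "?lq f" "?lq g" for f g
    using locally_quotient_mult[OF that] by simp
  have "?lq (\<lambda>M. scaling L M i j)"
  proof (cases "i = 2 \<and> j = 2")
    case True
    have "?lq (pivot L 1 1)" unfolding pivot_def using e by simp
    from mult[OF this mult[OF inv inv]] True show ?thesis by (simp add: scaling_def)
  next
    case False
    then have "scaling L N i j = inverse (pivot L i j N)" for N unfolding scaling_def by (rule if_not_P)
    then show ?thesis using inv by simp
  qed
  from mult[OF this e] show ?thesis unfolding c ev_normal_form .
qed

lemma chart_saturated:
  assumes S: "\<And>h M. h \<in> carrier H \<Longrightarrow> M \<in> S \<Longrightarrow> H_act h M \<in> S"
    and M: "M \<in> chart S L" and eq: "orbit H H_act M = orbit H H_act N"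
  shows "N \<in> chart S L" "normal_form L M = normal_form L N"
proof -
  obtain h where h: "h \<in> carrier H" "N = H_act h M" using eq unfolding orbit_H_eq_iff by blast
  show "normal_form L M = normal_form L N" unfolding h(2) normal_form_H_act[OF h(1)] ..
  show "N \<in> chart S L"
    using M S[OF h(1)] torus_character_nonzero[OF h(1)] unfolding h(2) chart_def by (simp add: pivot_H_act[OF h(1)])
qed

lemma normal_form_in_chart:
  assumes S: "\<And>h M. h \<in> carrier H \<Longrightarrow> M \<in> S \<Longrightarrow> H_act h M \<in> S" and M: "M \<in> chart S L"
  shows "normal_form L M \<in> chart S L"
  using chart_saturated(1)[OF S M, of "normal_form L M"] orbit_normal_form[OF M] by simp

text \<open>Stated for any stable \<open>S\<close> because it is used twice: over
  \<open>Vstar\<close>, to compare the two structures on the data space, and over \<open>F\<close>,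
  to describe its charts.\<close>

lemma local_section_normal_form:
  assumes S: "\<And>h M. h \<in> carrier H \<Longrightarrow> M \<in> S \<Longrightarrow> H_act h M \<in> S"
  shows "local_section S (range ev) (orbit H H_act) (chart S L) (normal_form L)"
  unfolding local_section_def
proof (intro conjI ballI impI openin_chart)
  fix M N assume "M \<in> chart S L" "N \<in> S" "orbit H H_act M = orbit H H_act N"
  then show "N \<in> chart S L" "normal_form L M = normal_form L N" using chart_saturated[OF S] by blast+
next
  fix M assume M: "M \<in> chart S L"
  show "normal_form L M \<in> S" using normal_form_in_chart[OF S M] by (simp add: chart_def)
  show "orbit H H_act (normal_form L M) = orbit H H_act M" by (rule orbit_normal_form[OF M])
next
  fix g assume "g \<in> range ev"
  then show "locally_quotient S (range ev) (chart S L) (\<lambda>x. g (normal_form L x))"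
    using locally_quotient_normal_form by auto
qed

lemma exists_chart:
  assumes "M \<in> Vstar q \<rho> \<sigma>" "M \<in> S"
  shows "\<exists>L. M \<in> chart S L"
proof -
  have "\<forall>i j. \<exists>k. ev (k, i, j) M \<noteq> 0" using assms(1) unfolding Vstar_iff by blast
  then obtain L where "\<forall>i j. ev (L i j, i, j) M \<noteq> 0" by metis
  then show ?thesis using assms(2) by (intro exI[of _ L]) (simp add: chart_def pivot_def)
qed

section \<open>The orbit space as a variety\<close>

abbreviation orbit_F :: "(complex \<Rightarrow> complex^2^2) set fspace" where
  "orbit_F \<equiv> quotient_space (zar F (range ev)) (orbit H H_act)"

text \<open>The definition induces the structure from the orbit space of \<open>Vstar\<close>; the
  sections over its charts show that the quotient of \<open>F\<close> alone gives the same one, in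
  which all further computations take place.\<close>

lemma monodromy_data_space_eq: "monodromy_data_space q \<rho> \<sigma> X \<doteq> orbit_F"
proof -
  let ?S = "Vstar q \<rho> \<sigma>"
  have Vs: "Vstar_variety q \<rho> \<sigma> \<doteq> zar ?S (range ev)"
    unfolding Vstar_variety_def by (rule subspace_of_Vmat_variety[OF Vstar_subset_V])
  have "monodromy_data_space q \<rho> \<sigma> X =
      subspace_of (quotient_space (zar ?S (range ev)) (orbit H H_act)) (orbit H H_act ` F)"
    unfolding monodromy_data_space_def orbit_space_def
    by (rule subspace_of_cong[OF quotient_space_cong[OF Vs]])
  also have "\<dots> \<doteq> orbit_F"
  proof (rule subspace_of_quotient_space[OF _ F_subset_Vstar])
    fix M assume "M \<in> F"
    then have M: "M \<in> ?S" using F_subset_Vstar by blast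
    obtain L where "M \<in> chart ?S L" using exists_chart[OF M M] by blast
    then show "\<exists>U r. M \<in> U \<and> local_section ?S (range ev) (orbit H H_act) U r"
      using local_section_normal_form[of ?S L, OF H_act_in_Vstar] by blast
  next
    fix M N assume "M \<in> F" "orbit H H_act M = orbit H H_act N"
    then show "N \<in> F" unfolding orbit_H_eq_iff using H_act_in_F by blast
  qed
  finally show ?thesis .
qed

lemma orbit_chart_preimage: "{M \<in> F. orbit H H_act M \<in> orbit H H_act ` chart F L} = chart F L"
proof
  show "chart F L \<subseteq> {M \<in> F. orbit H H_act M \<in> orbit H H_act ` chart F L}" by (auto simp: chart_def)
  show "{M \<in> F. orbit H H_act M \<in> orbit H H_act ` chart F L} \<subseteq> chart F L"
  proof
    fix M assume "M \<in> {M \<in> F. orbit H H_act M \<in> orbit H H_act ` chart F L}"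
    then obtain N where "N \<in> chart F L" "orbit H H_act M = orbit H H_act N" by auto
    then show "M \<in> chart F L" using chart_saturated(1)[OF H_act_in_F, of N L M] by simp
  qed
qed

lemma openin_orbit_chart: "openin (topo orbit_F) (orbit H H_act ` chart F L)"
  unfolding openin_quotient_space pts_zar orbit_chart_preimage
  using openin_chart by (auto simp: chart_def)

lemma affine_chart: "affine_variety (zar (chart F L) (range ev))"
proof -
  define h where "h z = z (L 1 1, 1, 1) * (z (L 1 2, 1, 2) * (z (L 2 1, 2, 1) * z (L 2 2, 2, 2)))"
    for z :: "2 \<times> 2 \<times> 2 \<Rightarrow> complex"
  have "h \<in> algebra_generated_by (range (\<lambda>c z. z c))"
    unfolding h_def by (intro algebra_generated_by.mult algebra_generated_by.gen rangeI)
  from affine_variety_localised_F[OF this]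
  have "affine_variety (zar {M \<in> F. h (\<lambda>c. ev c M) \<noteq> 0} (range ev))" .
  also have "{M \<in> F. h (\<lambda>c. ev c M) \<noteq> 0} = chart F L"
    by (auto simp: chart_def h_def pivot_def forall_2)
  finally show ?thesis .
qed

text \<open>The section identifies the chart of the orbit space with the slice of normal forms. In
  the eight coordinates the slice is cut out by the vanishing of the determinant at the
  \<open>X k\<close> and by three selected coordinates being 1, with the fourth one and the
  determinant at \<open>base_point\<close> nonzero.\<close>

lemma affine_orbit_chart: "affine_variety (subspace_of orbit_F (orbit H H_act ` chart F L))"
proof -
  let ?\<pi> = "orbit H H_act" and ?U = "chart F L"
  \<comment> \<open>The choice of \<open>M\<close> is immaterial, as the normal form is constant on
    orbits.\<close>
  define s where "s y = normal_form L (SOME M. M \<in> ?U \<and> ?\<pi> M = y)" for y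
  have s: "s (?\<pi> M) = normal_form L M" if M: "M \<in> ?U" for M
  proof -
    define N where "N = (SOME N. N \<in> ?U \<and> ?\<pi> N = ?\<pi> M)"
    have N: "N \<in> ?U \<and> ?\<pi> N = ?\<pi> M" unfolding N_def by (rule someI[of _ M]) (use M in simp)
    then show ?thesis
      using chart_saturated(2)[OF H_act_in_F, of M L N] M unfolding s_def N_def[symmetric] by simp
  qed
  have nf: "normal_form L M \<in> ?U" if "M \<in> ?U" for M by (rule normal_form_in_chart[OF H_act_in_F that])
  have UF: "?U \<subseteq> F" by (auto simp: chart_def)
  have "subspace_of orbit_F (?\<pi> ` ?U) \<doteq> quotient_space (zar ?U (range ev)) ?\<pi>"
  proof (rule subspace_of_quotient_space[OF _ UF])
    fix M assume "M \<in> ?U"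
    then show "\<exists>U r. M \<in> U \<and> local_section F (range ev) ?\<pi> U r"
      using local_section_normal_form[of F L, OF H_act_in_F] by blast
  next
    fix M N assume "M \<in> ?U" "?\<pi> M = ?\<pi> N"
    then show "N \<in> ?U" using chart_saturated(1)[OF H_act_in_F, of M L N] by simp
  qed
  also have "\<dots> \<doteq> zar (?\<pi> ` ?U) ((\<lambda>g y. g (s y)) ` range ev)"
  proof (rule quotient_space_section)
    show "s y \<in> ?U \<and> ?\<pi> (s y) = y" if "y \<in> ?\<pi> ` ?U" for y
      using that s nf orbit_normal_form by auto
    fix g assume "g \<in> range ev"
    then obtain c where g: "g = ev c" by auto
    have "locally_quotient ?U (range ev) (?U \<inter> ?U) (\<lambda>M. ev c (normal_form L M))"
      by (rule locally_quotient_subset[OF locally_quotient_normal_form UF])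
    then have "locally_quotient ?U (range ev) ?U (\<lambda>M. ev c (normal_form L M))" by simp
    then show "locally_quotient ?U (range ev) ?U (\<lambda>M. g (s (?\<pi> M)))"
      by (rule locally_quotient_cong) (simp add: s g)
  qed
  also have "(\<lambda>g y. g (s y)) ` range ev = range (\<lambda>c y. ev c (s y))" by (simp add: image_image)
  finally have eq: "subspace_of orbit_F (?\<pi> ` ?U) \<doteq> zar (?\<pi> ` ?U) (range (\<lambda>c y. ev c (s y)))" .
  let ?A = "algebra_generated_by (range (\<lambda>c z. z c)) :: ((2 \<times> 2 \<times> 2 \<Rightarrow> complex) \<Rightarrow> complex) set"
  define P where "P = range (\<lambda>k. det_poly (X k)) \<union>
    {\<lambda>z. z (L 1 1, 1, 1) + (- 1), \<lambda>z. z (L 1 2, 1, 2) + (- 1), \<lambda>z. z (L 2 1, 2, 1) + (- 1)}"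
  define h where "h z = det_poly base_point z * z (L 2 2, 2, 2)" for z
  have "affine_variety (zar (?\<pi> ` ?U) (range (\<lambda>c y. ev c (s y))))"
  proof (rule affine_variety_zar[where P = P and h = h])
    fix y y' assume y: "y \<in> ?\<pi> ` ?U" "y' \<in> ?\<pi> ` ?U" "\<And>c. ev c (s y) = ev c (s y')"
    obtain M N where MN: "M \<in> ?U" "y = ?\<pi> M" "N \<in> ?U" "y' = ?\<pi> N" using y by auto
    have "normal_form L M = normal_form L N"
      using y(3) nf[OF MN(1)] nf[OF MN(3)] UF F_subset_V
      by (intro ev_eqI) (auto simp: MN s)
    then have "?\<pi> (normal_form L M) = ?\<pi> (normal_form L N)" by (rule arg_cong)
    then show "y = y'" unfolding orbit_normal_form[OF MN(1)] orbit_normal_form[OF MN(3)] MN(2,4) .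
  next
    have coord: "(\<lambda>z. z c + (- 1)) \<in> ?A" for c
      by (intro algebra_generated_by.add algebra_generated_by.const algebra_generated_by.gen rangeI)
    show "p \<in> ?A" if "p \<in> P" for p
      using that coord det_poly_algebra unfolding P_def by blast
    show "h \<in> ?A"
      unfolding h_def by (intro algebra_generated_by.mult det_poly_algebra algebra_generated_by.gen rangeI)
  next
    fix z :: "2 \<times> 2 \<times> 2 \<Rightarrow> complex"
    have zero: "(\<forall>p\<in>P. p z = 0) \<and> h z \<noteq> 0 \<longleftrightarrow>
        lift z \<in> F \<and> z (L 1 1, 1, 1) = 1 \<and> z (L 1 2, 1, 2) = 1 \<and> z (L 2 1, 2, 1) = 1 \<and> z (L 2 2, 2, 2) \<noteq> 0"
      unfolding lift_in_F_iff P_def h_def by auto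
    show "(\<exists>y\<in>?\<pi> ` ?U. \<forall>c. ev c (s y) = z c) \<longleftrightarrow> (\<forall>p\<in>P. p z = 0) \<and> h z \<noteq> 0"
      unfolding zero
    proof
      assume "\<exists>y\<in>?\<pi> ` ?U. \<forall>c. ev c (s y) = z c"
      then obtain M where M: "M \<in> ?U" "\<forall>c. ev c (normal_form L M) = z c" using s by auto
      have z: "(\<lambda>c. ev c (normal_form L M)) = z" using M(2) by auto
      have "lift z = normal_form L M"
        using lift_ev[of "normal_form L M"] nf[OF M(1)] UF F_subset_V unfolding z by auto
      moreover have "z (L i j, i, j) = pivot L i j (normal_form L M)" for i j
        using M(2) by (simp add: pivot_def)
      ultimately show "lift z \<in> F \<and> z (L 1 1, 1, 1) = 1 \<and> z (L 1 2, 1, 2) = 1 \<and> z (L 2 1, 2, 1) = 1 \<and>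
          z (L 2 2, 2, 2) \<noteq> 0"
        using nf[OF M(1)] pivot_normal_form[OF M(1)] by (simp add: chart_def)
    next
      assume *: "lift z \<in> F \<and> z (L 1 1, 1, 1) = 1 \<and> z (L 1 2, 1, 2) = 1 \<and> z (L 2 1, 2, 1) = 1 \<and>
          z (L 2 2, 2, 2) \<noteq> 0"
      have piv: "pivot L i j (lift z) = z (L i j, i, j)" for i j by (simp add: pivot_def ev_lift)
      have "pivot L i j (lift z) \<noteq> 0" for i j
        using * exhaust_2[of i] exhaust_2[of j] unfolding piv by auto
      then have U: "lift z \<in> ?U" using * by (simp add: chart_def)
      have "normal_form L (lift z) = lift z"
      proof (rule normal_form_id)
        show "pivot L i j (lift z) = 1" if "\<not> (i = 2 \<and> j = 2)" for i j
          using * that exhaust_2[of i] exhaust_2[of j] unfolding piv by auto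
      qed
      then show "\<exists>y\<in>?\<pi> ` ?U. \<forall>c. ev c (s y) = z c"
        using U by (intro bexI[of _ "?\<pi> (lift z)"]) (simp_all add: s ev_lift)
    qed
  qed
  then show ?thesis unfolding affine_variety_cong[OF eq] .
qed

lemma pts_orbit_F: "pts orbit_F = orbit H H_act ` F"
  by (simp add: pts_quotient_space pts_zar)

lemma reg_orbit_F:
  "f \<in> reg orbit_F U \<longleftrightarrow> f \<in> extensional U \<and>
    pullback (zar F (range ev)) (orbit H H_act) U f \<in> reg (zar F (range ev)) {M \<in> F. orbit H H_act M \<in> U}"
  by (simp add: quotient_space_def pts_zar)

lemma orbit_charts_cover: "(\<Union>L. orbit H H_act ` chart F L) = orbit H H_act ` F"
proof -
  have "(\<Union>L. chart F L) = F"
    using exists_chart F_subset_Vstar by (auto simp: chart_def)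
  then show ?thesis by (metis image_UN)
qed

lemma variety_orbit_F: "variety orbit_F"
  unfolding variety_def
proof (intro conjI exI[of _ "range (\<lambda>L. orbit H H_act ` chart F L)"])
  show "sheaf_of_functions orbit_F"
    by (rule sheaf_of_functions_quotient_space[OF sheaf_of_functions_zar])
  show "\<Union> (range (\<lambda>L. orbit H H_act ` chart F L)) = pts orbit_F"
    unfolding pts_orbit_F by (rule orbit_charts_cover)
qed (auto simp: openin_orbit_chart affine_orbit_chart)

section \<open>Global invariants and separatedness\<close>

lemma regular_if_invariant:
  assumes g: "locally_quotient F (range ev) F g"
    and inv: "\<And>h M. h \<in> carrier H \<Longrightarrow> M \<in> F \<Longrightarrow> g (H_act h M) = g M"
  shows "\<exists>f\<in>reg orbit_F (pts orbit_F). \<forall>M\<in>F. f (orbit H H_act M) = g M"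
proof -
  let ?\<pi> = "orbit H H_act"
  define f where "f = restrict (\<lambda>y. g (SOME M. M \<in> F \<and> ?\<pi> M = y)) (pts orbit_F)"
  have f: "f (?\<pi> M) = g M" if M: "M \<in> F" for M
  proof -
    define N where "N = (SOME N. N \<in> F \<and> ?\<pi> N = ?\<pi> M)"
    have N: "N \<in> F \<and> ?\<pi> N = ?\<pi> M" unfolding N_def by (rule someI[of _ M]) (use M in simp)
    then obtain h where "h \<in> carrier H" "N = H_act h M" using orbit_H_eq_iff[of M N] by auto
    then show ?thesis using inv M unfolding f_def pts_orbit_F N_def[symmetric] by (simp add: N_def[symmetric])
  qed
  have opn: "openin (topo (zar F (range ev))) F" by (simp add: openin_zar locally_quotient_const)
  have pre: "{M \<in> F. ?\<pi> M \<in> pts orbit_F} = F" by (auto simp: pts_orbit_F)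
  have "locally_quotient F (range ev) F (pullback (zar F (range ev)) ?\<pi> (pts orbit_F) f)"
    using g by (rule locally_quotient_cong) (auto simp: pullback_def pts_zar pts_orbit_F f)
  then have "pullback (zar F (range ev)) ?\<pi> (pts orbit_F) f \<in> reg (zar F (range ev)) F"
    unfolding reg_zar[OF opn] by (simp add: pullback_def pts_zar pre)
  then have "f \<in> reg orbit_F (pts orbit_F)"
    unfolding reg_orbit_F pre by (simp add: f_def)
  then show ?thesis using f by blast
qed

text \<open>A term of the determinant with its two factors taken at independent sample points,
  divided by the determinant at \<open>base_point\<close> to make the weight trivial. The
  conditional selects the column other than \<open>j\<close>.\<close>

definition invariant :: "2 \<Rightarrow> 2 \<Rightarrow> 2 \<Rightarrow> (complex \<Rightarrow> complex^2^2) \<Rightarrow> complex" where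
  "invariant j k l M = ev (k, 1, j) M * ev (l, 2, if j = 1 then 2 else 1) M * inverse (det (M base_point))"

lemma invariant_H_act:
  assumes "h \<in> carrier H"
  shows "invariant j k l (H_act h M) = invariant j k l M"
proof -
  have "torus_character h 1 j * torus_character h 2 (if j = 1 then 2 else 1) =
      torus_character h 1 1 * torus_character h 2 2"
    using exhaust_2[of j] torus_character_rel[OF assms] by auto
  moreover have "torus_character h i j \<noteq> 0" for i j by (rule torus_character_nonzero[OF assms])
  moreover have "a * x * (b * y) * inverse (c * d * w) = x * y * inverse w"
    if "a * b = c * d" "c \<noteq> 0" "d \<noteq> 0" for a b c d x y w :: complex
  proof -
    have "a * x * (b * y) * inverse (c * d * w) = (a * b) * inverse (c * d) * (x * y * inverse w)"
      unfolding inverse_mult_distrib by (simp only: mult_ac)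
    also have "(a * b) * inverse (c * d) = 1" unfolding that(1) by (rule right_inverse) (use that(2,3) in simp)
    finally show ?thesis by simp
  qed
  ultimately show ?thesis
    unfolding invariant_def ev_H_act[OF assms] det_H_act[OF assms] by blast
qed

lemma locally_quotient_invariant: "locally_quotient F (range ev) F (invariant j k l)"
proof -
  have "(\<lambda>M. det_poly t (\<lambda>c. ev c M)) \<in> algebra_generated_by (range ev)" for t
    unfolding det_poly_def entry_poly_def
    by (intro algebra_generated_by.add algebra_generated_by.mult algebra_generated_by.const algebra_generated_by.gen rangeI)
  then have "locally_quotient F (range ev) F (\<lambda>M. det_poly base_point (\<lambda>c. ev c M))"
    by (rule locally_quotient_algebra)
  then have "locally_quotient F (range ev) F (\<lambda>M. det (M base_point))"
    by (rule locally_quotient_cong) (use F_subset_V det_eq_det_poly in auto)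
  from locally_quotient_inverse[OF this order_refl]
  have "locally_quotient F (range ev) {M \<in> F. det (M base_point) \<noteq> 0} (\<lambda>M. inverse (det (M base_point)))" .
  moreover have "{M \<in> F. det (M base_point) \<noteq> 0} = F" using F_iff by blast
  ultimately have d: "locally_quotient F (range ev) F (\<lambda>M. inverse (det (M base_point)))" by simp
  have e: "locally_quotient F (range ev) F (ev c)" for c by (rule locally_quotient_gen) simp
  show ?thesis
    using locally_quotient_mult[OF locally_quotient_mult[OF e e] d] unfolding invariant_def Int_absorb .
qed

text \<open>For each \<open>j\<close> the invariants form a matrix of rank one, so they determine
  the sample values of the two opposite entries up to scalars whose product is the ratio of the
  determinants. This product is the same for both \<open>j\<close>, which is exactly the relation
  under which four scalars come from the torus.\<close>

lemma invariants_separate_orbits: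
  assumes M: "M \<in> F" and N: "N \<in> F" and eq: "\<And>j k l. invariant j k l M = invariant j k l N"
  shows "orbit H H_act M = orbit H H_act N"
proof -
  let ?d = "det (M base_point)" and ?d' = "det (N base_point)"
  have d: "?d \<noteq> 0" "?d' \<noteq> 0" using M N unfolding F_iff by auto
  have "M \<in> Vstar q \<rho> \<sigma>" using M F_subset_Vstar by blast
  then have nz: "\<exists>k. ev (k, i, j) M \<noteq> 0" for i j unfolding Vstar_iff by blast
  have eqd: "ev (k, 1, j) M * ev (l, 2, if j = 1 then 2 else 1) M / ?d =
      ev (k, 1, j) N * ev (l, 2, if j = 1 then 2 else 1) N / ?d'" for j k l
    using eq[of j k l] unfolding invariant_def divide_inverse .
  have ratio: "\<exists>\<alpha> \<beta>. \<alpha> \<noteq> 0 \<and> \<beta> \<noteq> 0 \<and> \<alpha> * \<beta> = ?d' / ?d \<and> (\<forall>k. ev (k, 1, j) N = \<alpha> * ev (k, 1, j) M) \<and>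
      (\<forall>l. ev (l, 2, if j = 1 then 2 else 1) N = \<beta> * ev (l, 2, if j = 1 then 2 else 1) M)" for j
  proof -
    obtain k0 where k0: "ev (k0, 1, j) M \<noteq> 0" using nz by blast
    obtain l0 where l0: "ev (l0, 2, if j = 1 then 2 else 1) M \<noteq> 0" using nz by blast
    show ?thesis
      by (rule proportional_if_outer_products_eq[where a = "\<lambda>k. ev (k, 1, j) M" and a' = "\<lambda>k. ev (k, 1, j) N"
            and b = "\<lambda>l. ev (l, 2, if j = 1 then 2 else 1) M" and b' = "\<lambda>l. ev (l, 2, if j = 1 then 2 else 1) N",
            OF eqd d k0 l0])
  qed
  obtain a b where ab: "a \<noteq> 0" "b \<noteq> 0" "a * b = ?d' / ?d" "\<And>k. ev (k, 1, 1) N = a * ev (k, 1, 1) M"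
    "\<And>k. ev (k, 2, 2) N = b * ev (k, 2, 2) M" using ratio[of 1] by auto
  obtain c e where ce: "c \<noteq> 0" "e \<noteq> 0" "c * e = ?d' / ?d" "\<And>k. ev (k, 1, 2) N = c * ev (k, 1, 2) M"
    "\<And>k. ev (k, 2, 1) N = e * ev (k, 2, 1) M" using ratio[of 2] by auto
  define f :: "2 \<Rightarrow> 2 \<Rightarrow> complex" where
    "f i j = (if i = 1 then (if j = 1 then a else c) else (if j = 1 then e else b))" for i j
  have "f i j \<noteq> 0" for i j using ab ce by (simp add: f_def)
  moreover have "f 1 1 * f 2 2 = f 1 2 * f 2 1" using ab(3) ce(3) by (simp add: f_def)
  ultimately obtain h where h: "h \<in> carrier H" "\<forall>i j. torus_character h i j = f i j"
    using exists_torus_character[of f] by blast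
  have "N = H_act h M"
  proof (rule ev_eqI)
    show "N \<in> V" "H_act h M \<in> V" using M N F_subset_V H_act_in_V[OF h(1)] by auto
    fix c' :: "2 \<times> 2 \<times> 2"
    obtain k i j where c': "c' = (k, i, j)" by (cases c')
    show "ev c' N = ev c' (H_act h M)"
      unfolding c' ev_H_act[OF h(1)] using h(2) exhaust_2[of i] exhaust_2[of j] ab ce
      by (auto simp: f_def)
  qed
  then show ?thesis unfolding orbit_H_eq_iff using h(1) by blast
qed

lemma separated_orbit_F: "separated orbit_F"
proof (rule separatedI)
  fix c
  obtain f where f: "f \<in> reg orbit_F (pts orbit_F)" "\<forall>M\<in>F. f (orbit H H_act M) = c"
    using regular_if_invariant[OF locally_quotient_const, of c] by auto
  have "f \<in> extensional (pts orbit_F)" using f(1) unfolding reg_orbit_F by blast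
  then have "f = restrict (\<lambda>_. c) (pts orbit_F)"
    by (rule extensionalityI[OF _ restrict_extensional]) (use f(2) pts_orbit_F in auto)
  then show "restrict (\<lambda>_. c) (pts orbit_F) \<in> reg orbit_F (pts orbit_F)" using f(1) by simp
next
  fix x y assume "x \<in> pts orbit_F" "y \<in> pts orbit_F" "x \<noteq> y"
  then obtain M N where MN: "M \<in> F" "N \<in> F" "x = orbit H H_act M" "y = orbit H H_act N"
    "orbit H H_act M \<noteq> orbit H H_act N" unfolding pts_orbit_F by auto
  then obtain j k l where ne: "invariant j k l M \<noteq> invariant j k l N"
    using invariants_separate_orbits by blast
  obtain f where "f \<in> reg orbit_F (pts orbit_F)" "\<forall>M\<in>F. f (orbit H H_act M) = invariant j k l M"
    using regular_if_invariant[OF locally_quotient_invariant invariant_H_act] by blast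
  then show "\<exists>f\<in>reg orbit_F (pts orbit_F). f x \<noteq> f y" using MN ne by (intro bexI[of _ f]) auto
qed

lemma geometric_quotient_F:
  "geometric_quotient H H_variety H_act (F_variety q \<rho> \<sigma> X) (monodromy_data_space q \<rho> \<sigma> X) (orbit H H_act)"
proof (rule geometric_quotient_orbit[OF algebraic_action_F])
  let ?Y = "monodromy_data_space q \<rho> \<sigma> X" and ?\<pi> = "orbit H H_act"
  have "quotient_space (F_variety q \<rho> \<sigma> X) ?\<pi> \<doteq> orbit_F" by (rule quotient_space_cong[OF F_variety_zar])
  also have "orbit_F \<doteq> ?Y" by (rule same_structure_sym[OF monodromy_data_space_eq])
  finally show "quotient_space (F_variety q \<rho> \<sigma> X) ?\<pi> \<doteq> ?Y" .
  show "variety ?Y" by (rule variety_cong[OF same_structure_sym[OF monodromy_data_space_eq] variety_orbit_F])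
  have ptsF: "pts (F_variety q \<rho> \<sigma> X) = F" using same_structure_pts[OF F_variety_zar] by (simp add: pts_zar)
  fix y assume "y \<in> pts ?Y"
  then have "y \<in> (\<Union>L. ?\<pi> ` chart F L)"
    unfolding same_structure_pts[OF monodromy_data_space_eq] pts_orbit_F orbit_charts_cover .
  then obtain L where L: "y \<in> ?\<pi> ` chart F L" by (rule UN_E)
  have "openin (topo ?Y) (?\<pi> ` chart F L)"
    unfolding same_structure_openin[OF monodromy_data_space_eq] by (rule openin_orbit_chart)
  moreover have "affine_variety (subspace_of ?Y (?\<pi> ` chart F L))"
    unfolding subspace_of_cong[OF monodromy_data_space_eq] by (rule affine_orbit_chart)
  moreover have "affine_variety (subspace_of (F_variety q \<rho> \<sigma> X) {x \<in> pts (F_variety q \<rho> \<sigma> X). ?\<pi> x \<in> ?\<pi> ` chart F L})"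
  proof -
    have "chart F L \<subseteq> F" by (auto simp: chart_def)
    from affine_variety_cong[OF subspace_of_zar[OF this]] affine_chart
    show ?thesis unfolding ptsF orbit_chart_preimage subspace_of_cong[OF F_variety_zar] by (rule iffD2)
  qed
  ultimately show "\<exists>U. y \<in> U \<and> openin (topo ?Y) U \<and> affine_variety (subspace_of ?Y U) \<and>
      affine_variety (subspace_of (F_variety q \<rho> \<sigma> X) {x \<in> pts (F_variety q \<rho> \<sigma> X). ?\<pi> x \<in> U})"
    by (intro exI[of _ "?\<pi> ` chart F L"] conjI L)
qed

end

theorem theorem3p2:
  fixes q :: complex and \<rho> \<sigma> :: "2 \<Rightarrow> complex" and x :: "4 \<Rightarrow> complex"
  assumes "q \<noteq> 0" and "norm q < 1"
    and "\<forall>i. \<rho> i \<noteq> 0" and "\<forall>j. \<sigma> j \<noteq> 0" and "\<forall>k. x k \<noteq> 0"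
    and "NR q \<rho> \<sigma> x" and "FR \<rho> \<sigma> x" and "NS q \<rho> \<sigma> x"
  shows "geometric_quotient H H_variety H_act
           (F_variety q \<rho> \<sigma> x) (monodromy_data_space q \<rho> \<sigma> x) (orbit H H_act)
       \<and> variety (monodromy_data_space q \<rho> \<sigma> x)
       \<and> separated (monodromy_data_space q \<rho> \<sigma> x)"
proof -
  interpret monodromy q \<rho> \<sigma> x
    by (intro monodromy.intro assms(1,2,6,8) assms(3-5)[rule_format])
  show ?thesis
  proof (intro conjI)
    show "geometric_quotient H H_variety H_act
        (F_variety q \<rho> \<sigma> x) (monodromy_data_space q \<rho> \<sigma> x) (orbit H H_act)"
      by (rule geometric_quotient_F)
    show "variety (monodromy_data_space q \<rho> \<sigma> x)"
      by (rule variety_cong[OF same_structure_sym[OF monodromy_data_space_eq] variety_orbit_F])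
    show "separated (monodromy_data_space q \<rho> \<sigma> x)"
      unfolding separated_cong[OF monodromy_data_space_eq] by (rule separated_orbit_F)
  qed
qed

end
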